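(* Let $\lambda=\lim_n\lambda_n$ be the limit of the maximum eigenvalues of the truncations $\mathbf{A}_n$ (see context). There exists a probability density $f^*$ on $(0,2]$ of the form $$f^*(t)=\ell^*\log(t)+\sum_{k=0}^\infty a_k^*(t-1)^k$$ such that $$(1+C)f^*(x)=\tfrac12 f^*(x/2)+\int_{1+x/2}^2\frac{f^*(y)}{y-1}\,dy\qquad (x\in(0,2]),\qquad C=\int_1^2 f^*(y)\,dy,$$ with $1+C=\lambda$. The coefficient sequence $(\ell^*,a_0^*,a_1^*,\ldots)$ is in $\ell^1_\rho$ for $1\le\rho\le3$. Moreover, starting from any probability density on $(0,2]$ of the form $$f_0(t)=\ell\log(t)+\sum_{k=0}^\infty a_k(t-1)^k,\qquad (\ell,a_0,a_1,\ldots)\in\ell^1,$$ and defining $f_{s}$ for $s\ge1$ recursively by $$(1+C_s)f_{s+1}(x)=\tfrac12 f_s(x/2)+\int_{1+x/2}^2\frac{f_s(y)}{y-1}\,dy,\qquad C_s=\int_1^2 f_s(y)\,dy,$$ we have for each $0<y<2$ $$\lim_{s\to\infty}\ \sup_{y\le t\le 2}|f_s(t)-f^*(t)|=0.$$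
   Context: For $\rho\ge1$, $\ell^1_\rho$ is the space of sequences $(x_n)_{n\ge0}$ with $\sum_n\rho^n|x_n|<\infty$. The infinite real matrix $\mathbf{A}=(\mathbf{A}_{ij})_{i,j\ge 0}$ has the following entries, where $r,k\ge 1$ are integers and $\binom kr=0$ for $k<r$: $\mathbf{A}_{0,0}=\tfrac12$, $\mathbf{A}_{0,1}=-1$, $\mathbf{A}_{0,j}=0$ for $j\ge 2$; $\mathbf{A}_{1,0}=\tfrac{\pi^2}{12}+\sum_{k\ge1}\tfrac{(-1)^k}{k^2 2^k}-\tfrac{\log 2}{2}$, $\mathbf{A}_{1,1}=\tfrac12+\log 2$, $\mathbf{A}_{1,k+1}=\tfrac1k+\tfrac{(-1)^k}{2^{k+1}}-\tfrac1{k2^k}$; $\mathbf{A}_{r+1,0}=\tfrac{(-1)^r}{r}\sum_{j=r}^\infty \tfrac1{j3^j}$, $\mathbf{A}_{r+1,1}=0$, $\mathbf{A}_{r+1,k+1}=\binom kr\left(\tfrac{(-1)^{k-r}}{2^{k+1}}-\tfrac1{k2^k}\right)$. $\mathbf{A}_n$ denotes the $(n+1)\times(n+1)$ principal submatrix of $\mathbf{A}$ with row and column indices $0,\dots,n$. For $n\ge7$, $\mathbf{A}_n$ has a unique eigenvalue $\lambda_n$ of maximum absolute value, which is real, and the sequence $\{\lambda_n\}$ converges. *)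

theory Defs
  imports "HOL-Analysis.Analysis" "Jordan_Normal_Form.Char_Poly"
begin

definition weighted_l1 :: "real \<Rightarrow> (nat \<Rightarrow> real) set" where
  "weighted_l1 \<rho> = {x. summable (\<lambda>n. \<rho> ^ n * \<bar>x n\<bar>)}"

definition prob_density_on :: "real set \<Rightarrow> (real \<Rightarrow> real) \<Rightarrow> bool" where
  "prob_density_on S f \<longleftrightarrow>
     (\<forall>x\<in>S. 0 \<le> f x) \<and> set_integrable lborel S f \<and> (LBINT x:S. f x) = 1"

(* The sequence c encodes (l, a_0, a_1, ...): entry 0 is the coefficient of the logarithm
   and entry Suc k is the coefficient of (t - 1)^k. *)
definition log_series :: "(nat \<Rightarrow> real) \<Rightarrow> real \<Rightarrow> real" where
  "log_series c t = c 0 * ln t + (\<Sum>k. c (Suc k) * (t - 1) ^ k)"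

definition transfer_op :: "(real \<Rightarrow> real) \<Rightarrow> real \<Rightarrow> real" where
  "transfer_op f x = 1 / 2 * f (x / 2) + (LBINT y:{1 + x / 2..2}. f y / (y - 1))"

definition upper_mass :: "(real \<Rightarrow> real) \<Rightarrow> real" where
  "upper_mass f = (LBINT y:{1..2}. f y)"

(* The matrix of transfer_op in the coordinates of log_series.
   Indices are shifted: Suc r and Suc k stand for the powers (t - 1)^r and (t - 1)^k. *)
fun A_entry :: "nat \<Rightarrow> nat \<Rightarrow> real" where
  "A_entry 0 0 = 1 / 2"
| "A_entry 0 (Suc k) = (if k = 0 then - 1 else 0)"
| "A_entry (Suc r) 0 =
     (if r = 0
      then pi\<^sup>2 / 12 + (\<Sum>m. (- 1) ^ Suc m / ((real (Suc m))\<^sup>2 * 2 ^ Suc m)) - ln 2 / 2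
      else (- 1) ^ r / real r * (\<Sum>m. 1 / (real (r + m) * 3 ^ (r + m))))"
| "A_entry (Suc r) (Suc k) =
     (if k = 0 then (if r = 0 then 1 / 2 + ln 2 else 0)
      else if r = 0 then 1 / real k + (- 1) ^ k / 2 ^ (k + 1) - 1 / (real k * 2 ^ k)
      else if r \<le> k then
        real (k choose r) * ((- 1) ^ (k - r) / 2 ^ (k + 1) - 1 / (real k * 2 ^ k))
      else 0)"

definition A_trunc :: "nat \<Rightarrow> complex Matrix.mat" where
  "A_trunc n = Matrix.mat (n + 1) (n + 1) (\<lambda>(i, j). complex_of_real (A_entry i j))"

(* The dominance is over all complex eigenvalues; the dominant one is real. *)
definition max_eigenvalue :: "complex Matrix.mat \<Rightarrow> real" where
  "max_eigenvalue M = (THE l. eigenvalue M (complex_of_real l) \<and>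
     (\<forall>z. eigenvalue M z \<and> z \<noteq> complex_of_real l \<longrightarrow> cmod z < \<bar>l\<bar>))"

end

theory Submission
  imports Defs "HOL-Real_Asymp.Real_Asymp"
begin

text \<open>
  Let $T$ be the transfer operator. For $x \le y$ the difference $Tf(x) - Tf(y)$ is
  $(f(x/2) - f(y/2))/2$ plus the integral of $f(1+u)/u$ from $x/2$ to $y/2$, and $T$ does not
  decrease the mass $m(f)$ of $f \ge 0$. So $T$ maps the cone of all $f \ge 0$ with
  $0 \le f(x) - f(y) \le 4\, m(f) \log(y/x)$ for $x \le y$ into itself, and $T^5$ contracts the
  projective oscillation on it. This yields the leading eigenpair $(v, \lambda)$ and the geometric
  convergence of $T^n f / m(T^n w)$, where $w = c - \log$, to a multiple of $v$ for logarithmically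
  Lipschitz $f$; by positivity the convergence, without a rate, extends to uniform limits of such $f$,
  hence to all $\ell^1$ series.

  In the coordinates of the logarithmic series $T$ is upper triangular apart from the column of
  the logarithm. Below the first two coordinates its weighted $\ell^1$ norm is at most $1/4$
  (weights $2^i$) and $1/2$ (weights $3^i$), so for an eigenvalue of modulus at least $1.08$ all other
  coordinates of the eigenvector are determined by the first one, and the eigenvalue is a fixed point
  of a map that contracts by the factor $0.95$, uniformly in the size of the truncation. As
  $\lambda \ge 1.085$, there is exactly one such eigenvalue close to $\lambda$. The same
  elimination, with weights $3^i$, gives the series of $v$.
\<close>

section \<open>Tame functions\<close>

text \<open>The truncations preserve no cone, so positivity says nothing about their eigenvalues
  directly, and the elimination alone does not show that its fixed points converge to
  \<open>lam\<close>. The link is a residual. Solving the infinite eliminated system at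
  \<open>lam\<close> itself gives a series f for which T f and lam f agree in the logarithm and in
  all positive powers; only the constant term can fail, so T f - lam f is a constant function. The
  functional that reads off the asymptotic coefficient is multiplied by \<open>lam\<close> under T
  and is positive on constants, which forces this constant to be 0. Hence \<open>lam\<close> is an
  approximate fixed point of every large truncated map, and f is a multiple of v. The value 1.085
  matters because the contraction estimate is run for moduli from 1.08 on: the margin 0.005 is the
  room in which the fixed points are located. Five steps occur because four halvings carry the point
  2 to 1/8, where an element of the cone is bounded below by its mass, and one more step turns this
  bound into a slope.\<close>

text \<open>The constant $c = 32/25$ is chosen such that $T w \ge 1.085\, w$ for $w = c - \log$, that is,
  $0.585 + \log 2 \le c \le 1.085 \log 2 / 0.585$.\<close>

definition wt :: "real \<Rightarrow> real" where "wt x = 32 / 25 - ln x"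

text \<open>The weight admits a logarithmic pole at 0 and is at least 1/2 on the interval, so one
  kind of bound covers constants, bounded series and the logarithm. Boundedness itself would not be
  preserved: T 1 contains - log x.\<close>

definition tame :: "(real \<Rightarrow> real) \<Rightarrow> bool" where
  "tame f \<longleftrightarrow> continuous_on {0<..2} f \<and> (\<exists>M. \<forall>x\<in>{0<..2}. \<bar>f x\<bar> \<le> M * wt x)"

definition mass :: "(real \<Rightarrow> real) \<Rightarrow> real" where "mass f = integral {0..2} f"

text \<open>Cutting off outside $(0,2]$ turns the linearity of the operator on tame functions
  into equations between functions.\<close>

definition gcd_op :: "(real \<Rightarrow> real) \<Rightarrow> real \<Rightarrow> real" where
  "gcd_op f x = (if x \<in> {0<..2} then transfer_op f x else 0)"

definition tail_int :: "(real \<Rightarrow> real) \<Rightarrow> real \<Rightarrow> real" where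
  "tail_int f x = integral {1 + x / 2..2} (\<lambda>y. f y / (y - 1))"

lemma ln2_bounds: "6925 / 10000 \<le> ln (2::real)" "ln (2::real) \<le> 694 / 1000"
  using ln_approx_bounds[of 2 3, simplified, simplified eval_nat_numeral, simplified] by (simp_all add: power_divide)

lemma tameI: "continuous_on {0<..2} f \<Longrightarrow> (\<And>x. 0 < x \<Longrightarrow> x \<le> 2 \<Longrightarrow> \<bar>f x\<bar> \<le> M * wt x) \<Longrightarrow> tame f"
  unfolding tame_def by (intro conjI exI[of _ M]) auto

lemma wt_ge_half: "0 < x \<Longrightarrow> x \<le> 2 \<Longrightarrow> 1 / 2 \<le> wt x"
  using ln2_bounds ln_le_cancel_iff[of x 2] by (simp add: wt_def del: ln_le_cancel_iff)

lemma wt_pos: "0 < x \<Longrightarrow> x \<le> 2 \<Longrightarrow> 0 < wt x"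
  using wt_ge_half[of x] by simp

lemma abs_le_wt: "0 < x \<Longrightarrow> x \<le> 2 \<Longrightarrow> \<bar>a\<bar> \<le> c \<Longrightarrow> \<bar>a\<bar> \<le> 2 * c * wt x"
  using wt_ge_half[of x] mult_left_mono[of "1/2" "wt x" "2 * c"] by auto

lemma tame_obtain:
  assumes "tame f" obtains M where "0 \<le> M" "\<And>x. 0 < x \<Longrightarrow> x \<le> 2 \<Longrightarrow> \<bar>f x\<bar> \<le> M * wt x"
proof -
  obtain M where M: "\<forall>x\<in>{0<..2}. \<bar>f x\<bar> \<le> M * wt x" using assms by (auto simp: tame_def)
  have "\<bar>f x\<bar> \<le> \<bar>M\<bar> * wt x" if "0 < x" "x \<le> 2" for x
    using M that wt_pos[of x] order_trans[OF _ mult_right_mono[of M "\<bar>M\<bar>" "wt x"]] by auto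
  then show ?thesis using that[of "\<bar>M\<bar>"] by auto
qed

lemma tame_cont: "tame f \<Longrightarrow> S \<subseteq> {0<..2} \<Longrightarrow> continuous_on S f"
  unfolding tame_def using continuous_on_subset by blast

lemma tame_add: assumes "tame f" "tame g" shows "tame (\<lambda>x. f x + g x)"
proof -
  obtain M N where M: "\<And>x. 0 < x \<Longrightarrow> x \<le> 2 \<Longrightarrow> \<bar>f x\<bar> \<le> M * wt x"
    and N: "\<And>x. 0 < x \<Longrightarrow> x \<le> 2 \<Longrightarrow> \<bar>g x\<bar> \<le> N * wt x"
    using assms tame_obtain by metis
  have "\<bar>f x + g x\<bar> \<le> (M + N) * wt x" if "0 < x" "x \<le> 2" for x
    using M[OF that] N[OF that] by (auto simp: algebra_simps)
  then show ?thesis using assms by (intro tameI) (auto simp: tame_def intro!: continuous_intros)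
qed

lemma tame_cmult: assumes "tame f" shows "tame (\<lambda>x. c * f x)"
proof -
  obtain M where M: "\<And>x. 0 < x \<Longrightarrow> x \<le> 2 \<Longrightarrow> \<bar>f x\<bar> \<le> M * wt x"
    using assms tame_obtain by metis
  have "\<bar>c * f x\<bar> \<le> (\<bar>c\<bar> * M) * wt x" if "0 < x" "x \<le> 2" for x
    using mult_left_mono[OF M[OF that], of "\<bar>c\<bar>"] by (auto simp: abs_mult algebra_simps)
  then show ?thesis using assms by (intro tameI) (auto simp: tame_def intro!: continuous_intros)
qed

lemma tame_diff: "tame f \<Longrightarrow> tame g \<Longrightarrow> tame (\<lambda>x. f x - g x)"
  using tame_add[of f "\<lambda>x. (-1) * g x"] tame_cmult[of g "-1"] by simp

lemma tame_const: "tame (\<lambda>x. c)"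
  unfolding tame_def by (auto intro!: exI[of _ "2 * \<bar>c\<bar>"] continuous_intros) (use abs_le_wt[of _ c "\<bar>c\<bar>"] in auto)

lemma tame_wt: "tame wt"
  unfolding tame_def by (auto intro!: exI[of _ 1] continuous_intros simp: wt_def[abs_def])
    (use wt_pos in \<open>force simp: wt_def\<close>)

lemma tame_ln: "tame ln"
  using tame_diff[OF tame_const[of "32/25"] tame_wt] by (simp add: wt_def)

lemma tame_cong: "tame f \<Longrightarrow> (\<And>x. 0 < x \<Longrightarrow> x \<le> 2 \<Longrightarrow> f x = g x) \<Longrightarrow> tame g"
  unfolding tame_def by (auto cong: continuous_on_cong_simp)

section \<open>Integrability in the presence of a logarithmic pole\<close>

lemma ln_has_integral:
  assumes "0 < b" shows "(ln has_integral (b * ln b - b)) {0..b::real}"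
proof -
  define F where "F = (\<lambda>x::real. x * ln x - x)"
  have "continuous_on {0..b} (\<lambda>x::real. x * ln x)"
    unfolding continuous_on_def
  proof
    fix x :: real assume x: "x \<in> {0..b}"
    show "((\<lambda>x. x * ln x) \<longlongrightarrow> x * ln x) (at x within {0..b})"
    proof (cases "x = 0")
      case True
      have "((\<lambda>x::real. x * ln x) \<longlongrightarrow> 0) (at_right 0)"
        by real_asymp
      then show ?thesis using True assms by (auto simp: at_within_Icc_at_right)
    next
      case False
      then show ?thesis using x by (auto intro!: tendsto_intros)
    qed
  qed
  then have "(ln has_integral (F b - F 0)) {0..b}"
    using assms by (intro fundamental_theorem_of_calculus_interior)
       (auto simp: F_def has_real_derivative_iff_has_vector_derivative[symmetric]
             intro!: derivative_eq_intros continuous_intros)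
  then show ?thesis by (simp add: F_def)
qed

lemma wt_has_integral: "(wt has_integral (114 / 25 - 2 * ln 2)) {0..2}"
  using has_integral_diff[OF has_integral_const_real[of "32 / 25" 0 2] ln_has_integral[of 2]]
  by (simp add: wt_def[abs_def])

lemma tame_abs_integrable:
  assumes "tame f" shows "f absolutely_integrable_on {0..2}"
proof -
  obtain M where M: "\<And>x. 0 < x \<Longrightarrow> x \<le> 2 \<Longrightarrow> \<bar>f x\<bar> \<le> M * wt x"
    using assms tame_obtain by metis
  have "f absolutely_integrable_on {0<..2}"
  proof (rule measurable_bounded_by_integrable_imp_absolutely_integrable)
    show "f \<in> borel_measurable (lebesgue_on {0<..2})"
      using assms by (intro continuous_imp_measurable_on_sets_lebesgue) (auto simp: tame_def)
    have "(\<lambda>x. M * wt x) integrable_on {0..2}"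
      using wt_has_integral by (intro integrable_on_mult_right) (auto simp: integrable_on_def)
    then show "(\<lambda>x. M * wt x) integrable_on {0<..2}"
      by (rule integrable_spike_set_eq[THEN iffD1, rotated])
         (rule negligible_subset[of "{0}"], auto)
  qed (use M in auto)
  then show ?thesis
    by (rule absolutely_integrable_spike_set) (rule negligible_subset[of "{0}"], auto)+
qed

lemma tame_integrable: "tame f \<Longrightarrow> f integrable_on {0..2}"
  using tame_abs_integrable set_lebesgue_integral_eq_integral(1) by blast

lemma tame_integrable_sub:
  assumes "tame f" "0 \<le> a" "b \<le> 2" shows "f integrable_on {a..b}"
  using integrable_on_subinterval[OF tame_integrable[OF assms(1)]] assms by auto

section \<open>The transfer operator\<close>

lemma quot_continuous:
  assumes "tame f" "0 < x" "b \<le> 2" shows "continuous_on {1 + x / 2..b} (\<lambda>y. f y / (y - 1))"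
  by (rule continuous_on_divide) (use assms in \<open>auto intro!: continuous_intros tame_cont[OF assms(1)]\<close>)

lemma quot_integrable:
  "tame f \<Longrightarrow> 0 < x \<Longrightarrow> b \<le> 2 \<Longrightarrow> (\<lambda>y. f y / (y - 1)) integrable_on {1 + x / 2..b}"
  by (intro integrable_continuous_real quot_continuous)

lemma gcd_op_eq:
  assumes "tame f" "0 < x" "x \<le> 2" shows "gcd_op f x = f (x / 2) / 2 + tail_int f x"
  using set_borel_integral_eq_integral(2)[OF borel_integrable_atLeastAtMost'[OF quot_continuous[OF assms(1,2) order_refl]]] assms
  by (simp add: gcd_op_def transfer_op_def tail_int_def)

lemma gcd_op_outside: "\<not> (0 < x \<and> x \<le> 2) \<Longrightarrow> gcd_op f x = 0"
  by (auto simp: gcd_op_def)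

lemma upper_mass_eq:
  assumes "tame f" shows "upper_mass f = integral {1..2} f"
  unfolding upper_mass_def
  by (intro set_borel_integral_eq_integral(2) borel_integrable_atLeastAtMost' tame_cont[OF assms]) auto

lemma tail_int_split:
  assumes "tame f" "0 < x" "x \<le> y" "y \<le> 2"
  shows "tail_int f x = integral {1 + x / 2..1 + y / 2} (\<lambda>y. f y / (y - 1)) + tail_int f y"
  unfolding tail_int_def
  using assms Henstock_Kurzweil_Integration.integral_combine[OF _ _ quot_integrable[OF assms(1,2) order_refl], of "1 + y / 2"] by auto

lemma recip_integral:
  fixes c x y :: real
  assumes "0 < x" "x \<le> y"
  shows "((\<lambda>t. c / (t - 1)) has_integral c * ln (y / x)) {1 + x / 2..1 + y / 2}"
proof -
  have "((\<lambda>t. c / (t - 1)) has_integral (c * ln (1 + y / 2 - 1) - c * ln (1 + x / 2 - 1))) {1 + x / 2..1 + y / 2}"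
    by (rule fundamental_theorem_of_calculus)
       (use assms in \<open>auto simp: has_real_derivative_iff_has_vector_derivative[symmetric]
         intro!: derivative_eq_intros\<close>)
  moreover have "c * ln (1 + y / 2 - 1) - c * ln (1 + x / 2 - 1) = c * ln (y / x)"
    using assms by (simp add: ln_div algebra_simps)
  ultimately show ?thesis by simp
qed

text \<open>Bounds on [1, 2] suffice because 1 + x/2 never leaves that interval. The kernel
  integrates to log(y/x), which is where the logarithmic modulus of the cone comes from.\<close>

lemma tail_int_diff_le:
  assumes "tame f" "0 < x" "x \<le> y" "y \<le> 2" "\<And>t. 1 \<le> t \<Longrightarrow> t \<le> 2 \<Longrightarrow> f t \<le> M"
  shows "tail_int f x - tail_int f y \<le> M * ln (y / x)"
proof -
  have "integral {1 + x / 2..1 + y / 2} (\<lambda>y. f y / (y - 1)) \<le> M * ln (y / x)"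
    by (rule has_integral_le[OF integrable_integral recip_integral])
       (use assms in \<open>auto intro!: quot_integrable divide_right_mono\<close>)
  then show ?thesis using tail_int_split[OF assms(1-4)] by simp
qed

lemma tail_int_diff_ge:
  assumes "tame f" "0 < x" "x \<le> y" "y \<le> 2" "\<And>t. 1 \<le> t \<Longrightarrow> t \<le> 2 \<Longrightarrow> M \<le> f t"
  shows "M * ln (y / x) \<le> tail_int f x - tail_int f y"
proof -
  have "M * ln (y / x) \<le> integral {1 + x / 2..1 + y / 2} (\<lambda>y. f y / (y - 1))"
    by (rule has_integral_le[OF recip_integral integrable_integral])
       (use assms in \<open>auto intro!: quot_integrable divide_right_mono\<close>)
  then show ?thesis using tail_int_split[OF assms(1-4)] by simp
qed

lemma tail_int_2 [simp]: "tail_int f 2 = 0"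
  by (simp add: tail_int_def)

lemma gcd_op_add:
  assumes "tame f" "tame g" shows "gcd_op (\<lambda>x. f x + g x) = (\<lambda>x. gcd_op f x + gcd_op g x)"
proof
  fix x show "gcd_op (\<lambda>x. f x + g x) x = gcd_op f x + gcd_op g x"
  proof (cases "0 < x \<and> x \<le> 2")
    case True
    then have "tail_int (\<lambda>x. f x + g x) x = tail_int f x + tail_int g x"
      unfolding tail_int_def add_divide_distrib
      by (intro integral_add quot_integrable assms) auto
    then show ?thesis using True by (simp add: gcd_op_eq assms tame_add field_simps)
  qed (simp add: gcd_op_outside)
qed

lemma gcd_op_cmult:
  assumes "tame f" shows "gcd_op (\<lambda>x. c * f x) = (\<lambda>x. c * gcd_op f x)"
proof
  fix x show "gcd_op (\<lambda>x. c * f x) x = c * gcd_op f x"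
  proof (cases "0 < x \<and> x \<le> 2")
    case True
    have "tail_int (\<lambda>x. c * f x) x = c * tail_int f x"
      unfolding tail_int_def times_divide_eq_right[symmetric] by (rule integral_mult_right)
    then show ?thesis using True by (simp add: gcd_op_eq assms tame_cmult field_simps)
  qed (simp add: gcd_op_outside)
qed

lemma gcd_op_diff:
  "tame f \<Longrightarrow> tame g \<Longrightarrow> gcd_op (\<lambda>x. f x - g x) = (\<lambda>x. gcd_op f x - gcd_op g x)"
  using gcd_op_add[of f "\<lambda>x. (-1) * g x"] tame_cmult[of g "-1"] gcd_op_cmult[of g "-1"] by simp

lemma gcd_op_cong:
  assumes "\<And>x. 0 < x \<Longrightarrow> x \<le> 2 \<Longrightarrow> f x = g x" shows "gcd_op f = gcd_op g"
proof
  fix x :: real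
  have "(LBINT y:{1 + x / 2..2}. f y / (y - 1)) = (LBINT y:{1 + x / 2..2}. g y / (y - 1))" if "0 < x"
    by (intro set_lebesgue_integral_cong) (use that assms in auto)
  then show "gcd_op f x = gcd_op g x"
    using assms by (auto simp: gcd_op_def transfer_op_def)
qed

lemma gcd_op_mono:
  assumes "tame f" "tame g" "\<And>x. 0 < x \<Longrightarrow> x \<le> 2 \<Longrightarrow> f x \<le> g x" shows "gcd_op f x \<le> gcd_op g x"
proof (cases "0 < x \<and> x \<le> 2")
  case True
  then have "tail_int f x \<le> tail_int g x" unfolding tail_int_def
    by (intro integral_le quot_integrable assms(1,2)) (auto intro!: divide_right_mono assms(3))
  then show ?thesis using True assms(3)[of "x/2"] by (simp add: gcd_op_eq assms(1,2))
qed (simp add: gcd_op_outside)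

lemma log_Lipschitz_continuous:
  fixes f :: "real \<Rightarrow> real"
  assumes "\<And>x y. 0 < x \<Longrightarrow> x \<le> y \<Longrightarrow> y \<le> 2 \<Longrightarrow> \<bar>f x - f y\<bar> \<le> M * ln (y / x)"
  shows "continuous_on {0<..2} f"
proof -
  have bd: "\<bar>f x - f y\<bar> \<le> M * \<bar>ln y - ln x\<bar>" if "x \<in> {0<..2}" "y \<in> {0<..2}" for x y :: real
    using that assms[of x y] assms[of y x]
    by (cases "x \<le> y") (auto simp: ln_div abs_minus_commute)
  show ?thesis unfolding continuous_on_def
  proof
    fix x :: real assume x: "x \<in> {0<..2}"
    have "((\<lambda>y. M * \<bar>ln y - ln x\<bar>) \<longlongrightarrow> M * \<bar>ln x - ln x\<bar>) (at x within {0<..2})"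
      using x by (intro tendsto_intros) auto
    moreover have "\<forall>\<^sub>F y in at x within {0<..2}. norm (f y - f x) \<le> M * \<bar>ln y - ln x\<bar>"
      using bd[OF _ x] unfolding eventually_at_filter
      by (intro always_eventually) (simp add: abs_minus_commute[of "ln x"])
    ultimately have "((\<lambda>y. f y - f x) \<longlongrightarrow> 0) (at x within {0<..2})"
      using Lim_null_comparison[of "\<lambda>y. f y - f x" "\<lambda>y. M * \<bar>ln y - ln x\<bar>"] by simp
    then show "(f \<longlongrightarrow> f x) (at x within {0<..2})" by (simp add: LIM_zero_iff)
  qed
qed

lemma tame_upper_bounded:
  assumes "tame f" obtains M where "0 \<le> M" "\<And>t. 1 \<le> t \<Longrightarrow> t \<le> 2 \<Longrightarrow> \<bar>f t\<bar> \<le> M"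
proof -
  obtain M where M: "0 \<le> M" "\<And>x. 0 < x \<Longrightarrow> x \<le> 2 \<Longrightarrow> \<bar>f x\<bar> \<le> M * wt x"
    using assms tame_obtain by metis
  have "\<bar>f t\<bar> \<le> M * 2" if "1 \<le> t" "t \<le> 2" for t
  proof -
    have "wt t \<le> 2" using ln_ge_zero[OF that(1)] unfolding wt_def by linarith
    then have "M * wt t \<le> M * 2" using M(1) by (rule mult_left_mono)
    then show ?thesis using M(2)[of t] that by simp
  qed
  then show ?thesis using that[of "M * 2"] M(1) by auto
qed

lemma ln_2_div_le_wt: "0 < x \<Longrightarrow> x \<le> 2 \<Longrightarrow> ln (2 / x) \<le> wt x"
  using ln2_bounds by (simp add: wt_def ln_div)

lemma tail_int_log_Lipschitz:
  assumes "tame f"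
  obtains M where "0 \<le> M"
    "\<And>x y. 0 < x \<Longrightarrow> x \<le> y \<Longrightarrow> y \<le> 2 \<Longrightarrow> \<bar>tail_int f x - tail_int f y\<bar> \<le> M * ln (y / x)"
proof -
  obtain M where M: "0 \<le> M" "\<And>t. 1 \<le> t \<Longrightarrow> t \<le> 2 \<Longrightarrow> \<bar>f t\<bar> \<le> M"
    using assms tame_upper_bounded by blast
  have M': "- M \<le> f t" "f t \<le> M" if "1 \<le> t" "t \<le> 2" for t using M(2)[OF that] by auto
  have S: "\<bar>tail_int f x - tail_int f y\<bar> \<le> M * ln (y / x)" if "0 < x" "x \<le> y" "y \<le> 2" for x y
    using tail_int_diff_le[OF assms that M'(2)] tail_int_diff_ge[OF assms that M'(1)] by auto
  then show ?thesis using that M(1) by blast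
qed

lemma tame_gcd_op: assumes "tame f" shows "tame (gcd_op f)"
proof -
  obtain M where M: "0 \<le> M"
    and S: "\<And>x y. 0 < x \<Longrightarrow> x \<le> y \<Longrightarrow> y \<le> 2 \<Longrightarrow> \<bar>tail_int f x - tail_int f y\<bar> \<le> M * ln (y / x)"
    using tail_int_log_Lipschitz[OF assms] by metis
  obtain N where N: "0 \<le> N" "\<And>x. 0 < x \<Longrightarrow> x \<le> 2 \<Longrightarrow> \<bar>f x\<bar> \<le> N * wt x"
    using assms tame_obtain by metis
  have c: "continuous_on {0<..2} (\<lambda>x. f (x / 2) / 2 + tail_int f x)"
    by (intro continuous_intros log_Lipschitz_continuous[OF S]
          continuous_on_compose2[OF tame_cont[OF assms order_refl]]) auto
  have "\<bar>gcd_op f x\<bar> \<le> (2 * N + M) * wt x" if x: "0 < x" "x \<le> 2" for x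
  proof -
    have "\<bar>f (x / 2)\<bar> \<le> N * wt (x / 2)" using N(2)[of "x/2"] x by simp
    also have "wt (x / 2) \<le> 4 * wt x"
      using x wt_ge_half[of x] ln2_bounds by (simp add: wt_def ln_div)
    finally have "\<bar>f (x / 2)\<bar> \<le> N * (4 * wt x)" using N(1) by (auto simp: mult_left_mono)
    moreover have "M * ln (2 / x) \<le> M * wt x"
      using M ln_2_div_le_wt[OF x] by (intro mult_left_mono) auto
    ultimately show ?thesis using x S[of x 2] by (auto simp: gcd_op_eq assms algebra_simps)
  qed
  moreover have "continuous_on {0<..2} (gcd_op f)"
    by (rule continuous_on_eq[OF c]) (simp add: gcd_op_eq assms)
  ultimately show ?thesis by (intro tameI)
qed

section \<open>Growth of the mass under the operator\<close>

lemma integral_tame_deriv: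
  assumes "tame f" "0 < x" "x < 2"
  shows "((\<lambda>u. integral {0..u} f) has_real_derivative f x) (at x)"
proof -
  have "continuous_on {0<..<2} f" by (rule tame_cont[OF assms(1)]) auto
  then have "isCont f x" using assms by (simp add: continuous_on_eq_continuous_at)
  then have "((\<lambda>u. integral {0..u} f) has_vector_derivative f x) (at x within {0..2})"
    using assms integral_has_vector_derivative_continuous_at[OF tame_integrable[OF assms(1)], of x "{}"]
      continuous_at_imp_continuous_at_within[of x f "{0..2}"] by simp
  then show ?thesis using assms
    by (simp add: has_real_derivative_iff_has_vector_derivative at_within_Icc_at)
qed

lemma tail_int_deriv:
  assumes "tame f" "0 < x" "x < 2"
  shows "(tail_int f has_real_derivative (- f (1 + x / 2) / x)) (at x)"
proof -
  let ?g = "\<lambda>y. f y / (y - 1)" and ?a = "1 + x / 4"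
  have "((\<lambda>u. integral {u..2} ?g) has_real_derivative - ?g (1 + x / 2)) (at (1 + x / 2) within {?a..2})"
    by (rule integral_has_real_derivative') (use quot_continuous[OF assms(1), of "x/2" 2] assms in auto)
  then have "((\<lambda>u. integral {u..2} ?g) has_real_derivative - ?g (1 + x / 2)) (at (1 + x / 2))"
    using assms by (subst (asm) at_within_Icc_at) auto
  then have "((\<lambda>u. integral {1 + u / 2..2} ?g) has_real_derivative (- ?g (1 + x / 2)) * (1 / 2)) (at x)"
    by (rule DERIV_chain2) (auto intro!: derivative_eq_intros)
  then show ?thesis using assms by (simp add: tail_int_def[abs_def])
qed

text \<open>Obtained from an explicit primitive of T f. For a density f it makes 1 + C the mass of T
  f, so the nonlinear recursion of the theorem is T followed by normalisation.\<close>

lemma mass_gcd_op: assumes "tame f" shows "mass (gcd_op f) = mass f + integral {1..2} f"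
proof -
  define F where "F = (\<lambda>u. integral {0..u} f)"
  \<comment> \<open>Differentiating x times the tail integral leaves - f(1 + x/2) besides the tail
    integral itself, and the derivative of the last summand cancels exactly this; the first summand
    yields f(x/2)/2.\<close>
  define G where "G = (\<lambda>x. F (x / 2) + x * tail_int f x + 2 * F (1 + x / 2))"
  have Fc: "continuous_on {0..2} F"
    unfolding F_def by (rule indefinite_integral_continuous_1[OF tame_integrable[OF assms]])
  obtain M where M: "0 \<le> M"
    and S: "\<And>x y. 0 < x \<Longrightarrow> x \<le> y \<Longrightarrow> y \<le> 2 \<Longrightarrow> \<bar>tail_int f x - tail_int f y\<bar> \<le> M * ln (y / x)"
    using tail_int_log_Lipschitz[OF assms] by metis
  \<comment> \<open>Only the endpoint 0 is delicate: the tail integral may grow like log(2/x) there,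
    and x log(2/x) tends to 0.\<close>
  have xS: "continuous_on {0..2} (\<lambda>x. x * tail_int f x)"
    unfolding continuous_on_def
  proof
    fix x :: real assume x: "x \<in> {0..2}"
    show "((\<lambda>x. x * tail_int f x) \<longlongrightarrow> x * tail_int f x) (at x within {0..2})"
    proof (cases "x = 0")
      case True
      have "((\<lambda>x::real. M * (x * ln (2 / x))) \<longlongrightarrow> 0) (at_right 0)" by real_asymp
      moreover have "\<forall>\<^sub>F x in at_right 0. norm (x * tail_int f x) \<le> M * (x * ln (2 / x))"
        unfolding eventually_at_right_field
      proof (intro exI[of _ 2] conjI allI impI)
        fix y :: real assume y: "0 < y" "y < 2"
        have "y * \<bar>tail_int f y\<bar> \<le> y * (M * ln (2 / y))"
          using S[of y 2] y by (intro mult_left_mono) auto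
        then show "norm (y * tail_int f y) \<le> M * (y * ln (2 / y))"
          using y by (simp add: abs_mult mult_ac)
      qed simp
      ultimately have "((\<lambda>x. x * tail_int f x) \<longlongrightarrow> 0) (at_right 0)"
        by (rule Lim_null_comparison[rotated])
      then show ?thesis using True by (auto simp: at_within_Icc_at_right)
    next
      case False
      have "continuous_on {0<..2} (\<lambda>x. x * tail_int f x)"
        by (intro continuous_intros log_Lipschitz_continuous[OF S])
      then have "((\<lambda>x. x * tail_int f x) \<longlongrightarrow> x * tail_int f x) (at x within {0<..2})"
        using False x by (auto simp: continuous_on_def)
      moreover have "at x within {0<..2} = at x within {0..2}"
        by (rule at_within_nhd[of x "{0<..}"]) (use False x in auto)
      ultimately show ?thesis by simp
    qed
  qed
  have "(gcd_op f has_integral (G 2 - G 0)) {0..2}"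
  proof (rule fundamental_theorem_of_calculus_interior)
    show "continuous_on {0..2} G" unfolding G_def
      by (intro continuous_intros xS continuous_on_compose2[OF Fc]) auto
    fix x :: real assume x: "x \<in> {0<..<2}"
    have 1: "((\<lambda>x. F (x / 2)) has_real_derivative f (x / 2) * (1 / 2)) (at x)"
      by (rule DERIV_chain2[of F])
        (use x in \<open>auto intro!: derivative_eq_intros integral_tame_deriv[OF assms] simp: F_def\<close>)
    have 2: "((\<lambda>x. F (1 + x / 2)) has_real_derivative f (1 + x / 2) * (1 / 2)) (at x)"
      by (rule DERIV_chain2[of F])
        (use x in \<open>auto intro!: derivative_eq_intros integral_tame_deriv[OF assms] simp: F_def\<close>)
    have "(G has_real_derivative (f (x / 2) * (1 / 2) + (1 * tail_int f x + (- f (1 + x / 2) / x) * x)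
            + 2 * (f (1 + x / 2) * (1 / 2)))) (at x)"
      unfolding G_def
      by (rule derivative_eq_intros refl 1 2 tail_int_deriv[OF assms] | use x in force)+
    moreover have "f (x / 2) * (1 / 2) + (1 * tail_int f x + (- f (1 + x / 2) / x) * x)
            + 2 * (f (1 + x / 2) * (1 / 2)) = gcd_op f x"
      using x by (simp add: gcd_op_eq assms)
    ultimately show "(G has_vector_derivative gcd_op f x) (at x)"
      by (simp add: has_real_derivative_iff_has_vector_derivative)
  qed simp
  then have "mass (gcd_op f) = G 2 - G 0" unfolding mass_def by (rule integral_unique)
  moreover have "F 1 + integral {1..2} f = F 2"
    unfolding F_def by (rule Henstock_Kurzweil_Integration.integral_combine) (use tame_integrable_sub[OF assms, of 0 2] in auto)
  ultimately show ?thesis by (simp add: G_def F_def mass_def)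
qed

lemma mass_add: "tame f \<Longrightarrow> tame g \<Longrightarrow> mass (\<lambda>x. f x + g x) = mass f + mass g"
  unfolding mass_def by (intro integral_add tame_integrable)

lemma mass_diff: "tame f \<Longrightarrow> tame g \<Longrightarrow> mass (\<lambda>x. f x - g x) = mass f - mass g"
  unfolding mass_def by (intro integral_diff tame_integrable)

lemma mass_cmult: "mass (\<lambda>x. c * f x) = c * mass f"
  unfolding mass_def by simp

lemma integral_mono_tame:
  assumes "tame f" "tame g" "0 \<le> a" "b \<le> 2" "\<And>x. 0 < x \<Longrightarrow> a \<le> x \<Longrightarrow> x \<le> b \<Longrightarrow> f x \<le> g x"
  shows "integral {a..b} f \<le> integral {a..b} g"
proof -
  have "integral {a..b} f = integral {a..b} (\<lambda>x. if x = 0 then g 0 else f x)"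
    by (rule integral_spike[of "{0}"]) auto
  also have "\<dots> \<le> integral {a..b} g"
  proof (rule integral_le)
    show "(\<lambda>x. if x = 0 then g 0 else f x) integrable_on {a..b}"
      by (rule integrable_spike[OF tame_integrable_sub[OF assms(1)], of a b "{0}"]) (use assms in auto)
  qed (use assms tame_integrable_sub[OF assms(2)] in auto)
  finally show ?thesis .
qed

lemma mass_mono:
  "tame f \<Longrightarrow> tame g \<Longrightarrow> (\<And>x. 0 < x \<Longrightarrow> x \<le> 2 \<Longrightarrow> f x \<le> g x) \<Longrightarrow> mass f \<le> mass g"
  unfolding mass_def by (rule integral_mono_tame) auto

lemma mass_const: "mass (\<lambda>x. c) = 2 * c"
  by (simp add: mass_def)

lemma mass_wt: "mass wt = 114 / 25 - 2 * ln 2"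
  using integral_unique[OF wt_has_integral] by (simp add: mass_def)

section \<open>A contracted cone\<close>

text \<open>The constant 4 exceeds the 3 of \<open>log_cone_gcd_op\<close>; the surplus absorbs the
  subtraction of a multiple of \<open>wt\<close> in \<open>log_cone_comparable\<close>. Positivity
  is asked at 2 only, since monotonicity spreads it. As the mass is linear, the set is a convex
  cone.\<close>

definition log_cone :: "(real \<Rightarrow> real) set" where
  "log_cone = {f. tame f \<and> 0 \<le> f 2 \<and>
     (\<forall>x y. 0 < x \<longrightarrow> x \<le> y \<longrightarrow> y \<le> 2 \<longrightarrow> 0 \<le> f x - f y \<and> f x - f y \<le> 4 * mass f * ln (y / x))}"

lemma log_coneI:
  assumes "tame f" "0 \<le> f 2"
    "\<And>x y. 0 < x \<Longrightarrow> x \<le> y \<Longrightarrow> y \<le> 2 \<Longrightarrow> 0 \<le> f x - f y"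
    "\<And>x y. 0 < x \<Longrightarrow> x \<le> y \<Longrightarrow> y \<le> 2 \<Longrightarrow> f x - f y \<le> 4 * mass f * ln (y / x)"
  shows "f \<in> log_cone"
  using assms by (simp add: log_cone_def)

lemma log_coneD:
  assumes "f \<in> log_cone"
  shows "tame f" "0 \<le> f 2"
    "0 < x \<Longrightarrow> x \<le> y \<Longrightarrow> y \<le> 2 \<Longrightarrow> f y \<le> f x"
    "0 < x \<Longrightarrow> x \<le> y \<Longrightarrow> y \<le> 2 \<Longrightarrow> f x - f y \<le> 4 * mass f * ln (y / x)"
  using assms by (auto simp: log_cone_def)

lemma log_cone_nonneg: "f \<in> log_cone \<Longrightarrow> 0 < x \<Longrightarrow> x \<le> 2 \<Longrightarrow> 0 \<le> f x"
  using log_coneD(2) log_coneD(3)[of f x 2] by fastforce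

lemma log_cone_add:
  assumes "f \<in> log_cone" "g \<in> log_cone" shows "(\<lambda>x. f x + g x) \<in> log_cone"
proof (rule log_coneI)
  fix x y :: real assume xy: "0 < x" "x \<le> y" "y \<le> 2"
  show "0 \<le> f x + g x - (f y + g y)"
    using log_coneD(3)[OF assms(1) xy] log_coneD(3)[OF assms(2) xy] by simp
  show "f x + g x - (f y + g y) \<le> 4 * mass (\<lambda>x. f x + g x) * ln (y / x)"
    using log_coneD(4)[OF assms(1) xy] log_coneD(4)[OF assms(2) xy]
      mass_add[OF log_coneD(1)[OF assms(1)] log_coneD(1)[OF assms(2)]] by (simp add: algebra_simps)
qed (use assms log_coneD tame_add in auto)

lemma log_cone_cmult:
  assumes "f \<in> log_cone" "0 \<le> c" shows "(\<lambda>x. c * f x) \<in> log_cone"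
proof (rule log_coneI)
  fix x y :: real assume xy: "0 < x" "x \<le> y" "y \<le> 2"
  show "0 \<le> c * f x - c * f y"
    using mult_left_mono[OF log_coneD(3)[OF assms(1) xy] assms(2)] by simp
  show "c * f x - c * f y \<le> 4 * mass (\<lambda>x. c * f x) * ln (y / x)"
    using mult_left_mono[OF log_coneD(4)[OF assms(1) xy] assms(2)] by (simp add: mass_cmult algebra_simps)
qed (use assms log_coneD tame_cmult in auto)

lemma log_cone_mass_ge_2: "f \<in> log_cone \<Longrightarrow> 2 * f 2 \<le> mass f"
  using mass_mono[OF tame_const log_coneD(1), of f "f 2"] log_coneD(3)[of f _ 2] by (simp add: mass_const)

lemma log_cone_mass_nonneg: "f \<in> log_cone \<Longrightarrow> 0 \<le> mass f"
  using log_cone_mass_ge_2 log_coneD(2) by fastforce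

lemma mass_split: "tame f \<Longrightarrow> 0 \<le> c \<Longrightarrow> c \<le> 2 \<Longrightarrow> mass f = integral {0..c} f + integral {c..2} f"
  unfolding mass_def
  by (rule Henstock_Kurzweil_Integration.integral_combine[symmetric]) (auto simp: tame_integrable)

lemma log_cone_mass_ge_1:
  assumes "f \<in> log_cone" shows "f 1 \<le> mass f"
proof -
  have "integral {0..1::real} (\<lambda>x. f 1) \<le> integral {0..1} f"
    by (rule integral_mono_tame) (use assms log_coneD in \<open>auto simp: tame_const\<close>)
  moreover have "integral {1..2::real} (\<lambda>x. 0) \<le> integral {1..2} f"
    by (rule integral_mono_tame) (use assms log_coneD log_cone_nonneg in \<open>auto simp: tame_const\<close>)
  ultimately show ?thesis using mass_split[OF log_coneD(1)[OF assms], of 1] by simp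
qed

lemma nonneg_mass_gcd_op:
  assumes "tame f" "\<And>x. 0 < x \<Longrightarrow> x \<le> 2 \<Longrightarrow> 0 \<le> f x"
  shows "mass f \<le> mass (gcd_op f)" "mass (gcd_op f) \<le> 2 * mass f"
proof -
  have "integral {1..2::real} (\<lambda>x. 0) \<le> integral {1..2} f" "integral {0..1::real} (\<lambda>x. 0) \<le> integral {0..1} f"
    by (rule integral_mono_tame; use assms in \<open>auto simp: tame_const\<close>)+
  then show "mass f \<le> mass (gcd_op f)" "mass (gcd_op f) \<le> 2 * mass f"
    using mass_gcd_op[OF assms(1)] mass_split[OF assms(1), of 1] by auto
qed

text \<open>Halving both arguments keeps log(y/x), and the factor 1/2 turns the slope 4 into 2; the
  tail integral adds at most f(1), which is at most the mass. The lower slope f(2) comes from the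
  tail integral alone and is what later produces strict interior points.\<close>

lemma log_cone_gcd_op:
  assumes f: "f \<in> log_cone"
  shows "gcd_op f \<in> log_cone"
    and "0 < x \<Longrightarrow> x \<le> y \<Longrightarrow> y \<le> 2 \<Longrightarrow> f 2 * ln (y / x) \<le> gcd_op f x - gcd_op f y"
    and "0 < x \<Longrightarrow> x \<le> y \<Longrightarrow> y \<le> 2 \<Longrightarrow> gcd_op f x - gcd_op f y \<le> 3 * mass f * ln (y / x)"
proof -
  note t = log_coneD(1)[OF f]
  have lo: "f 2 * ln (y / x) \<le> gcd_op f x - gcd_op f y" if "0 < x" "x \<le> y" "y \<le> 2" for x y
    using tail_int_diff_ge[OF t that, of "f 2"] log_coneD(3)[OF f, of _ 2] that
      log_coneD(3)[OF f, of "x/2" "y/2"] by (simp add: gcd_op_eq[OF t])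
  have hi: "gcd_op f x - gcd_op f y \<le> 3 * mass f * ln (y / x)" if xy: "0 < x" "x \<le> y" "y \<le> 2" for x y
  proof -
    have "0 \<le> ln (y / x)" using xy by simp
    then have "f 1 * ln (y / x) \<le> mass f * ln (y / x)"
      using log_cone_mass_ge_1[OF f] by (rule mult_right_mono[rotated])
    then show ?thesis
      using tail_int_diff_le[OF t xy, of "f 1"] log_coneD(3)[OF f, of 1] xy
        log_coneD(4)[OF f, of "x/2" "y/2"] by (simp add: gcd_op_eq[OF t])
  qed
  have "gcd_op f \<in> log_cone"
  proof (rule log_coneI)
    show "0 \<le> gcd_op f 2" using log_cone_nonneg[OF f, of 1] by (simp add: gcd_op_eq[OF t])
    fix x y :: real assume xy: "0 < x" "x \<le> y" "y \<le> 2"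
    have l: "0 \<le> ln (y / x)" using xy by simp
    show "0 \<le> gcd_op f x - gcd_op f y"
      using lo[OF xy] mult_nonneg_nonneg[OF log_coneD(2)[OF f] l] by linarith
    have "mass f \<le> mass (gcd_op f)"
      by (rule nonneg_mass_gcd_op[OF t]) (use log_cone_nonneg[OF f] in auto)
    then have "3 * mass f * ln (y / x) \<le> 4 * mass (gcd_op f) * ln (y / x)"
      using l log_cone_mass_nonneg[OF f] by (intro mult_right_mono) auto
    then show "gcd_op f x - gcd_op f y \<le> 4 * mass (gcd_op f) * ln (y / x)"
      using hi[OF xy] by linarith
  qed (rule tame_gcd_op[OF t])
  then show "gcd_op f \<in> log_cone"
    "0 < x \<Longrightarrow> x \<le> y \<Longrightarrow> y \<le> 2 \<Longrightarrow> f 2 * ln (y / x) \<le> gcd_op f x - gcd_op f y"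
    "0 < x \<Longrightarrow> x \<le> y \<Longrightarrow> y \<le> 2 \<Longrightarrow> gcd_op f x - gcd_op f y \<le> 3 * mass f * ln (y / x)"
    using lo hi by auto
qed

section \<open>Positivity and domination for the iterates\<close>

lemma log_cone_funpow: "f \<in> log_cone \<Longrightarrow> (gcd_op ^^ n) f \<in> log_cone"
  by (induction n) (auto intro: log_cone_gcd_op)

lemma tame_funpow: "tame f \<Longrightarrow> tame ((gcd_op ^^ n) f)"
  by (induction n) (auto intro: tame_gcd_op)

lemma gcd_op_nonneg:
  "tame f \<Longrightarrow> (\<And>x. 0 < x \<Longrightarrow> x \<le> 2 \<Longrightarrow> 0 \<le> f x) \<Longrightarrow> 0 \<le> gcd_op f x"
  using gcd_op_mono[OF tame_const[of 0], of f x] gcd_op_cmult[OF tame_const[of 0], of 0] by (simp add: fun_eq_iff)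

lemma iter_nonneg:
  "tame f \<Longrightarrow> (\<And>x. 0 < x \<Longrightarrow> x \<le> 2 \<Longrightarrow> 0 \<le> f x) \<Longrightarrow> 0 < x \<Longrightarrow> x \<le> 2 \<Longrightarrow> 0 \<le> (gcd_op ^^ n) f x"
  by (induction n arbitrary: x) (auto intro!: gcd_op_nonneg tame_funpow)

lemma iter_mono:
  "tame f \<Longrightarrow> tame g \<Longrightarrow> (\<And>x. 0 < x \<Longrightarrow> x \<le> 2 \<Longrightarrow> f x \<le> g x) \<Longrightarrow> 0 < x \<Longrightarrow> x \<le> 2
    \<Longrightarrow> (gcd_op ^^ n) f x \<le> (gcd_op ^^ n) g x"
  by (induction n arbitrary: x) (auto intro!: gcd_op_mono tame_funpow)

lemma iter_cmult: "tame f \<Longrightarrow> (gcd_op ^^ n) (\<lambda>x. c * f x) = (\<lambda>x. c * (gcd_op ^^ n) f x)"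
  by (induction n) (auto simp: gcd_op_cmult tame_funpow)

lemma iter_diff:
  "tame f \<Longrightarrow> tame g \<Longrightarrow> (gcd_op ^^ n) (\<lambda>x. f x - g x) = (\<lambda>x. (gcd_op ^^ n) f x - (gcd_op ^^ n) g x)"
  by (induction n) (auto simp: gcd_op_diff tame_funpow)

lemma iter_add:
  "tame f \<Longrightarrow> tame g \<Longrightarrow> (gcd_op ^^ n) (\<lambda>x. f x + g x) = (\<lambda>x. (gcd_op ^^ n) f x + (gcd_op ^^ n) g x)"
  by (induction n) (auto simp: gcd_op_add tame_funpow)

lemma iter_abs_le:
  assumes "tame f" "tame g" "\<And>x. 0 < x \<Longrightarrow> x \<le> 2 \<Longrightarrow> \<bar>f x\<bar> \<le> g x" "0 < x" "x \<le> 2"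
  shows "\<bar>(gcd_op ^^ n) f x\<bar> \<le> (gcd_op ^^ n) g x"
proof -
  have "(gcd_op ^^ n) f x \<le> (gcd_op ^^ n) g x" "(gcd_op ^^ n) (\<lambda>x. (-1) * f x) x \<le> (gcd_op ^^ n) g x"
    by (rule iter_mono; use assms tame_cmult[of f "-1"] in \<open>force simp: abs_le_iff\<close>)+
  then show ?thesis using iter_cmult[OF assms(1), of n "-1"] by (simp add: abs_le_iff)
qed

lemma mass_funpow_bounds:
  assumes "tame f" "\<And>x. 0 < x \<Longrightarrow> x \<le> 2 \<Longrightarrow> 0 \<le> f x"
  shows "mass f \<le> mass ((gcd_op ^^ n) f)" "mass ((gcd_op ^^ n) f) \<le> 2 ^ n * mass f"
proof (induction n)
  case (Suc n)
  case 1 show ?case using Suc nonneg_mass_gcd_op[OF tame_funpow iter_nonneg, OF assms(1) assms, of n] by simp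
  case 2 show ?case using Suc nonneg_mass_gcd_op[OF tame_funpow iter_nonneg, OF assms(1) assms, of n] by simp
qed auto

text \<open>On (0, 1/8] the slope bound gives f(x) <= f(1/8) + 4 m log(1/(8x)), whose integral is
  f(1/8)/8 + m/2; on the rest f is at most f(1/8). The point 1/8 is chosen so that the logarithmic
  part accounts for only half of the mass m.\<close>

lemma log_cone_eighth:
  assumes f: "f \<in> log_cone" shows "mass f / 4 \<le> f (1 / 8)"
proof -
  note t = log_coneD(1)[OF f]
  let ?m = "mass f"
  define h where "h = (\<lambda>x. (f (1 / 8) + 4 * ?m * ln (1 / 8)) - 4 * ?m * ln x)"
  have th: "tame h" unfolding h_def by (intro tame_diff tame_const tame_cmult tame_ln)
  have "integral {0..1/8} f \<le> integral {0..1/8} h"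
  proof (rule integral_mono_tame[OF t th])
    fix x :: real assume x: "0 < x" "0 \<le> x" "x \<le> 1 / 8"
    have l: "ln ((1 / 8) / x) = ln (1 / 8) - ln x"
      by (rule ln_divide_pos) (use x in auto)
    have "4 * ?m * ln ((1 / 8) / x) = 4 * ?m * ln (1 / 8) - 4 * ?m * ln x"
      unfolding l by (rule right_diff_distrib)
    then show "f x \<le> h x" using log_coneD(4)[OF f, of x "1/8"] x by (simp add: h_def)
  qed auto
  also have "(h has_integral ((f (1 / 8) + 4 * ?m * ln (1 / 8)) / 8 - 4 * ?m * ((1 / 8) * ln (1 / 8) - 1 / 8))) {0..1/8}"
    unfolding h_def
    using has_integral_diff[OF has_integral_const_real[of "f (1 / 8) + 4 * ?m * ln (1 / 8)" 0 "1/8"]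
       has_integral_mult_right[OF ln_has_integral[of "1/8"], of "4 * ?m"]] by simp
  then have "integral {0..1/8} h = f (1 / 8) / 8 + ?m / 2"
    by (simp add: integral_unique algebra_simps)
  finally have 1: "integral {0..1/8} f \<le> f (1 / 8) / 8 + ?m / 2" .
  have "integral {1/8..2} f \<le> integral {1/8..2::real} (\<lambda>x. f (1/8))"
    by (rule integral_mono_tame[OF t tame_const]) (use log_coneD(3)[OF f, of "1/8"] in auto)
  then have "integral {1/8..2} f \<le> 15 / 8 * f (1 / 8)" by simp
  moreover have "?m = integral {0..1/8} f + integral {1/8..2} f" by (rule mass_split[OF t]) auto
  ultimately show ?thesis using 1 by linarith
qed

lemma gcd_op_ge_half:
  assumes "tame f" "\<And>x. 0 < x \<Longrightarrow> x \<le> 2 \<Longrightarrow> 0 \<le> f x" "0 < x" "x \<le> 2"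
  shows "f (x / 2) / 2 \<le> gcd_op f x"
  using tail_int_diff_ge[OF assms(1), of x 2 0] assms by (simp add: gcd_op_eq)

section \<open>Comparison with the weight in the order of the cone\<close>

lemma mass_wt_bounds: "31 / 10 \<le> mass wt" "mass wt \<le> 32 / 10"
  using ln2_bounds by (simp_all add: mass_wt)

lemma wt_2_bounds: "1 / 2 \<le> wt 2" "wt 2 \<le> 6 / 10"
  using ln2_bounds by (simp_all add: wt_def)

lemma wt_diff: "0 < x \<Longrightarrow> 0 < y \<Longrightarrow> wt x - wt y = ln (y / x)"
  by (simp add: wt_def ln_div)

lemma wt_log_cone: "wt \<in> log_cone"
proof (rule log_coneI)
  fix x y :: real assume xy: "0 < x" "x \<le> y" "y \<le> 2"
  then have "0 \<le> ln (y / x)" by simp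
  moreover from this have "1 * ln (y / x) \<le> 4 * mass wt * ln (y / x)"
    using mass_wt_bounds by (intro mult_right_mono) auto
  ultimately show "0 \<le> wt x - wt y" "wt x - wt y \<le> 4 * mass wt * ln (y / x)"
    using wt_diff[of x y] xy by auto
qed (use tame_wt wt_pos[of 2] in auto)

text \<open>Five steps make every element of the cone comparable, in the order of the cone, with
  its mass times \<^const>\<open>wt\<close>; this is what makes the operator a projective contraction.\<close>

lemma log_cone_comparable:
  assumes f: "f \<in> log_cone"
  shows "(\<lambda>x. (gcd_op ^^ 5) f x - mass f / 128 * wt x) \<in> log_cone" (is ?lo)
    and "(\<lambda>x. 64 * mass f * wt x - (gcd_op ^^ 5) f x) \<in> log_cone" (is ?hi)
proof -
  note t = log_coneD(1)[OF f]
  let ?m = "mass f" and ?h = "(gcd_op ^^ 4) f" and ?g = "(gcd_op ^^ 5) f"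
  have m: "0 \<le> ?m" by (rule log_cone_mass_nonneg[OF f])
  have g: "?g = gcd_op ?h" by (simp add: eval_nat_numeral)
  have hc: "?h \<in> log_cone" and gc: "?g \<in> log_cone" using f by (auto intro: log_cone_funpow)
  have half: "(gcd_op ^^ n) f (x / 2) / 2 \<le> (gcd_op ^^ Suc n) f x" if "0 < x" "x \<le> 2" for x n
    using gcd_op_ge_half[OF log_coneD(1)[OF log_cone_funpow[OF f]] log_cone_nonneg[OF log_cone_funpow[OF f]] that] by simp
  \<comment> \<open>The points 2, 1, 1/2, 1/4, 1/8: four halvings cost the factor 1/16, and
    \<open>log_cone_eighth\<close> another 1/4.\<close>
  have h2: "?m / 64 \<le> ?h 2"
    using half[of 2 3] half[of 1 2] half[of "1/2" 1] half[of "1/4" 0] log_cone_eighth[OF f]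
    by (simp add: eval_nat_numeral)
  have g2: "?m / 128 \<le> ?g 2"
    using half[of 2 4] log_coneD(3)[OF hc, of 1 2] h2 by (simp add: eval_nat_numeral)
  have mh: "?m \<le> mass ?h" "mass ?h \<le> 16 * ?m" "mass ?h \<le> mass ?g" "mass ?g \<le> 32 * ?m"
    using mass_funpow_bounds[OF t log_cone_nonneg[OF f], of 4] mass_funpow_bounds[OF t log_cone_nonneg[OF f], of 5]
      nonneg_mass_gcd_op[OF log_coneD(1)[OF hc] log_cone_nonneg[OF hc]] by (auto simp: g)
  have tg: "tame ?g" by (rule log_coneD(1)[OF gc])
  have lo: "?m / 64 * ln (y / x) \<le> ?g x - ?g y" if "0 < x" "x \<le> y" "y \<le> 2" for x y
    using log_cone_gcd_op(2)[OF hc that] mult_right_mono[OF h2, of "ln (y / x)"] that by (simp add: g)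
  have hi: "?g x - ?g y \<le> 3 * mass ?h * ln (y / x)" if "0 < x" "x \<le> y" "y \<le> 2" for x y
    using log_cone_gcd_op(3)[OF hc that] by (simp add: g)
  note w = mass_wt_bounds wt_2_bounds
  have mw: "31 / 10 * ?m \<le> ?m * mass wt" "?m * mass wt \<le> 32 / 10 * ?m" "?m * wt 2 \<le> 6 / 10 * ?m" "1 / 2 * ?m \<le> ?m * wt 2"
    using mult_left_mono[OF w(1) m] mult_left_mono[OF w(2) m] mult_left_mono[OF w(3) m] mult_left_mono[OF w(4) m]
    by auto
  have wd: "a * wt x - a * wt y = a * ln (y / x)" if "0 < x" "x \<le> y" for a x y
    using wt_diff[of x y] that by (simp flip: right_diff_distrib)
  show ?lo
  proof (rule log_coneI)
    have "mass (\<lambda>x. ?g x - ?m / 128 * wt x) = mass ?g - ?m / 128 * mass wt"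
      using mass_diff[OF tg tame_cmult[OF tame_wt, of "?m / 128"]] mass_cmult[of "?m / 128" wt] by simp
    moreover fix x y :: real assume xy: "0 < x" "x \<le> y" "y \<le> 2"
    moreover have l: "0 \<le> ln (y / x)" using xy by simp
    \<comment> \<open>The gap between 3 and 4 is spent here: \<open>mass ?g\<close> is at least
      \<open>mass ?h\<close> and \<open>?m\<close>, while the subtracted mass is at most ?m /
      40.\<close>
    moreover have "3 * mass ?h \<le> 4 * (mass ?g - ?m / 128 * mass wt)"
      using mw mh m by (simp only: right_diff_distrib times_divide_eq_left)
    ultimately have "3 * mass ?h * ln (y / x) \<le> 4 * mass (\<lambda>x. ?g x - ?m / 128 * wt x) * ln (y / x)"
      by (intro mult_right_mono) auto
    moreover have "?m / 128 * ln (y / x) \<le> ?m / 64 * ln (y / x)" "0 \<le> ?m / 128 * ln (y / x)"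
      using l m by (auto intro!: mult_right_mono)
    ultimately show "0 \<le> ?g x - ?m / 128 * wt x - (?g y - ?m / 128 * wt y)"
      "?g x - ?m / 128 * wt x - (?g y - ?m / 128 * wt y) \<le> 4 * mass (\<lambda>x. ?g x - ?m / 128 * wt x) * ln (y / x)"
      using lo[OF xy] hi[OF xy] wd[OF xy(1,2), of "?m / 128"] by linarith+
  qed (intro tame_diff tame_cmult tame_wt tg, use g2 mw in auto)
  show ?hi
  proof (rule log_coneI)
    have "mass (\<lambda>x. 64 * ?m * wt x - ?g x) = 64 * ?m * mass wt - mass ?g"
      by (simp add: mass_diff tg tame_cmult tame_wt mass_cmult)
    moreover fix x y :: real assume xy: "0 < x" "x \<le> y" "y \<le> 2"
    moreover have l: "0 \<le> ln (y / x)" using xy by simp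
    ultimately have "64 * ?m * ln (y / x) \<le> 4 * mass (\<lambda>x. 64 * ?m * wt x - ?g x) * ln (y / x)"
      using mw mh by (intro mult_right_mono) auto
    moreover have "3 * mass ?h * ln (y / x) \<le> 64 * ?m * ln (y / x)" "0 \<le> ?m / 64 * ln (y / x)"
      using l m mh by (auto intro!: mult_right_mono)
    ultimately show "0 \<le> 64 * ?m * wt x - ?g x - (64 * ?m * wt y - ?g y)"
      "64 * ?m * wt x - ?g x - (64 * ?m * wt y - ?g y) \<le> 4 * mass (\<lambda>x. 64 * ?m * wt x - ?g x) * ln (y / x)"
      using lo[OF xy] hi[OF xy] wd[OF xy(1,2), of "64 * ?m"] by linarith+
  next
    show "0 \<le> 64 * ?m * wt 2 - ?g 2"
      using log_cone_mass_ge_2[OF gc] mh mw by simp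
  qed (use tg in \<open>auto intro!: tame_diff tame_cmult tame_wt\<close>)
qed

text \<open>The order is that of the cone, not the pointwise one. The ratio of the optimal constants
  is what Hilbert's projective metric measures, but the difference b - a is tracked because a may be
  negative.\<close>

definition between :: "real \<Rightarrow> real \<Rightarrow> (real \<Rightarrow> real) \<Rightarrow> (real \<Rightarrow> real) \<Rightarrow> bool" where
  "between a b f g \<longleftrightarrow> (\<lambda>x. f x - a * g x) \<in> log_cone \<and> (\<lambda>x. b * g x - f x) \<in> log_cone"

text \<open>The gaps f - a g and b g - f add up to (b - a) g, so one of them carries at least half
  of its mass. After five steps that gap dominates a fixed fraction of (b - a) T^5 g in the order of
  the cone, and the corresponding end moves inwards.\<close>

lemma between_contract:
  assumes f: "tame f" and g: "g \<in> log_cone" and ab: "a \<le> b" and bt: "between a b f g"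
  shows "\<exists>a' b'. a \<le> a' \<and> a' \<le> b' \<and> b' \<le> b \<and> b' - a' \<le> (1 - 1 / 16384) * (b - a)
           \<and> between a' b' ((gcd_op ^^ 5) f) ((gcd_op ^^ 5) g)"
proof -
  define p where "p = (\<lambda>x. f x - a * g x)"
  define r where "r = (\<lambda>x. b * g x - f x)"
  \<comment> \<open>16384 = 2 * 128 * 64: half of the mass, and the two constants of
    \<open>log_cone_comparable\<close>.\<close>
  define d where "d = (b - a) / 16384"
  let ?F = "(gcd_op ^^ 5) f" and ?G = "(gcd_op ^^ 5) g"
  have pc: "p \<in> log_cone" and rc: "r \<in> log_cone" using bt by (auto simp: between_def p_def r_def)
  note tg = log_coneD(1)[OF g]
  have Tp: "(gcd_op ^^ 5) p = (\<lambda>x. ?F x - a * ?G x)" and Tr: "(gcd_op ^^ 5) r = (\<lambda>x. b * ?G x - ?F x)"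
    by (simp_all add: p_def r_def iter_diff iter_cmult tame_cmult f tg)
  have "mass p + mass r = (b - a) * mass g"
    by (simp add: p_def r_def mass_diff mass_cmult tame_cmult f tg algebra_simps)
  then consider "(b - a) * mass g / 2 \<le> mass p" | "(b - a) * mass g / 2 \<le> mass r" by linarith
  moreover have key: "(\<lambda>x. (gcd_op ^^ 5) h x - d * ?G x) \<in> log_cone"
    if h: "h \<in> log_cone" "(b - a) * mass g / 2 \<le> mass h" for h
  proof -
    have 1: "(\<lambda>x. (mass h - (b - a) * mass g / 2) / 128 * wt x) \<in> log_cone"
      by (rule log_cone_cmult[OF wt_log_cone]) (use h in auto)
    have 2: "(\<lambda>x. d * (64 * mass g * wt x - ?G x)) \<in> log_cone"
      by (rule log_cone_cmult[OF log_cone_comparable(2)[OF g]]) (use ab in \<open>auto simp: d_def\<close>)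
    have eq: "(gcd_op ^^ 5) h x - mass h / 128 * wt x + (mass h - (b - a) * mass g / 2) / 128 * wt x
        + d * (64 * mass g * wt x - ?G x) = (gcd_op ^^ 5) h x - d * ?G x" for x
      by (simp add: d_def field_simps)
    then show ?thesis
      using log_cone_add[OF log_cone_add[OF log_cone_comparable(1)[OF h(1)] 1] 2] by (simp only: eq)
  qed
  ultimately show ?thesis
  proof cases
    case 1
    have "between (a + d) b ?F ?G"
      unfolding between_def using key[OF pc 1] log_cone_funpow[OF rc, of 5] by (simp add: Tp Tr algebra_simps)
    then show ?thesis using ab
      by (intro exI[of _ "a + d"] exI[of _ b]) (auto simp: d_def field_simps)
  next
    case 2
    have "between a (b - d) ?F ?G"
      unfolding between_def using key[OF rc 2] log_cone_funpow[OF pc, of 5] by (simp add: Tp Tr algebra_simps)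
    then show ?thesis using ab
      by (intro exI[of _ a] exI[of _ "b - d"]) (auto simp: d_def field_simps)
  qed
qed

lemma between_iterate:
  assumes f: "tame f" and g: "g \<in> log_cone" and ab: "a \<le> b" and bt: "between a b f g"
  obtains A B :: "nat \<Rightarrow> real" where "A 0 = a" "B 0 = b" "\<And>n. A n \<le> A (Suc n)" "\<And>n. B (Suc n) \<le> B n"
    "\<And>n. A n \<le> B n" "\<And>n. B n - A n \<le> (1 - 1 / 16384) ^ n * (b - a)"
    "\<And>n. between (A n) (B n) ((gcd_op ^^ (5 * n)) f) ((gcd_op ^^ (5 * n)) g)"
proof -
  define P where "P = (\<lambda>n (s :: real \<times> real). fst s \<le> snd s \<and> snd s - fst s \<le> (1 - 1 / 16384) ^ n * (b - a) \<and>
     between (fst s) (snd s) ((gcd_op ^^ (5 * n)) f) ((gcd_op ^^ (5 * n)) g) \<and> (n = 0 \<longrightarrow> s = (a, b)))"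
  have "\<exists>s. \<forall>n. P n (s n) \<and> (fst (s n) \<le> fst (s (Suc n)) \<and> snd (s (Suc n)) \<le> snd (s n))"
  proof (rule dependent_nat_choice)
    show "\<exists>s. P 0 s" using ab bt by (auto simp: P_def)
    fix s n assume s: "P n s"
    obtain a' b' where *: "fst s \<le> a'" "a' \<le> b'" "b' \<le> snd s" "b' - a' \<le> (1 - 1 / 16384) * (snd s - fst s)"
      "between a' b' ((gcd_op ^^ 5) ((gcd_op ^^ (5 * n)) f)) ((gcd_op ^^ 5) ((gcd_op ^^ (5 * n)) g))"
      using between_contract[OF tame_funpow[OF f] log_cone_funpow[OF g], of "fst s" "snd s" "5 * n" "5 * n"] s
      unfolding P_def by auto
    have "(1 - 1 / 16384) * (snd s - fst s) \<le> (1 - 1 / 16384) * ((1 - 1 / 16384) ^ n * (b - a))"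
      using s by (intro mult_left_mono) (auto simp: P_def)
    moreover have "5 * Suc n = 5 + 5 * n" by simp
    ultimately show "\<exists>t. P (Suc n) t \<and> fst s \<le> fst t \<and> snd t \<le> snd s"
      using * by (intro exI[of _ "(a', b')"]) (simp add: P_def funpow_add)
  qed
  then obtain s where "\<And>n. P n (s n)" "\<And>n. fst (s n) \<le> fst (s (Suc n))" "\<And>n. snd (s (Suc n)) \<le> snd (s n)"
    by blast
  then show ?thesis by (intro that[of "\<lambda>n. fst (s n)" "\<lambda>n. snd (s n)"]) (auto simp: P_def)
qed

section \<open>The leading eigenpair\<close>

definition osc_rate :: real where "osc_rate = root 5 (1 - 1 / 16384)"

text \<open>Rounding m down to a multiple of 5 loses less than one factor 1 - 1/16384, which is at
  least 1/2; this explains the 2.\<close>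

lemma osc_rate: "0 < osc_rate" "osc_rate < 1" "(1 - 1 / 16384) ^ (m div 5) \<le> 2 * osc_rate ^ m"
proof -
  show 1: "0 < osc_rate" "osc_rate < 1" by (simp_all add: osc_rate_def)
  have 5: "osc_rate ^ 5 = 1 - 1 / 16384" by (simp add: osc_rate_def)
  have "(1 - 1 / 16384) ^ (m div 5) * osc_rate ^ 5 \<le> osc_rate ^ (5 * (m div 5)) * osc_rate ^ (m mod 5)"
    unfolding 5[symmetric] power_mult[symmetric] using 1
    by (intro mult_mono power_decreasing) auto
  also have "\<dots> = osc_rate ^ m" by (simp flip: power_add)
  finally have "(1 - 1 / 16384) ^ (m div 5) * (1 - 1 / 16384) \<le> osc_rate ^ m" by (simp add: 5)
  moreover have "(1 - 1 / 16384) ^ (m div 5) * (1 / 2) \<le> (1 - 1 / 16384 :: real) ^ (m div 5) * (1 - 1 / 16384)"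
    by (intro mult_left_mono) auto
  ultimately show "(1 - 1 / 16384) ^ (m div 5) \<le> 2 * osc_rate ^ m" by linarith
qed

lemma osc_rate_tendsto: "(\<lambda>m. c * osc_rate ^ m) \<longlonglongrightarrow> 0"
  using tendsto_mult_left[OF LIMSEQ_realpow_zero[of osc_rate], of c] osc_rate by simp

lemma iter_pos:
  assumes "tame f" "\<And>x. 0 < x \<Longrightarrow> x \<le> 2 \<Longrightarrow> 0 < f x" "0 < x" "x \<le> 2"
  shows "0 < (gcd_op ^^ n) f x"
  using assms(3,4)
proof (induction n arbitrary: x)
  case (Suc n)
  have "(gcd_op ^^ n) f (x / 2) / 2 \<le> gcd_op ((gcd_op ^^ n) f) x"
    by (rule gcd_op_ge_half) (use Suc tame_funpow assms(1) in \<open>auto intro: less_imp_le\<close>)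
  moreover have "0 < (gcd_op ^^ n) f (x / 2)" by (rule Suc.IH) (use Suc.prems in auto)
  ultimately show ?case by simp
qed (use assms in auto)

lemma iter_wt_pos: "0 < x \<Longrightarrow> x \<le> 2 \<Longrightarrow> 0 < (gcd_op ^^ n) wt x"
  by (rule iter_pos[OF tame_wt wt_pos])

text \<open>The nested intervals of \<open>between_iterate\<close> shrink to one number \<rho>. At
  multiples of 5 membership in the cone is weakened to pointwise positivity; the remaining m mod 5
  steps keep the resulting domination because T is positive.\<close>

lemma ratio_limit:
  assumes f: "tame f" and ab: "a \<le> b" and bt: "between a b f wt"
  shows "\<exists>\<rho>. \<forall>m x. 0 < x \<longrightarrow> x \<le> 2 \<longrightarrow>
    \<bar>(gcd_op ^^ m) f x - \<rho> * (gcd_op ^^ m) wt x\<bar> \<le> (2 * (b - a)) * osc_rate ^ m * (gcd_op ^^ m) wt x"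
proof -
  let ?T = "\<lambda>m. gcd_op ^^ m"
  obtain A B where AB: "A 0 = a" "B 0 = b" "\<And>n. A n \<le> A (Suc n)" "\<And>n. B (Suc n) \<le> B n"
    "\<And>n. A n \<le> B n" "\<And>n. B n - A n \<le> (1 - 1 / 16384) ^ n * (b - a)"
    "\<And>n. between (A n) (B n) (?T (5 * n) f) (?T (5 * n) wt)"
    using between_iterate[OF f wt_log_cone ab bt] by metis
  have AmBn: "A m \<le> B n" for m n
    using lift_Suc_mono_le[of A m "max m n", OF AB(3)] AB(5)[of "max m n"]
      lift_Suc_antimono_le[of B n "max m n", OF AB(4)] by simp
  define \<rho> where "\<rho> = (SUP m. A m)"
  have \<rho>: "A n \<le> \<rho>" "\<rho> \<le> B n" for n
    unfolding \<rho>_def by (auto intro!: cSUP_upper bdd_aboveI2[of _ _ "B 0"] cSUP_least AmBn)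
  have "\<bar>?T m f x - \<rho> * ?T m wt x\<bar> \<le> (2 * (b - a)) * osc_rate ^ m * ?T m wt x"
    if x: "0 < x" "x \<le> 2" for m x
  proof -
    let ?n = "m div 5"
    define e where "e = (1 - 1 / 16384) ^ ?n * (b - a)"
    let ?h = "\<lambda>x. ?T (5 * ?n) f x - \<rho> * ?T (5 * ?n) wt x" and ?k = "\<lambda>x. e * ?T (5 * ?n) wt x"
    have "\<bar>?h y\<bar> \<le> ?k y" if y: "0 < y" "y \<le> 2" for y
    proof -
      have "0 \<le> ?T (5 * ?n) f y - A ?n * ?T (5 * ?n) wt y" "0 \<le> B ?n * ?T (5 * ?n) wt y - ?T (5 * ?n) f y"
        using AB(7)[of ?n] log_cone_nonneg[OF _ y] unfolding between_def by blast+
      moreover have w: "0 \<le> ?T (5 * ?n) wt y" using iter_wt_pos[OF y] by (rule less_imp_le)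
      have "A ?n * ?T (5 * ?n) wt y \<le> \<rho> * ?T (5 * ?n) wt y" "\<rho> * ?T (5 * ?n) wt y \<le> B ?n * ?T (5 * ?n) wt y"
        using \<rho> w by (auto intro: mult_right_mono)
      moreover have "(B ?n - A ?n) * ?T (5 * ?n) wt y \<le> e * ?T (5 * ?n) wt y"
        unfolding e_def using AB(6) w by (rule mult_right_mono)
      ultimately show ?thesis by (simp add: abs_le_iff algebra_simps)
    qed
    then have "\<bar>?T (m mod 5) ?h x\<bar> \<le> ?T (m mod 5) ?k x"
      by (intro iter_abs_le x) (auto intro!: tame_diff tame_cmult tame_funpow f tame_wt)
    moreover have "?T (m mod 5) (?T (5 * ?n) g) = ?T m g" for g
      by (simp flip: funpow_add[THEN fun_cong, unfolded comp_def])
    ultimately have "\<bar>?T m f x - \<rho> * ?T m wt x\<bar> \<le> e * ?T m wt x"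
      by (simp add: iter_diff iter_cmult tame_diff tame_cmult tame_funpow f tame_wt)
    also have "e * ?T m wt x \<le> (2 * (b - a) * osc_rate ^ m) * ?T m wt x"
    proof (rule mult_right_mono)
      show "e \<le> 2 * (b - a) * osc_rate ^ m"
        using mult_right_mono[OF osc_rate(3)[of m], of "b - a"] ab by (simp add: e_def algebra_simps)
    qed (use iter_wt_pos[OF x, of m] in auto)
    finally show ?thesis .
  qed
  then show ?thesis by blast
qed

text \<open>This is the linear span of the cone: its elements qualify by
  \<open>log_lip_log_cone\<close>, and \<open>log_lip_between\<close> writes f as the difference of
  f + N wt and N wt, both in the cone.\<close>

definition log_lip :: "(real \<Rightarrow> real) \<Rightarrow> bool" where
  "log_lip f \<longleftrightarrow> tame f \<and> (\<exists>M. \<forall>x y. 0 < x \<longrightarrow> x \<le> y \<longrightarrow> y \<le> 2 \<longrightarrow> \<bar>f x - f y\<bar> \<le> M * ln (y / x))"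

lemma log_lip_log_cone: "f \<in> log_cone \<Longrightarrow> log_lip f"
  unfolding log_lip_def
  by (intro conjI exI[of _ "4 * mass f"]) (use log_coneD[of f] in \<open>auto simp: abs_le_iff\<close>)

lemma log_lip_between:
  assumes "log_lip f" obtains N where "0 \<le> N" "between (- N) N f wt"
proof -
  have t: "tame f" using assms by (simp add: log_lip_def)
  obtain M0 where M0: "\<And>x y. 0 < x \<Longrightarrow> x \<le> y \<Longrightarrow> y \<le> 2 \<Longrightarrow> \<bar>f x - f y\<bar> \<le> M0 * ln (y / x)"
    using assms by (auto simp: log_lip_def)
  \<comment> \<open>One constant is to control increments and values alike, since the cone also asks
    for a sign at 2.\<close>
  define M where "M = \<bar>M0\<bar> + \<bar>f 2\<bar>"
  have M: "\<bar>f x - f y\<bar> \<le> M * ln (y / x)" if "0 < x" "x \<le> y" "y \<le> 2" for x y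
  proof -
    have "M0 * ln (y / x) \<le> M * ln (y / x)"
      by (rule mult_right_mono) (use that in \<open>auto simp: M_def\<close>)
    then show ?thesis using M0[OF that] by simp
  qed
  have M2: "\<bar>f 2\<bar> \<le> M" "0 \<le> M" by (auto simp: M_def)
  have fw: "\<bar>f x\<bar> \<le> 3 * M * wt x" if x: "0 < x" "x \<le> 2" for x
  proof -
    have "\<bar>f 2\<bar> \<le> 2 * M * wt x" by (rule abs_le_wt[OF x M2(1)])
    moreover have "\<bar>f x - f 2\<bar> \<le> M * wt x"
      using M[of x 2] x mult_left_mono[OF ln_2_div_le_wt[OF x] M2(2)] by simp
    ultimately show ?thesis by linarith
  qed
  \<comment> \<open>With the factor 10 the increments lie between 9 M and 11 M times log(y/x), while
    the mass is at least 7 M times that of \<open>wt\<close>, which is more than the upper slope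
    condition needs. The claim is applied to f and to - f.\<close>
  have c: "(\<lambda>x. 10 * M * wt x - h x) \<in> log_cone"
    if th: "tame h" and hM: "\<And>x y. 0 < x \<Longrightarrow> x \<le> y \<Longrightarrow> y \<le> 2 \<Longrightarrow> \<bar>h x - h y\<bar> \<le> M * ln (y / x)"
      and hw: "\<And>x. 0 < x \<Longrightarrow> x \<le> 2 \<Longrightarrow> \<bar>h x\<bar> \<le> 3 * M * wt x" for h
  proof (rule log_coneI)
    have "3 * M * wt 2 \<le> 10 * M * wt 2" using M2(2) wt_2_bounds by (intro mult_right_mono) auto
    then show "0 \<le> 10 * M * wt 2 - h 2" using hw[of 2] by simp
    fix x y :: real assume xy: "0 < x" "x \<le> y" "y \<le> 2"
    then have l: "0 \<le> M * ln (y / x)" using M2(2) by simp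
    have wd: "10 * M * wt x - 10 * M * wt y = 10 * (M * ln (y / x))"
      using wt_diff[of x y] xy by (simp flip: right_diff_distrib)
    show "0 \<le> 10 * M * wt x - h x - (10 * M * wt y - h y)" using hM[OF xy] l wd by linarith
    have "mass h \<le> 3 * M * mass wt"
      using mass_mono[OF th tame_cmult[OF tame_wt, of "3 * M"]] hw by (simp add: mass_cmult abs_le_iff)
    moreover have "mass (\<lambda>x. 10 * M * wt x - h x) = 10 * M * mass wt - mass h"
      using mass_diff[OF tame_cmult[OF tame_wt, of "10 * M"] th] by (simp add: mass_cmult)
    moreover have "M * (31 / 10) \<le> M * mass wt" using mass_wt_bounds M2(2) by (intro mult_left_mono) auto
    ultimately have "11 * M \<le> 4 * mass (\<lambda>x. 10 * M * wt x - h x)" using M2(2) by simp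
    then have "11 * M * ln (y / x) \<le> 4 * mass (\<lambda>x. 10 * M * wt x - h x) * ln (y / x)"
      using xy by (intro mult_right_mono) auto
    then show "10 * M * wt x - h x - (10 * M * wt y - h y) \<le> 4 * mass (\<lambda>x. 10 * M * wt x - h x) * ln (y / x)"
      using hM[OF xy] wd by linarith
  qed (intro tame_diff tame_cmult tame_wt th)
  have "between (- (10 * M)) (10 * M) f wt"
    using c[OF t M fw] c[OF tame_cmult[OF t, of "-1"]] M fw
    by (simp add: between_def abs_minus_commute add.commute)
  then show ?thesis using that[of "10 * M"] M2(2) by simp
qed

lemma log_lip_ratio:
  assumes "log_lip f"
  shows "\<exists>\<rho> D. 0 \<le> D \<and> (\<forall>m x. 0 < x \<longrightarrow> x \<le> 2 \<longrightarrow>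
    \<bar>(gcd_op ^^ m) f x - \<rho> * (gcd_op ^^ m) wt x\<bar> \<le> D * osc_rate ^ m * (gcd_op ^^ m) wt x)"
proof -
  obtain N where N: "0 \<le> N" "between (- N) N f wt" using log_lip_between[OF assms] .
  then show ?thesis using ratio_limit[of f "-N" N] assms
    by (intro ex_forward[OF ratio_limit[of f "-N" N]] exI[of _ "2 * (N - - N)"]) (auto simp: log_lip_def)
qed

lemma geometric_cauchy:
  fixes s :: "nat \<Rightarrow> real"
  assumes "\<And>n. \<bar>s (Suc n) - s n\<bar> \<le> c * r ^ n" "0 \<le> r" "r < 1"
  shows "\<exists>l. \<forall>n. \<bar>s n - l\<bar> \<le> c / (1 - r) * r ^ n"
proof -
  let ?d = "\<lambda>n. s (Suc n) - s n"
  have sg: "summable (\<lambda>k. c * r ^ (k + n))" for n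
    using assms by (intro summable_mult) (simp add: power_add summable_mult2 summable_geometric)
  have sd: "summable (\<lambda>k. \<bar>?d (k + n)\<bar>)" for n
    by (rule summable_comparison_test'[OF sg[of n], of 0]) (use assms in auto)
  have sd0: "summable ?d" using summable_rabs_cancel[of ?d] sd[of 0] by simp
  have "\<bar>s n - (s 0 + suminf ?d)\<bar> \<le> c / (1 - r) * r ^ n" for n
  proof -
    have "suminf ?d = (\<Sum>k. ?d (k + n)) + (\<Sum>k<n. ?d k)" by (rule suminf_split_initial_segment[OF sd0])
    moreover have "(\<Sum>k<n. ?d k) = s n - s 0" by (rule sum_lessThan_telescope)
    ultimately have "\<bar>s n - (s 0 + suminf ?d)\<bar> = \<bar>\<Sum>k. ?d (k + n)\<bar>" by simp
    also have "\<dots> \<le> (\<Sum>k. \<bar>?d (k + n)\<bar>)" by (rule summable_rabs[OF sd])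
    also have "\<dots> \<le> (\<Sum>k. c * r ^ (k + n))" by (rule suminf_le[OF _ sd sg]) (use assms in auto)
    also have "\<dots> = (\<Sum>k. (c * r ^ n) * r ^ k)" by (simp add: power_add mult_ac)
    also have "\<dots> = (c * r ^ n) * (1 / (1 - r))"
      using assms by (subst suminf_mult) (auto simp: suminf_geometric summable_geometric)
    finally show ?thesis by simp
  qed
  then show ?thesis by blast
qed

text \<open>In effect \<phi> is the value at f of the left eigenfunctional of T, normalised to 1 at
  \<open>wt\<close>. No rate is recorded, so that the property survives limits in the norm weighted
  by \<open>wt\<close>.\<close>

definition asymp_coeff :: "(real \<Rightarrow> real) \<Rightarrow> (real \<Rightarrow> real) \<Rightarrow> real \<Rightarrow> bool" where
  "asymp_coeff v f \<phi> \<longleftrightarrow> (\<forall>\<epsilon>>0. \<forall>\<^sub>F m in sequentially. \<forall>x\<in>{0<..2}.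
     \<bar>(gcd_op ^^ m) f x / mass ((gcd_op ^^ m) wt) - \<phi> * v x\<bar> \<le> \<epsilon> * wt x)"

locale leading_pair =
  fixes v :: "real \<Rightarrow> real" and lam :: real
  assumes v_cone: "v \<in> log_cone" and mass_v: "mass v = 1"
    and gcd_op_v: "gcd_op v = (\<lambda>x. lam * v x)"
    and lambda_ge: "217 / 200 \<le> lam"
    and asymp_wt: "asymp_coeff v wt 1"
    and asymp_log_lip: "log_lip f \<Longrightarrow> \<exists>\<phi>. asymp_coeff v f \<phi>"

text \<open>Read as a comparison in log(2/x): halving contributes the slope 1/2 and the tail
  integral at least 0.586, together more than 1.085; the constant terms compare 0.64 with 1.085
  times \<open>wt 2\<close>.\<close>

lemma gcd_op_wt_ge: assumes "0 < x" "x \<le> 2" shows "217 / 200 * wt x \<le> gcd_op wt x"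
proof -
  have "293 / 500 \<le> wt t" if "1 \<le> t" "t \<le> 2" for t
    using ln_le_cancel_iff[of t 2] that ln2_bounds by (simp add: wt_def del: ln_le_cancel_iff)
  then have "293 / 500 * ln (2 / x) \<le> tail_int wt x - tail_int wt 2"
    by (intro tail_int_diff_ge tame_wt) (use assms in auto)
  moreover have "0 \<le> ln (2 / x)" using assms by simp
  moreover have "wt (x / 2) = 32 / 25 + ln (2 / x)" "wt x = 32 / 25 - ln 2 + ln (2 / x)"
    using assms by (simp_all add: wt_def ln_div)
  ultimately show ?thesis
    using ln2_bounds tail_int_2[of wt] unfolding gcd_op_eq[OF tame_wt assms] by linarith
qed

lemma mass_iter_wt_pos: "0 < mass ((gcd_op ^^ m) wt)"
  using mass_funpow_bounds(1)[OF tame_wt less_imp_le[OF wt_pos], of m] mass_wt_bounds by simp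

text \<open>Mass 1 in the cone bounds the slope by 4 and the value at 2 by 1/2, whence the bound 5
  \<open>wt\<close> uniformly in m.\<close>

lemma normalized_iter_wt:
  defines "w \<equiv> \<lambda>m x. 1 / mass ((gcd_op ^^ m) wt) * (gcd_op ^^ m) wt x"
  shows "w m \<in> log_cone" "mass (w m) = 1" "0 < x \<Longrightarrow> x \<le> 2 \<Longrightarrow> w m x \<le> 5 * wt x"
proof -
  show wc: "w m \<in> log_cone"
    unfolding w_def by (intro log_cone_cmult log_cone_funpow wt_log_cone) (use mass_iter_wt_pos[of m] in auto)
  show wm: "mass (w m) = 1" unfolding w_def mass_cmult using mass_iter_wt_pos[of m] by simp
  assume x: "0 < x" "x \<le> 2"
  have "w m x - w m 2 \<le> 4 * ln (2 / x)" using log_coneD(4)[OF wc, of x 2] x by (simp add: wm)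
  moreover have "w m 2 \<le> 1 / 2" using log_cone_mass_ge_2[OF wc] by (simp add: wm)
  ultimately show "w m x \<le> 5 * wt x" using ln_2_div_le_wt[OF x] wt_ge_half[OF x] by linarith
qed

theorem leading_pair_exists: "\<exists>v lam. leading_pair v lam"
proof -
  let ?T = "\<lambda>m. gcd_op ^^ m" and ?r = osc_rate
  define M where "M = (\<lambda>m. mass (?T m wt))"
  have Mpos: "0 < M m" and Mstep: "M m \<le> M (Suc m)" for m
    using mass_iter_wt_pos nonneg_mass_gcd_op(1)[OF tame_funpow[OF tame_wt] less_imp_le[OF iter_wt_pos], of m]
    by (simp_all add: M_def)
  \<comment> \<open>The orbit of T wt is the orbit of \<open>wt\<close> shifted by one step, so the
    limit ratio of the two orbits is the eigenvalue.\<close>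
  have "log_lip (gcd_op wt)" by (intro log_lip_log_cone log_cone_gcd_op(1) wt_log_cone)
  then obtain lam D where D0: "0 \<le> D" and D: "\<And>m x. 0 < x \<Longrightarrow> x \<le> 2 \<Longrightarrow>
      \<bar>?T (Suc m) wt x - lam * ?T m wt x\<bar> \<le> D * ?r ^ m * ?T m wt x"
    using log_lip_ratio[of "gcd_op wt"] by (auto simp: funpow_swap1)
  have DM: "\<bar>M (Suc m) - lam * M m\<bar> \<le> D * ?r ^ m * M m" for m
  proof -
    note t = tame_funpow[OF tame_wt]
    have D': "?T (Suc m) wt x - lam * ?T m wt x \<le> D * ?r ^ m * ?T m wt x"
      "- D * ?r ^ m * ?T m wt x \<le> ?T (Suc m) wt x - lam * ?T m wt x" if "0 < x" "x \<le> 2" for x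
      using D[OF that, of m] unfolding abs_le_iff by simp_all
    have "mass (\<lambda>x. ?T (Suc m) wt x - lam * ?T m wt x) \<le> mass (\<lambda>x. D * ?r ^ m * ?T m wt x)"
      by (intro mass_mono tame_diff tame_cmult t D')
    moreover have "mass (\<lambda>x. - D * ?r ^ m * ?T m wt x) \<le> mass (\<lambda>x. ?T (Suc m) wt x - lam * ?T m wt x)"
      by (intro mass_mono tame_diff tame_cmult t D')
    ultimately show ?thesis
      unfolding mass_cmult mass_diff[OF t[of "Suc m"] tame_cmult[OF t[of m]]]
      by (simp add: M_def abs_le_iff)
  qed
  have lam: "217 / 200 \<le> lam"
  proof -
    have "217 / 200 \<le> lam + D * ?r ^ m" for m
    proof -
      have "(gcd_op ^^ m) (\<lambda>x. 217 / 200 * wt x) 2 \<le> (gcd_op ^^ m) (gcd_op wt) 2"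
        by (rule iter_mono[OF tame_cmult[OF tame_wt] tame_gcd_op[OF tame_wt] gcd_op_wt_ge]) simp_all
      then have "217 / 200 * ?T m wt 2 \<le> ?T (Suc m) wt 2"
        by (simp only: iter_cmult[OF tame_wt] funpow.simps comp_def funpow_swap1)
      also have "\<dots> \<le> (lam + D * ?r ^ m) * ?T m wt 2" using D[of 2 m] by (simp add: algebra_simps)
      finally show ?thesis using iter_wt_pos[of 2 m] by (simp add: mult_le_cancel_right_pos)
    qed
    moreover have "(\<lambda>m. lam + D * ?r ^ m) \<longlonglongrightarrow> lam + 0" by (intro tendsto_intros osc_rate_tendsto)
    ultimately show ?thesis by (intro LIMSEQ_le_const[of "\<lambda>m. lam + D * ?r ^ m"]) auto
  qed
  define w where "w = (\<lambda>m x. ?T m wt x / M m)"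
  have w_eq: "w m = (\<lambda>x. (1 / M m) * ?T m wt x)" for m by (simp add: w_def)
  have wc: "w m \<in> log_cone" and wm: "mass (w m) = 1" for m
    using normalized_iter_wt(1,2) unfolding w_eq M_def by blast+
  have w5: "w m x \<le> 5 * wt x" if "0 < x" "x \<le> 2" for m x
    using normalized_iter_wt(3)[OF that] unfolding w_eq M_def .
  have w0: "0 \<le> w m x" if "0 < x" "x \<le> 2" for m x by (rule log_cone_nonneg[OF wc that])
  have Tw: "\<bar>?T (Suc m) wt x / M m - lam * w m x\<bar> \<le> D * ?r ^ m * w m x" if "0 < x" "x \<le> 2" for m x
    using divide_right_mono[OF D[OF that, of m], of "M m"] Mpos[of m]
    by (simp add: w_def diff_divide_distrib[symmetric] abs_divide)
  have step: "\<bar>w (Suc m) x - w m x\<bar> \<le> (10 * D * wt x) * ?r ^ m" if x: "0 < x" "x \<le> 2" for m x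
  proof -
    define l where "l = M (Suc m) / M m"
    \<comment> \<open>Masses do not decrease, so multiplying by l can only enlarge a difference;
      bounding l times the increment is therefore enough.\<close>
    have l1: "1 \<le> l" using Mstep[of m] Mpos[of m] by (simp add: l_def)
    have ll: "\<bar>l - lam\<bar> \<le> D * ?r ^ m"
      using divide_right_mono[OF DM[of m], of "M m"] Mpos[of m] by (simp add: l_def diff_divide_distrib abs_divide[symmetric] flip: abs_divide) (simp add: field_simps)
    have "l * w (Suc m) x = ?T (Suc m) wt x / M m"
      using Mpos[of m] Mpos[of "Suc m"] by (simp add: l_def w_def)
    then have "\<bar>l * w (Suc m) x - lam * w m x\<bar> \<le> D * ?r ^ m * w m x" using Tw[OF x, of m] by simp
    moreover have "\<bar>l * w m x - lam * w m x\<bar> \<le> D * ?r ^ m * w m x"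
      using mult_right_mono[OF ll w0[OF x, of m]] w0[OF x, of m] by (simp add: abs_mult flip: left_diff_distrib)
    ultimately have "\<bar>l * w (Suc m) x - l * w m x\<bar> \<le> 2 * (D * ?r ^ m * w m x)" by linarith
    moreover have "\<bar>w (Suc m) x - w m x\<bar> \<le> \<bar>l * w (Suc m) x - l * w m x\<bar>"
      using mult_right_mono[OF l1, of "\<bar>w (Suc m) x - w m x\<bar>"] l1 by (simp add: abs_mult flip: right_diff_distrib)
    moreover have "D * ?r ^ m * w m x \<le> D * ?r ^ m * (5 * wt x)"
      using D0 osc_rate w5[OF x, of m] by (intro mult_left_mono) auto
    ultimately show ?thesis by (simp add: mult_ac)
  qed
  define K where "K = 10 * D / (1 - ?r)"
  \<comment> \<open>The limit is set to 0 outside (0, 2], matching the cut-off in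
    \<open>gcd_op\<close>; otherwise the eigenvalue equation would not hold as an equation of
    functions.\<close>
  have "\<forall>x. \<exists>l. (0 < x \<and> x \<le> 2 \<longrightarrow> (\<forall>m. \<bar>w m x - l\<bar> \<le> K * ?r ^ m * wt x)) \<and> (\<not> (0 < x \<and> x \<le> 2) \<longrightarrow> l = 0)"
  proof
    fix x :: real
    show "\<exists>l. (0 < x \<and> x \<le> 2 \<longrightarrow> (\<forall>m. \<bar>w m x - l\<bar> \<le> K * ?r ^ m * wt x)) \<and> (\<not> (0 < x \<and> x \<le> 2) \<longrightarrow> l = 0)"
    proof (cases "0 < x \<and> x \<le> 2")
      case True
      then obtain l where "\<And>n. \<bar>w n x - l\<bar> \<le> (10 * D * wt x) / (1 - ?r) * ?r ^ n"
        using geometric_cauchy[of "\<lambda>m. w m x", OF step] osc_rate by auto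
      then show ?thesis using True by (intro exI[of _ l]) (simp add: K_def mult_ac)
    qed auto
  qed
  then obtain v where v: "\<And>x m. 0 < x \<Longrightarrow> x \<le> 2 \<Longrightarrow> \<bar>w m x - v x\<bar> \<le> K * ?r ^ m * wt x"
    and vout: "\<And>x. \<not> (0 < x \<and> x \<le> 2) \<Longrightarrow> v x = 0" by metis
  have lim: "(\<lambda>m. w m x) \<longlonglongrightarrow> v x" if x: "0 < x" "x \<le> 2" for x
  proof -
    have "(\<lambda>m. w m x - v x) \<longlonglongrightarrow> 0"
      by (rule Lim_null_comparison[OF _ osc_rate_tendsto[of "K * wt x"]])
         (use v[OF x] in \<open>auto simp: mult_ac\<close>)
    then show ?thesis by (simp add: LIM_zero_iff)
  qed
  have vd: "0 \<le> v x - v y" "v x - v y \<le> 4 * ln (y / x)" if xy: "0 < x" "x \<le> y" "y \<le> 2" for x y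
  proof -
    have l: "(\<lambda>m. w m x - w m y) \<longlonglongrightarrow> v x - v y" by (intro tendsto_diff lim) (use xy in auto)
    show "0 \<le> v x - v y" by (rule LIMSEQ_le_const[OF l]) (use log_coneD(3)[OF wc xy] in auto)
    show "v x - v y \<le> 4 * ln (y / x)"
      by (rule LIMSEQ_le_const2[OF l]) (use log_coneD(4)[OF wc xy] in \<open>auto simp: wm\<close>)
  qed
  have vt: "tame v"
  proof (rule tameI)
    show "continuous_on {0<..2} v"
      by (rule log_Lipschitz_continuous[of _ 4]) (use vd in \<open>auto simp: abs_le_iff\<close>)
    fix x :: real assume x: "0 < x" "x \<le> 2"
    have "0 \<le> v x" by (rule LIMSEQ_le_const[OF lim[OF x]]) (use w0[OF x] in auto)
    moreover have "v x \<le> 5 * wt x" by (rule LIMSEQ_le_const2[OF lim[OF x]]) (use w5[OF x] in auto)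
    ultimately show "\<bar>v x\<bar> \<le> 5 * wt x" by simp
  qed
  have v2: "0 \<le> v 2" by (rule LIMSEQ_le_const[OF lim]) (use w0[of 2] in auto)
  note wt' = log_coneD(1)[OF wc]
  have massv: "mass v = 1"
  proof -
    have "\<bar>mass (w m) - mass v\<bar> \<le> K * mass wt * ?r ^ m" for m
    proof -
      have v': "w m x - v x \<le> K * ?r ^ m * wt x" "- (K * ?r ^ m) * wt x \<le> w m x - v x"
        if "0 < x" "x \<le> 2" for x
        using v[OF that, of m] unfolding abs_le_iff by simp_all
      have "mass (\<lambda>x. w m x - v x) \<le> mass (\<lambda>x. K * ?r ^ m * wt x)"
        by (intro mass_mono tame_diff tame_cmult tame_wt wt' vt v')
      moreover have "mass (\<lambda>x. - (K * ?r ^ m) * wt x) \<le> mass (\<lambda>x. w m x - v x)"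
        by (intro mass_mono tame_diff tame_cmult tame_wt wt' vt v')
      ultimately show ?thesis unfolding mass_cmult mass_diff[OF wt' vt] by (simp add: abs_le_iff mult_ac)
    qed
    then have "\<bar>1 - mass v\<bar> \<le> K * mass wt * ?r ^ m" for m by (simp add: wm)
    then have "\<bar>1 - mass v\<bar> \<le> 0" by (intro LIMSEQ_le_const[OF osc_rate_tendsto]) auto
    then show ?thesis by simp
  qed
  have vc: "v \<in> log_cone" by (rule log_coneI) (use vt v2 vd massv in auto)
  have Tv: "gcd_op v x = lam * v x" for x
  proof (cases "0 < x \<and> x \<le> 2")
    case True
    then have x: "0 < x" "x \<le> 2" by auto
    have Twm: "gcd_op (w m) = (\<lambda>x. ?T (Suc m) wt x / M m)" for m
      unfolding w_eq gcd_op_cmult[OF tame_funpow[OF tame_wt]] by simp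
    have "\<bar>gcd_op (w m) x - gcd_op v x\<bar> \<le> (K * gcd_op wt x) * ?r ^ m" for m
    proof -
      have "\<bar>(gcd_op ^^ 1) (\<lambda>x. w m x - v x) x\<bar> \<le> (gcd_op ^^ 1) (\<lambda>x. K * ?r ^ m * wt x) x"
        by (rule iter_abs_le[OF tame_diff[OF wt' vt] tame_cmult[OF tame_wt] v x])
      then show ?thesis
        unfolding iter_diff[OF wt' vt] iter_cmult[OF tame_wt] by (simp add: mult_ac)
    qed
    then have "(\<lambda>m. gcd_op (w m) x - gcd_op v x) \<longlonglongrightarrow> 0"
      by (intro Lim_null_comparison[OF _ osc_rate_tendsto[of "K * gcd_op wt x"]]) auto
    moreover have "(\<lambda>m. gcd_op (w m) x - lam * w m x) \<longlonglongrightarrow> 0"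
    proof (intro Lim_null_comparison[OF _ osc_rate_tendsto[of "D * (5 * wt x)"]] always_eventually allI)
      fix m
      have "D * ?r ^ m * w m x \<le> D * ?r ^ m * (5 * wt x)"
        using D0 osc_rate w5[OF x, of m] by (intro mult_left_mono) auto
      then show "norm (gcd_op (w m) x - lam * w m x) \<le> D * (5 * wt x) * ?r ^ m"
        using Tw[OF x, of m] by (simp add: Twm mult_ac)
    qed
    ultimately have "(\<lambda>m. (gcd_op (w m) x - lam * w m x) - (gcd_op (w m) x - gcd_op v x)) \<longlonglongrightarrow> 0 - 0"
      by (rule tendsto_diff[rotated])
    then have "(\<lambda>m. gcd_op v x - lam * w m x) \<longlonglongrightarrow> 0" by simp
    moreover have "(\<lambda>m. gcd_op v x - lam * w m x) \<longlonglongrightarrow> gcd_op v x - lam * v x"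
      by (intro tendsto_intros lim x)
    ultimately show ?thesis using LIMSEQ_unique by fastforce
  qed (simp add: gcd_op_outside vout)
  have asy: "asymp_coeff v f \<rho>"
    if E: "0 \<le> E" "\<And>m x. 0 < x \<Longrightarrow> x \<le> 2 \<Longrightarrow> \<bar>?T m f x - \<rho> * ?T m wt x\<bar> \<le> E * ?r ^ m * ?T m wt x" for f \<rho> E
    unfolding asymp_coeff_def
  proof (intro allI impI)
    fix \<epsilon> :: real assume "0 < \<epsilon>"
    have b: "\<bar>?T m f x / M m - \<rho> * v x\<bar> \<le> ((5 * E + \<bar>\<rho>\<bar> * K) * ?r ^ m) * wt x" if x: "0 < x" "x \<le> 2" for m x
    proof -
      have "\<bar>?T m f x / M m - \<rho> * w m x\<bar> \<le> E * ?r ^ m * w m x"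
        using divide_right_mono[OF E(2)[OF x, of m], of "M m"] Mpos[of m]
        by (simp add: w_def diff_divide_distrib[symmetric] abs_divide)
      also have "\<dots> \<le> E * ?r ^ m * (5 * wt x)"
        using E(1) osc_rate w5[OF x, of m] by (intro mult_left_mono) auto
      finally have "\<bar>?T m f x / M m - \<rho> * w m x\<bar> \<le> E * ?r ^ m * (5 * wt x)" .
      moreover have "\<bar>\<rho> * w m x - \<rho> * v x\<bar> \<le> \<bar>\<rho>\<bar> * (K * ?r ^ m * wt x)"
        using mult_left_mono[OF v[OF x, of m], of "\<bar>\<rho>\<bar>"] by (simp add: abs_mult flip: right_diff_distrib)
      ultimately show ?thesis by (simp add: algebra_simps)
    qed
    have "\<forall>\<^sub>F m in sequentially. (5 * E + \<bar>\<rho>\<bar> * K) * ?r ^ m < \<epsilon>"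
      using order_tendstoD(2)[OF osc_rate_tendsto \<open>0 < \<epsilon>\<close>] .
    then show "\<forall>\<^sub>F m in sequentially. \<forall>x\<in>{0<..2}. \<bar>?T m f x / mass (?T m wt) - \<rho> * v x\<bar> \<le> \<epsilon> * wt x"
    proof eventually_elim
      case (elim m)
      show ?case
      proof
        fix x :: real assume "x \<in> {0<..2}"
        then have x: "0 < x" "x \<le> 2" by auto
        have "((5 * E + \<bar>\<rho>\<bar> * K) * ?r ^ m) * wt x \<le> \<epsilon> * wt x"
          using elim wt_pos[OF x] by (intro mult_right_mono) auto
        then show "\<bar>?T m f x / mass (?T m wt) - \<rho> * v x\<bar> \<le> \<epsilon> * wt x" using b[OF x, of m] by (simp add: M_def)
      qed
    qed
  qed
  have "leading_pair v lam"
  proof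
    show "asymp_coeff v wt 1" by (rule asy[of 0]) auto
    show "\<exists>\<phi>. asymp_coeff v f \<phi>" if "log_lip f" for f
      using log_lip_ratio[OF that] asy by blast
  qed (use vc massv Tv lam in auto)
  then show ?thesis by blast
qed

section \<open>Asymptotics of the iterates\<close>

context leading_pair
begin

abbreviation (input) M where "M m \<equiv> mass ((gcd_op ^^ m) wt)"

lemma tame_v: "tame v" by (rule log_coneD(1)[OF v_cone])

text \<open>The five-step comparison applied to v, where T^5 v is just lam^5 v.\<close>

lemma v_ge_wt: "\<exists>c>0. \<forall>x. 0 < x \<longrightarrow> x \<le> 2 \<longrightarrow> c * wt x \<le> v x"
proof -
  have it: "(gcd_op ^^ n) v = (\<lambda>x. lam ^ n * v x)" for n
    by (induction n) (simp_all add: gcd_op_v gcd_op_cmult tame_v mult.assoc mult.left_commute)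
  have "1 / (128 * lam ^ 5) * wt x \<le> v x" if "0 < x" "x \<le> 2" for x
    using log_cone_nonneg[OF log_cone_comparable(1)[OF v_cone] that] lambda_ge
    by (simp add: it mass_v field_simps)
  moreover have "0 < 1 / (128 * lam ^ 5)" using lambda_ge by simp
  ultimately show ?thesis by blast
qed

lemma v_pos: "0 < x \<Longrightarrow> x \<le> 2 \<Longrightarrow> 0 < v x"
  using v_ge_wt wt_pos[of x] by (meson less_le_trans mult_pos_pos)

lemma asymp_coeffD:
  "asymp_coeff v f \<phi> \<Longrightarrow> 0 < \<epsilon> \<Longrightarrow>
    \<forall>\<^sub>F m in sequentially. \<forall>x\<in>{0<..2}. \<bar>(gcd_op ^^ m) f x / M m - \<phi> * v x\<bar> \<le> \<epsilon> * wt x"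
  unfolding asymp_coeff_def by blast

lemma asymp_tendsto:
  assumes "asymp_coeff v f \<phi>" "0 < x" "x \<le> 2"
  shows "(\<lambda>m. (gcd_op ^^ m) f x / M m) \<longlonglongrightarrow> \<phi> * v x"
proof (rule LIMSEQ_I)
  fix r :: real assume r: "0 < r"
  have w: "0 < wt x" by (rule wt_pos[OF assms(2,3)])
  have "\<forall>\<^sub>F m in sequentially. \<forall>y\<in>{0<..2}. \<bar>(gcd_op ^^ m) f y / M m - \<phi> * v y\<bar> \<le> (r / (2 * wt x)) * wt y"
    by (rule asymp_coeffD[OF assms(1)]) (use r w in simp)
  then obtain N where N: "\<And>m. m \<ge> N \<Longrightarrow> \<bar>(gcd_op ^^ m) f x / M m - \<phi> * v x\<bar> \<le> (r / (2 * wt x)) * wt x"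
    using assms(2,3) unfolding eventually_sequentially by fastforce
  have "(r / (2 * wt x)) * wt x < r" using w r by simp
  then show "\<exists>no. \<forall>n\<ge>no. norm ((gcd_op ^^ n) f x / M n - \<phi> * v x) < r"
    using N by (intro exI[of _ N]) fastforce
qed

lemma asymp_unique:
  assumes "asymp_coeff v f a" "asymp_coeff v f b" shows "a = b"
proof -
  have "a * v 1 = b * v 1"
    by (rule LIMSEQ_unique[OF asymp_tendsto[OF assms(1)] asymp_tendsto[OF assms(2)]]) auto
  then show ?thesis using v_pos[of 1] by simp
qed

lemma asymp_mono:
  assumes "tame f" "tame g" "asymp_coeff v f a" "asymp_coeff v g b"
    "\<And>x. 0 < x \<Longrightarrow> x \<le> 2 \<Longrightarrow> f x \<le> g x"
  shows "a \<le> b"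
proof -
  have "(gcd_op ^^ m) f 1 / M m \<le> (gcd_op ^^ m) g 1 / M m" for m
    by (intro divide_right_mono iter_mono[OF assms(1,2,5)] less_imp_le[OF mass_iter_wt_pos]) auto
  then have "a * v 1 \<le> b * v 1"
    using LIMSEQ_le[OF asymp_tendsto[OF assms(3), of 1] asymp_tendsto[OF assms(4), of 1]] by auto
  then show ?thesis using v_pos[of 1] by simp
qed

lemma asymp_cmult:
  assumes "tame f" "asymp_coeff v f a" shows "asymp_coeff v (\<lambda>x. c * f x) (c * a)"
  unfolding asymp_coeff_def
proof (intro allI impI)
  fix \<epsilon> :: real assume \<epsilon>: "0 < \<epsilon>"
  have "\<forall>\<^sub>F m in sequentially. \<forall>x\<in>{0<..2}. \<bar>(gcd_op ^^ m) f x / M m - a * v x\<bar> \<le> \<epsilon> / (1 + \<bar>c\<bar>) * wt x"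
    by (rule asymp_coeffD[OF assms(2)]) (use \<epsilon> in \<open>simp add: add_pos_nonneg\<close>)
  then show "\<forall>\<^sub>F m in sequentially. \<forall>x\<in>{0<..2}. \<bar>(gcd_op ^^ m) (\<lambda>x. c * f x) x / M m - c * a * v x\<bar> \<le> \<epsilon> * wt x"
  proof eventually_elim
    case (elim m)
    show ?case
    proof
      fix x :: real assume x: "x \<in> {0<..2}"
      have "\<bar>c\<bar> * \<bar>(gcd_op ^^ m) f x / M m - a * v x\<bar> \<le> (1 + \<bar>c\<bar>) * (\<epsilon> / (1 + \<bar>c\<bar>) * wt x)"
        by (rule mult_mono) (use elim x in auto)
      also have "\<dots> = \<epsilon> * wt x" by (simp add: add_pos_nonneg less_imp_neq[symmetric])
      finally show "\<bar>(gcd_op ^^ m) (\<lambda>x. c * f x) x / M m - c * a * v x\<bar> \<le> \<epsilon> * wt x"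
        by (simp add: iter_cmult assms(1) mult.assoc flip: abs_mult right_diff_distrib times_divide_eq_right)
    qed
  qed
qed

lemma asymp_add:
  assumes "tame f" "tame g" "asymp_coeff v f a" "asymp_coeff v g b"
  shows "asymp_coeff v (\<lambda>x. f x + g x) (a + b)"
  unfolding asymp_coeff_def
proof (intro allI impI)
  fix \<epsilon> :: real assume "0 < \<epsilon>"
  then have "0 < \<epsilon> / 2" by simp
  then have "\<forall>\<^sub>F m in sequentially. \<forall>x\<in>{0<..2}. \<bar>(gcd_op ^^ m) f x / M m - a * v x\<bar> \<le> \<epsilon> / 2 * wt x"
    "\<forall>\<^sub>F m in sequentially. \<forall>x\<in>{0<..2}. \<bar>(gcd_op ^^ m) g x / M m - b * v x\<bar> \<le> \<epsilon> / 2 * wt x"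
    using assms(3,4) unfolding asymp_coeff_def by blast+
  then show "\<forall>\<^sub>F m in sequentially. \<forall>x\<in>{0<..2}. \<bar>(gcd_op ^^ m) (\<lambda>x. f x + g x) x / M m - (a + b) * v x\<bar> \<le> \<epsilon> * wt x"
  proof eventually_elim
    case (elim m)
    show ?case
    proof
      fix x :: real assume x: "x \<in> {0<..2}"
      have "\<bar>(gcd_op ^^ m) f x / M m - a * v x\<bar> \<le> \<epsilon> / 2 * wt x" "\<bar>(gcd_op ^^ m) g x / M m - b * v x\<bar> \<le> \<epsilon> / 2 * wt x"
        using elim x by auto
      then show "\<bar>(gcd_op ^^ m) (\<lambda>x. f x + g x) x / M m - (a + b) * v x\<bar> \<le> \<epsilon> * wt x"
        unfolding iter_add[OF assms(1,2)] add_divide_distrib distrib_right by linarith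
    qed
  qed
qed

text \<open>T is applied to the estimate for T^m f at the same m, instead of shifting the index;
  thus the ratios of consecutive masses never enter.\<close>

lemma asymp_gcd_op:
  assumes f: "tame f" and a: "asymp_coeff v f a"
  shows "asymp_coeff v (gcd_op f) (lam * a)"
  unfolding asymp_coeff_def
proof (intro allI impI)
  fix \<epsilon> :: real assume \<epsilon>: "0 < \<epsilon>"
  obtain C where C: "0 \<le> C" "\<And>x. 0 < x \<Longrightarrow> x \<le> 2 \<Longrightarrow> \<bar>gcd_op wt x\<bar> \<le> C * wt x"
    using tame_obtain[OF tame_gcd_op[OF tame_wt]] by metis
  define e where "e = \<epsilon> / (1 + C)"
  have e: "0 < e" "e * C \<le> \<epsilon>" using \<epsilon> C(1) by (auto simp: e_def field_simps)
  have "\<forall>\<^sub>F m in sequentially. \<forall>x\<in>{0<..2}. \<bar>(gcd_op ^^ m) f x / M m - a * v x\<bar> \<le> e * wt x"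
    using a e(1) unfolding asymp_coeff_def by blast
  then show "\<forall>\<^sub>F m in sequentially. \<forall>x\<in>{0<..2}. \<bar>(gcd_op ^^ m) (gcd_op f) x / M m - lam * a * v x\<bar> \<le> \<epsilon> * wt x"
  proof eventually_elim
    case (elim m)
    show ?case
    proof
      fix x :: real assume "x \<in> {0<..2}"
      then have x: "0 < x" "x \<le> 2" by auto
      let ?h = "\<lambda>x. 1 / M m * (gcd_op ^^ m) f x - a * v x"
      have "\<bar>(gcd_op ^^ 1) ?h x\<bar> \<le> (gcd_op ^^ 1) (\<lambda>x. e * wt x) x"
        by (rule iter_abs_le[OF tame_diff[OF tame_cmult[OF tame_funpow[OF f]] tame_cmult[OF tame_v]] tame_cmult[OF tame_wt] _ x])
           (use elim in auto)
      moreover have "gcd_op ?h = (\<lambda>x. 1 / M m * gcd_op ((gcd_op ^^ m) f) x - a * (lam * v x))"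
        by (simp only: gcd_op_diff gcd_op_cmult tame_cmult tame_funpow f tame_v gcd_op_v)
      ultimately have "\<bar>(gcd_op ^^ m) (gcd_op f) x / M m - lam * a * v x\<bar> \<le> e * gcd_op wt x"
        by (simp add: gcd_op_cmult tame_wt funpow_swap1 mult_ac)
      also have "\<dots> \<le> e * (C * wt x)" using C(2)[OF x] e(1) by (intro mult_left_mono) auto
      also have "\<dots> \<le> \<epsilon> * wt x"
        using mult_right_mono[OF e(2) less_imp_le[OF wt_pos[OF x]]] by (simp add: mult_ac)
      finally show "\<bar>(gcd_op ^^ m) (gcd_op f) x / M m - lam * a * v x\<bar> \<le> \<epsilon> * wt x" .
    qed
  qed
qed

text \<open>By positivity an error \<epsilon> wt in f grows to at most \<epsilon> T^m wt, and T^m wt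
  / M m is bounded by a multiple of \<open>wt\<close> uniformly in m. The candidate for the
  coefficient is found by a Cauchy argument at the single point 1.\<close>

lemma asymp_approx:
  assumes f: "tame f"
    and approx: "\<And>\<epsilon>. 0 < \<epsilon> \<Longrightarrow> \<exists>p. log_lip p \<and> (\<forall>x. 0 < x \<longrightarrow> x \<le> 2 \<longrightarrow> \<bar>f x - p x\<bar> \<le> \<epsilon> * wt x)"
  shows "\<exists>\<phi>. asymp_coeff v f \<phi>"
proof -
  obtain C where C: "0 \<le> C" "\<And>m x. 0 < x \<Longrightarrow> x \<le> 2 \<Longrightarrow> (gcd_op ^^ m) wt x / M m \<le> C * wt x"
    using normalized_iter_wt(3) by (metis mult_1 times_divide_eq_left zero_le_numeral)
  have close: "\<bar>(gcd_op ^^ m) f x / M m - (gcd_op ^^ m) p x / M m\<bar> \<le> \<epsilon> * ((gcd_op ^^ m) wt x / M m)"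
    if p: "tame p" "\<forall>x. 0 < x \<longrightarrow> x \<le> 2 \<longrightarrow> \<bar>f x - p x\<bar> \<le> \<epsilon> * wt x" and x: "0 < x" "x \<le> 2" for p \<epsilon> m x
  proof -
    have "\<bar>(gcd_op ^^ m) (\<lambda>x. f x - p x) x\<bar> \<le> (gcd_op ^^ m) (\<lambda>x. \<epsilon> * wt x) x"
      by (rule iter_abs_le) (use p x in \<open>auto intro!: tame_diff tame_cmult tame_wt f\<close>)
    then have "\<bar>(gcd_op ^^ m) f x - (gcd_op ^^ m) p x\<bar> \<le> \<epsilon> * (gcd_op ^^ m) wt x"
      by (simp add: iter_diff iter_cmult f p(1) tame_wt)
    then have "\<bar>(gcd_op ^^ m) f x - (gcd_op ^^ m) p x\<bar> / M m \<le> \<epsilon> * (gcd_op ^^ m) wt x / M m"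
      using mass_iter_wt_pos[of m] by (intro divide_right_mono) auto
    moreover have "\<bar>(gcd_op ^^ m) f x - (gcd_op ^^ m) p x\<bar> / M m = \<bar>(gcd_op ^^ m) f x / M m - (gcd_op ^^ m) p x / M m\<bar>"
      using mass_iter_wt_pos[of m] by (simp flip: diff_divide_distrib)
    ultimately show ?thesis by simp
  qed
  define s where "s = (\<lambda>m. (gcd_op ^^ m) f 1 / M m)"
  define W where "W = C * wt 1"
  have W: "0 \<le> W" using C(1) wt_pos[of 1] by (simp add: W_def)
  have "Cauchy s"
  proof (rule metric_CauchyI)
    fix r :: real assume r: "0 < r"
    define \<epsilon> where "\<epsilon> = r / (4 * (1 + W))"
    have e: "0 < \<epsilon>" "\<epsilon> * W \<le> r / 4" using r W by (auto simp: \<epsilon>_def field_simps)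
    obtain p where p: "log_lip p" "\<forall>x. 0 < x \<longrightarrow> x \<le> 2 \<longrightarrow> \<bar>f x - p x\<bar> \<le> \<epsilon> * wt x"
      using approx[OF e(1)] by blast
    then have tp: "tame p" by (simp add: log_lip_def)
    obtain \<psi> where "asymp_coeff v p \<psi>" using asymp_log_lip[OF p(1)] by blast
    then have "(\<lambda>m. (gcd_op ^^ m) p 1 / M m) \<longlonglongrightarrow> \<psi> * v 1" by (rule asymp_tendsto) auto
    then have "Cauchy (\<lambda>m. (gcd_op ^^ m) p 1 / M m)" by (rule LIMSEQ_imp_Cauchy)
    then obtain N where N: "\<And>m n. m \<ge> N \<Longrightarrow> n \<ge> N \<Longrightarrow> dist ((gcd_op ^^ m) p 1 / M m) ((gcd_op ^^ n) p 1 / M n) < r / 4"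
      using metric_CauchyD[of "\<lambda>m. (gcd_op ^^ m) p 1 / M m" "r / 4"] r by auto
    have c: "\<bar>s m - (gcd_op ^^ m) p 1 / M m\<bar> \<le> r / 4" for m
    proof -
      have "\<bar>s m - (gcd_op ^^ m) p 1 / M m\<bar> \<le> \<epsilon> * ((gcd_op ^^ m) wt 1 / M m)"
        unfolding s_def by (rule close[OF tp p(2)]) auto
      also have "\<dots> \<le> \<epsilon> * W" unfolding W_def using C(2)[of 1 m] e(1) by (intro mult_left_mono) auto
      finally show ?thesis using e(2) by simp
    qed
    have "dist (s m) (s n) < r" if "m \<ge> N" "n \<ge> N" for m n
      using N[OF that] c[of m] c[of n] r unfolding dist_real_def by linarith
    then show "\<exists>N. \<forall>m\<ge>N. \<forall>n\<ge>N. dist (s m) (s n) < r" by blast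
  qed
  then obtain l where l: "s \<longlonglongrightarrow> l" using Cauchy_convergent convergent_def by blast
  define \<phi> where "\<phi> = l / v 1"
  have v1: "0 < v 1" by (rule v_pos) auto
  obtain B where B: "0 \<le> B" "\<And>x. 0 < x \<Longrightarrow> x \<le> 2 \<Longrightarrow> \<bar>v x\<bar> \<le> B * wt x"
    using tame_obtain[OF tame_v] by metis
  have "asymp_coeff v f \<phi>"
    unfolding asymp_coeff_def
  proof (intro allI impI)
    fix \<epsilon> :: real assume \<epsilon>: "0 < \<epsilon>"
    \<comment> \<open>The summands pay for three errors: passing from f to p under the iterates, the
      convergence for p, and replacing \<psi> by \<phi>.\<close>
    define Q where "Q = C + 1 + W / v 1 * B"
    have "0 \<le> W / v 1 * B" using W v1 B(1) by simp
    then have Q: "0 < Q" using C(1) by (simp add: Q_def)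
    define e where "e = \<epsilon> / Q"
    have e: "0 < e" "e * Q = \<epsilon>" using \<epsilon> Q by (auto simp: e_def)
    obtain p where p: "log_lip p" "\<forall>x. 0 < x \<longrightarrow> x \<le> 2 \<longrightarrow> \<bar>f x - p x\<bar> \<le> e * wt x"
      using approx[OF e(1)] by blast
    then have tp: "tame p" by (simp add: log_lip_def)
    obtain \<psi> where \<psi>: "asymp_coeff v p \<psi>" using asymp_log_lip[OF p(1)] by blast
    have "\<bar>l - \<psi> * v 1\<bar> \<le> e * W"
    proof (rule LIMSEQ_le_const2)
      show "(\<lambda>m. \<bar>s m - (gcd_op ^^ m) p 1 / M m\<bar>) \<longlonglongrightarrow> \<bar>l - \<psi> * v 1\<bar>"
        by (intro tendsto_intros l asymp_tendsto[OF \<psi>]) auto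
      have "\<bar>s m - (gcd_op ^^ m) p 1 / M m\<bar> \<le> e * W" for m
      proof -
        have "\<bar>s m - (gcd_op ^^ m) p 1 / M m\<bar> \<le> e * ((gcd_op ^^ m) wt 1 / M m)"
          unfolding s_def by (rule close[OF tp p(2)]) auto
        also have "\<dots> \<le> e * W" unfolding W_def using C(2)[of 1 m] e(1) by (intro mult_left_mono) auto
        finally show ?thesis .
      qed
      then show "\<exists>N. \<forall>m\<ge>N. \<bar>s m - (gcd_op ^^ m) p 1 / M m\<bar> \<le> e * W" by blast
    qed
    then have "\<bar>l - \<psi> * v 1\<bar> / v 1 \<le> e * W / v 1" using v1 by (intro divide_right_mono) auto
    moreover have "\<bar>l - \<psi> * v 1\<bar> / v 1 = \<bar>\<psi> - \<phi>\<bar>"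
      using v1 by (simp add: \<phi>_def abs_divide[symmetric] diff_divide_distrib abs_minus_commute flip: abs_divide) (simp add: field_simps abs_minus_commute)
    ultimately have d: "\<bar>\<psi> - \<phi>\<bar> \<le> e * W / v 1" by simp
    have "\<forall>\<^sub>F m in sequentially. \<forall>x\<in>{0<..2}. \<bar>(gcd_op ^^ m) p x / M m - \<psi> * v x\<bar> \<le> e * wt x"
      using \<psi> e(1) unfolding asymp_coeff_def by blast
    then show "\<forall>\<^sub>F m in sequentially. \<forall>x\<in>{0<..2}. \<bar>(gcd_op ^^ m) f x / M m - \<phi> * v x\<bar> \<le> \<epsilon> * wt x"
    proof eventually_elim
      case (elim m)
      show ?case
      proof
        fix x :: real assume "x \<in> {0<..2}"
        then have x: "0 < x" "x \<le> 2" by auto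
        have "\<bar>(gcd_op ^^ m) f x / M m - (gcd_op ^^ m) p x / M m\<bar> \<le> e * ((gcd_op ^^ m) wt x / M m)"
          by (rule close[OF tp p(2) x])
        also have "\<dots> \<le> e * (C * wt x)" using C(2)[OF x] e(1) by (intro mult_left_mono) auto
        finally have 1: "\<bar>(gcd_op ^^ m) f x / M m - (gcd_op ^^ m) p x / M m\<bar> \<le> e * (C * wt x)" .
        have 2: "\<bar>(gcd_op ^^ m) p x / M m - \<psi> * v x\<bar> \<le> e * wt x" using elim x by auto
        have "\<bar>\<psi> - \<phi>\<bar> * \<bar>v x\<bar> \<le> (e * W / v 1) * (B * wt x)"
          by (rule mult_mono[OF d B(2)[OF x]]) (use e W v1 in auto)
        then have 3: "\<bar>\<psi> * v x - \<phi> * v x\<bar> \<le> (e * W / v 1) * (B * wt x)"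
          by (simp flip: abs_mult left_diff_distrib)
        have "e * (C * wt x) + e * wt x + (e * W / v 1) * (B * wt x) = \<epsilon> * wt x"
          unfolding e(2)[symmetric] by (simp add: Q_def algebra_simps)
        then show "\<bar>(gcd_op ^^ m) f x / M m - \<phi> * v x\<bar> \<le> \<epsilon> * wt x"
          using add_mono[OF add_mono[OF 1 2] 3] by argo
      qed
    qed
  qed
  then show ?thesis by blast
qed

text \<open>Positivity at a single point spreads to a multiple of \<open>wt\<close> after finitely
  many steps, and \<open>wt\<close> has coefficient 1; monotonicity then bounds the coefficient of
  that iterate, which is a power of \<open>lam\<close> times \<phi>, away from 0.\<close>

lemma asymp_positive:
  assumes f: "tame f" "\<And>x. 0 < x \<Longrightarrow> x \<le> 2 \<Longrightarrow> 0 \<le> f x" "mass f > 0" and a: "asymp_coeff v f \<phi>"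
  shows "0 < \<phi>"
proof -
  have nn: "0 \<le> (gcd_op ^^ n) f x" if "0 < x" "x \<le> 2" for n x
    by (rule iter_nonneg) (use f that in auto)
  have half: "(gcd_op ^^ n) f (x / 2) / 2 \<le> (gcd_op ^^ Suc n) f x" if "0 < x" "x \<le> 2" for n x
    using gcd_op_ge_half[OF tame_funpow[OF f(1)] nn that] by simp
  have dbl: "(gcd_op ^^ n) f (x / 2 ^ k) / 2 ^ k \<le> (gcd_op ^^ (n + k)) f x" if "0 < x" "x \<le> 2" for n k x
    using that
  proof (induction k arbitrary: x)
    case (Suc k)
    have "(gcd_op ^^ n) f (x / 2 / 2 ^ k) / 2 ^ k \<le> (gcd_op ^^ (n + k)) f (x / 2)"
      by (rule Suc.IH) (use Suc.prems in auto)
    then have "(gcd_op ^^ n) f (x / 2 / 2 ^ k) / 2 ^ k / 2 \<le> (gcd_op ^^ (n + k)) f (x / 2) / 2"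
      by (rule divide_right_mono) simp
    moreover have "(gcd_op ^^ (n + k)) f (x / 2) / 2 \<le> (gcd_op ^^ Suc (n + k)) f x" by (rule half[OF Suc.prems])
    ultimately have "(gcd_op ^^ n) f (x / 2 / 2 ^ k) / 2 ^ k / 2 \<le> (gcd_op ^^ Suc (n + k)) f x" by (rule order_trans)
    moreover have "(gcd_op ^^ n) f (x / 2 / 2 ^ k) / 2 ^ k / 2 = (gcd_op ^^ n) f (x / 2 ^ Suc k) / 2 ^ Suc k"
      by (simp add: mult.commute)
    ultimately show ?case by simp
  qed auto
  have "\<exists>t0. 0 < t0 \<and> t0 \<le> 2 \<and> 0 < f t0"
  proof (rule ccontr)
    assume n: "\<not> ?thesis"
    have "mass f \<le> mass (\<lambda>x. 0)"
      by (rule mass_mono[OF f(1) tame_const]) (meson n not_less)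
    then show False using f(3) by (simp add: mass_const)
  qed
  then obtain t0 where t0: "0 < t0" "t0 \<le> 2" "0 < f t0" by blast
  obtain k0 where "1 < t0 * 2 ^ k0"
    using real_arch_pow[of 2 "1 / t0"] t0 by (auto simp: field_simps)
  then have ex: "\<exists>k. 1 < t0 * 2 ^ k" by blast
  \<comment> \<open>Doubling moves the positive point into (1, 2], where the tail integral can see
    it; minimality of the exponent keeps it at most 2.\<close>
  define j where "j = (LEAST k. 1 < t0 * 2 ^ k)"
  define t where "t = t0 * 2 ^ j"
  have t1: "1 < t" unfolding t_def j_def by (rule LeastI_ex[OF ex])
  have t2: "t \<le> 2"
  proof (cases j)
    case (Suc i)
    then have "\<not> 1 < t0 * 2 ^ i" using not_less_Least[of i "\<lambda>k. 1 < t0 * 2 ^ k"] by (simp add: j_def)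
    then show ?thesis by (simp add: t_def Suc)
  qed (use t0 in \<open>simp add: t_def\<close>)
  define g where "g = (gcd_op ^^ j) f"
  have tg: "tame g" unfolding g_def by (rule tame_funpow[OF f(1)])
  have gn: "0 \<le> g x" if "0 < x" "x \<le> 2" for x unfolding g_def by (rule nn[OF that])
  have "f t0 / 2 ^ j \<le> g t" using dbl[of t 0 j] t1 t2 by (simp add: g_def t_def)
  then have gt: "0 < g t" using t0 by (smt (verit) divide_pos_pos zero_less_power)
  have "continuous_on {1..t} g" by (rule tame_cont[OF tg]) (use t2 in auto)
  then obtain d where d: "0 < d" "\<And>y. y \<in> {1..t} \<Longrightarrow> dist y t < d \<Longrightarrow> dist (g y) (g t) < g t / 2"
    using gt t1 unfolding continuous_on_iff by (metis atLeastAtMost_iff half_gt_zero less_imp_le order_refl)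
  \<comment> \<open>The first entry keeps a above 1, away from the pole of 1/(y - 1); the second
    keeps [a, t] within distance d of t.\<close>
  define a where "a = max ((1 + t) / 2) (t - d / 2)"
  have a1: "1 < a" "a < t" using t1 d(1) by (auto simp: a_def max_def)
  have ga: "g t / 2 \<le> g y" if "a \<le> y" "y \<le> t" for y
  proof -
    have "dist (g y) (g t) < g t / 2" by (rule d(2)) (use that a1 d(1) in \<open>auto simp: a_def dist_real_def\<close>)
    then show ?thesis unfolding dist_real_def by linarith
  qed
  define \<alpha> where "\<alpha> = 2 * (a - 1)"
  define \<beta> where "\<beta> = g t / 2 * ln (2 * (t - 1) / \<alpha>)"
  have \<alpha>: "0 < \<alpha>" "\<alpha> \<le> 2 * (t - 1)" using a1 by (auto simp: \<alpha>_def)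
  have \<beta>: "0 < \<beta>" using gt a1 \<alpha> by (auto simp: \<beta>_def \<alpha>_def)
  have low: "\<beta> \<le> gcd_op g x" if x: "0 < x" "x \<le> \<alpha>" for x
  proof -
    have x2: "x \<le> 2" using x a1 t2 by (simp add: \<alpha>_def)
    have e: "1 + \<alpha> / 2 = a" "1 + 2 * (t - 1) / 2 = t" by (simp_all add: \<alpha>_def field_simps)
    have i: "(\<lambda>y. g y / (y - 1)) integrable_on {a..t}"
      using quot_integrable[OF tg \<alpha>(1) t2] by (simp add: e)
    have "((\<lambda>s. (g t / 2) / (s - 1)) has_integral \<beta>) {a..t}"
      using recip_integral[OF \<alpha>, of "g t / 2"] unfolding e \<beta>_def .
    then have "\<beta> \<le> integral {a..t} (\<lambda>y. g y / (y - 1))"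
    proof (rule has_integral_le[OF _ integrable_integral[OF i]])
      fix y assume "y \<in> {a..t}"
      then show "g t / 2 / (y - 1) \<le> g y / (y - 1)"
        using a1 by (intro divide_right_mono ga) auto
    qed
    also have "\<dots> \<le> tail_int g x"
      unfolding tail_int_def
    proof (rule integral_subset_le)
      show "{a..t} \<subseteq> {1 + x / 2..2}" using x t2 by (auto simp: \<alpha>_def)
      show "\<forall>y\<in>{1 + x / 2..2}. 0 \<le> g y / (y - 1)" using x gn by auto
    qed (use i quot_integrable[OF tg x(1)] in auto)
    also have "\<dots> \<le> gcd_op g x" using gn[of "x/2"] x x2 by (simp add: gcd_op_eq[OF tg])
    finally show ?thesis .
  qed
  \<comment> \<open>The lower bound holds only on (0, \<alpha>] so far; i further halvings bring
    every point of (0, 2] into that range.\<close>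
  obtain i where i: "2 / \<alpha> < 2 ^ i" using real_arch_pow[of 2 "2 / \<alpha>"] by auto
  define n where "n = Suc j + i"
  have lo: "\<beta> / 2 ^ i \<le> (gcd_op ^^ n) f x" if x: "0 < x" "x \<le> 2" for x
  proof -
    have "x / 2 ^ i \<le> \<alpha>" using i \<alpha>(1) x by (simp add: field_simps)
    then have "\<beta> \<le> (gcd_op ^^ Suc j) f (x / 2 ^ i)" using low[of "x / 2 ^ i"] x by (simp add: g_def)
    then have "\<beta> / 2 ^ i \<le> (gcd_op ^^ Suc j) f (x / 2 ^ i) / 2 ^ i" by (rule divide_right_mono) simp
    also have "\<dots> \<le> (gcd_op ^^ n) f x" unfolding n_def by (rule dbl[OF x])
    finally show ?thesis .
  qed
  have asn: "asymp_coeff v ((gcd_op ^^ n) f) (lam ^ n * \<phi>)" for n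
    by (induction n) (use a in \<open>auto simp: mult.assoc intro: asymp_gcd_op tame_funpow f\<close>)
  define c where "c = \<beta> / 2 ^ i"
  have c: "0 < c" using \<beta> by (simp add: c_def)
  \<comment> \<open>A constant has no pole at 0; one application of T creates the logarithm needed
    to dominate \<open>wt\<close>.\<close>
  have one: "gcd_op (\<lambda>x. c) x \<ge> c / 2 * wt x" if x: "0 < x" "x \<le> 2" for x
  proof -
    have "c * ln (2 / x) \<le> tail_int (\<lambda>x. c) x - tail_int (\<lambda>x. c) 2"
      by (rule tail_int_diff_ge) (use x in \<open>auto simp: tame_const\<close>)
    moreover have "wt x = wt 2 + ln (2 / x)" using x by (simp add: wt_def ln_div)
    then have "c / 2 * wt x = c / 2 * wt 2 + 1 / 2 * (c * ln (2 / x))" by (simp add: distrib_left)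
    moreover have "0 \<le> c * ln (2 / x)" using c x by (intro mult_nonneg_nonneg) auto
    moreover have "c / 2 * wt 2 \<le> c / 2 * 1" using c wt_2_bounds by (intro mult_left_mono) auto
    ultimately show ?thesis using tail_int_2[of "\<lambda>x. c"] unfolding gcd_op_eq[OF tame_const x] by linarith
  qed
  have "c / 2 * wt x \<le> (gcd_op ^^ Suc n) f x" if x: "0 < x" "x \<le> 2" for x
  proof -
    have "gcd_op (\<lambda>x. c) x \<le> gcd_op ((gcd_op ^^ n) f) x"
      by (rule gcd_op_mono) (use lo in \<open>auto simp: tame_const tame_funpow f c_def\<close>)
    then show ?thesis using one[OF x] by simp
  qed
  then have "c / 2 * 1 \<le> lam ^ Suc n * \<phi>"
    by (rule asymp_mono[OF tame_cmult[OF tame_wt] tame_funpow[OF f(1)] asymp_cmult[OF tame_wt asymp_wt] asn])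
  then have "0 < lam ^ Suc n * \<phi>" using c by linarith
  moreover have "0 < lam ^ Suc n" using lambda_ge by simp
  ultimately show ?thesis by (simp only: zero_less_mult_pos)
qed

end

section \<open>The operator on logarithms and powers\<close>

declare A_entry.simps [simp del]

lemma gcd_op_one:
  assumes "0 < x" "x \<le> 2" shows "gcd_op (\<lambda>t. 1) x = 1 / 2 + ln 2 - ln x"
proof -
  have "tail_int (\<lambda>t. 1) x = ln (2 / x)"
    using integral_unique[OF recip_integral[OF assms, of 1]] by (simp add: tail_int_def)
  then show ?thesis using assms by (simp add: gcd_op_eq[OF tame_const] ln_div)
qed

lemma tame_power: "tame (\<lambda>t. (t - 1) ^ k)"
proof (rule tameI)
  fix x :: real assume x: "0 < x" "x \<le> 2"
  have "\<bar>(x - 1) ^ k\<bar> \<le> 1" using x by (simp add: power_abs power_le_one abs_le_iff)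
  then show "\<bar>(x - 1) ^ k\<bar> \<le> 2 * 1 * wt x" by (rule abs_le_wt[OF x])
qed (intro continuous_intros)

lemma gcd_op_power:
  assumes "0 < x" "x \<le> 2" "0 < k"
  shows "gcd_op (\<lambda>t. (t - 1) ^ k) x = (x / 2 - 1) ^ k / 2 + (1 - (x / 2) ^ k) / k"
proof -
  let ?F = "\<lambda>t::real. (t - 1) ^ k / k"
  have "((\<lambda>y. (y - 1) ^ k / (y - 1)) has_integral (?F 2 - ?F (1 + x / 2))) {1 + x / 2..2}"
  proof (rule fundamental_theorem_of_calculus)
    fix y assume y: "y \<in> {1 + x / 2..2}"
    have "(?F has_real_derivative (y - 1) ^ (k - 1)) (at y within {1 + x / 2..2})"
      using assms(3) by (auto intro!: derivative_eq_intros)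
    moreover have "(y - 1) ^ (k - 1) = (y - 1) ^ k / (y - 1)"
      using y assms by (simp add: power_diff)
    ultimately show "(?F has_vector_derivative (y - 1) ^ k / (y - 1)) (at y within {1 + x / 2..2})"
      by (simp add: has_real_derivative_iff_has_vector_derivative)
  qed (use assms in auto)
  from integral_unique[OF this] show ?thesis
    using assms by (simp add: gcd_op_eq[OF tame_power] tail_int_def diff_divide_distrib)
qed

text \<open>With s = x - 1 one has x/2 - 1 = (s - 1)/2 and x/2 = (s + 1)/2, and both powers expand
  binomially. The summand 1/k reaches the row r = 0 only, which is why that row has its own
  formula.\<close>

lemma gcd_op_power_expand:
  assumes x: "0 < x" "x \<le> 2"
  shows "gcd_op (\<lambda>t. (t - 1) ^ Suc j) x = (\<Sum>r\<le>Suc j. A_entry (Suc r) (Suc (Suc j)) * (x - 1) ^ r)"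
proof -
  let ?k = "Suc j" and ?s = "x - 1"
  have e1: "(x / 2 - 1) ^ ?k = (\<Sum>r\<le>?k. real (?k choose r) * ?s ^ r * (-1) ^ (?k - r)) / 2 ^ ?k"
    using binomial_ring[of ?s "-1" ?k] power_divide[of "?s + -1" 2 ?k]
    by (simp add: diff_divide_distrib)
  have e2: "(x / 2) ^ ?k = (\<Sum>r\<le>?k. real (?k choose r) * ?s ^ r) / 2 ^ ?k"
    using binomial_ring[of ?s 1 ?k] by (simp add: power_divide)
  have "gcd_op (\<lambda>t. (t - 1) ^ ?k) x = (x / 2 - 1) ^ ?k / 2 + (1 - (x / 2) ^ ?k) / ?k"
    by (rule gcd_op_power) (use x in auto)
  also have "\<dots> = (\<Sum>r\<le>?k. real (?k choose r) * ?s ^ r * (-1) ^ (?k - r) / 2 ^ ?k / 2)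
      + (1 / ?k - (\<Sum>r\<le>?k. real (?k choose r) * ?s ^ r / 2 ^ ?k / ?k))"
    unfolding e1 e2 by (simp only: diff_divide_distrib sum_divide_distrib)
  also have "1 / real ?k = (\<Sum>r\<le>?k. if r = 0 then 1 / real ?k else 0)" by (simp add: sum.delta)
  also have "(\<Sum>r\<le>?k. real (?k choose r) * ?s ^ r * (-1) ^ (?k - r) / 2 ^ ?k / 2)
      + ((\<Sum>r\<le>?k. if r = 0 then 1 / real ?k else 0) - (\<Sum>r\<le>?k. real (?k choose r) * ?s ^ r / 2 ^ ?k / ?k))
      = (\<Sum>r\<le>?k. A_entry (Suc r) (Suc ?k) * ?s ^ r)"
    unfolding sum_subtractf[symmetric] sum.distrib[symmetric]
  proof (rule sum.cong[OF refl])
    fix r assume "r \<in> {..?k}"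
    then show "real (?k choose r) * ?s ^ r * (-1) ^ (?k - r) / 2 ^ ?k / 2
      + ((if r = 0 then 1 / real ?k else 0) - real (?k choose r) * ?s ^ r / 2 ^ ?k / ?k) = A_entry (Suc r) (Suc ?k) * ?s ^ r"
      by (cases "r = 0") (simp_all add: A_entry.simps algebra_simps diff_divide_distrib add_divide_distrib)
  qed
  finally show ?thesis .
qed

section \<open>The column of the logarithm\<close>

definition log_tail :: "nat \<Rightarrow> real" where
  "log_tail r = (\<Sum>m. 1 / (real (r + m) * 3 ^ (r + m)))"

lemma log_tail_summable:
  assumes "0 < r" shows "summable (\<lambda>m. 1 / (real (r + m) * 3 ^ (r + m)))"
proof (rule summable_comparison_test'[of "\<lambda>m. (1/3::real) ^ m" 0])
  fix m :: nat
  have "(3::real) ^ m \<le> real (r + m) * 3 ^ (r + m)"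
    using assms mult_mono[of 1 "real (r + m)" "3 ^ m" "3 ^ (r + m) :: real"] by (simp add: power_increasing)
  then have "1 / (real (r + m) * 3 ^ (r + m)) \<le> 1 / 3 ^ m"
    by (rule divide_left_mono) (use assms in auto)
  then show "norm (1 / (real (r + m) * 3 ^ (r + m))) \<le> (1 / 3) ^ m"
    by (simp add: power_one_over)
qed (simp add: summable_geometric)

lemma log_tail_Suc: "0 < r \<Longrightarrow> log_tail r = 1 / (real r * 3 ^ r) + log_tail (Suc r)"
  using suminf_split_head[OF log_tail_summable, of r] by (simp add: log_tail_def)

lemma log_tail_nonneg: "0 < r \<Longrightarrow> 0 \<le> log_tail r"
  unfolding log_tail_def by (intro suminf_nonneg log_tail_summable) auto

lemma log_tail_le: assumes "0 < r" shows "log_tail r \<le> 3 / 2 / (real r * 3 ^ r)"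
proof -
  have g: "(\<lambda>m. 1 / (real r * 3 ^ r) * (1 / 3) ^ m) sums (1 / (real r * 3 ^ r) * (1 / (1 - 1 / 3)))"
    by (intro sums_mult geometric_sums) auto
  have "log_tail r \<le> 1 / (real r * 3 ^ r) * (1 / (1 - 1 / 3))"
    unfolding log_tail_def
  proof (rule sums_le[OF _ summable_sums[OF log_tail_summable[OF assms]] g])
    fix m
    have "real r * (3 ^ r * 3 ^ m) \<le> real (r + m) * (3 ^ r * 3 ^ m)" by (intro mult_right_mono) auto
    then have "1 / (real (r + m) * (3 ^ r * 3 ^ m)) \<le> 1 / (real r * (3 ^ r * 3 ^ m))"
      by (rule divide_left_mono) (use assms in auto)
    then show "1 / (real (r + m) * 3 ^ (r + m)) \<le> 1 / (real r * 3 ^ r) * (1 / 3) ^ m"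
      by (simp add: power_add power_one_over)
  qed
  then show ?thesis by simp
qed

lemma A_entry_log: "0 < r \<Longrightarrow> A_entry (Suc r) 0 = (-1) ^ r / real r * log_tail r"
  by (simp add: log_tail_def A_entry.simps)

lemma A_entry_log_abs: "0 < r \<Longrightarrow> \<bar>A_entry (Suc r) 0\<bar> = log_tail r / real r"
  using log_tail_nonneg[of r] by (simp add: A_entry_log abs_mult abs_divide power_abs)

lemma ln_series_1:
  assumes "-1 < u" "u < (1::real)" shows "(\<lambda>n. (-1) ^ n / real (Suc n) * u ^ Suc n) sums ln (1 + u)"
proof -
  have "ln (1 + u) = (\<Sum>n. (-1) ^ n * (1 / real (n + 1)) * u ^ Suc n)"
    using ln_series[of "1 + u"] assms by simp
  moreover have "summable (\<lambda>n. (-1) ^ n * (1 / real (n + 1)) * u ^ Suc n)"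
  proof (rule summable_comparison_test'[of "\<lambda>n. \<bar>u\<bar> ^ Suc n" 0])
    show "summable (\<lambda>n. \<bar>u\<bar> ^ Suc n)" using assms by (simp add: summable_geometric abs_less_iff)
    fix n :: nat
    have "1 / real (n + 1) * \<bar>u\<bar> ^ Suc n \<le> 1 * \<bar>u\<bar> ^ Suc n" by (intro mult_right_mono) auto
    then show "norm ((-1) ^ n * (1 / real (n + 1)) * u ^ Suc n) \<le> \<bar>u\<bar> ^ Suc n"
      by (simp add: abs_mult power_abs)
  qed
  ultimately show ?thesis by (simp add: sums_iff)
qed

lemma log_tail_1: "log_tail 1 = ln (3 / 2)"
proof -
  have "(\<lambda>n. - ((-1) ^ n / real (Suc n) * (- (1/3)) ^ Suc n)) sums (- ln (1 + - (1/3)))"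
    by (intro sums_minus ln_series_1) auto
  moreover have "- ((-1) ^ n / real (Suc n) * (- (1/3)) ^ Suc n) = 1 / (real (1 + n) * 3 ^ (1 + n))" for n
    by (simp add: power_minus[of "1/3"] power_one_over field_simps flip: power_mult_distrib)
  moreover have "- ln (1 + - (1 / 3)) = ln (3 / 2 :: real)" by (simp add: ln_div)
  ultimately show ?thesis unfolding log_tail_def by (simp add: sums_iff)
qed

lemma l1_series_continuous:
  fixes c :: "nat \<Rightarrow> real" assumes "summable (\<lambda>k. \<bar>c k\<bar>)"
  shows "continuous_on {-1..1} (\<lambda>s. \<Sum>k. c k * s ^ k)"
proof -
  have "uniform_limit {-1..1} (\<lambda>n s. \<Sum>k<n. c k * s ^ k) (\<lambda>s. \<Sum>k. c k * s ^ k) sequentially"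
  proof (rule Weierstrass_m_test[OF _ assms])
    fix n and s :: real assume "s \<in> {-1..1}"
    then have "\<bar>c n\<bar> * \<bar>s\<bar> ^ n \<le> \<bar>c n\<bar> * 1" by (intro mult_left_mono power_le_one) auto
    then show "norm (c n * s ^ n) \<le> \<bar>c n\<bar>" by (simp add: abs_mult power_abs)
  qed
  then show ?thesis
    by (rule uniform_limit_theorem[rotated]) (auto intro!: continuous_intros always_eventually)
qed

lemma l1_series_summable:
  fixes c :: "nat \<Rightarrow> real" assumes "summable (\<lambda>k. \<bar>c k\<bar>)" "\<bar>s\<bar> \<le> 1"
  shows "summable (\<lambda>k. \<bar>c k * s ^ k\<bar>)" "summable (\<lambda>k. c k * s ^ k)" "\<bar>c k * s ^ k\<bar> \<le> \<bar>c k\<bar>"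
proof -
  have b: "\<bar>c k * s ^ k\<bar> \<le> \<bar>c k\<bar>" for k
    using assms(2) by (simp add: abs_mult power_abs mult_left_le power_le_one)
  then show "\<bar>c k * s ^ k\<bar> \<le> \<bar>c k\<bar>" .
  show "summable (\<lambda>k. \<bar>c k * s ^ k\<bar>)"
    by (rule summable_comparison_test'[OF assms(1), of 0]) (use b in simp)
  then show "summable (\<lambda>k. c k * s ^ k)" by (rule summable_rabs_cancel)
qed

text \<open>The entries are bounded by a multiple of 3^(-r) / r^2, and the square in the denominator
  still gives convergence at the weight 3; this is the source of the range up to 3 for
  \<rho>.\<close>

lemma log_column_summable: "summable (\<lambda>r. \<bar>A_entry (Suc r) 0\<bar> * 3 ^ r)"
proof (rule summable_comparison_test'[of "\<lambda>r. 3 / 2 * (1 / (real r)\<^sup>2)" 1])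
  show "summable (\<lambda>r. 3 / 2 * (1 / (real r)\<^sup>2))"
    using inverse_power_summable[of 2, where 'a=real] by (intro summable_mult) (simp add: inverse_eq_divide)
  fix r :: nat assume "1 \<le> r"
  then have r: "0 < r" by simp
  have "log_tail r / real r * 3 ^ r \<le> 3 / 2 / (real r * 3 ^ r) / real r * 3 ^ r"
    by (intro mult_right_mono divide_right_mono log_tail_le r) auto
  also have "\<dots> = 3 / 2 * (1 / (real r)\<^sup>2)" using r by (simp add: power2_eq_square)
  finally show "norm (\<bar>A_entry (Suc r) 0\<bar> * 3 ^ r) \<le> 3 / 2 * (1 / (real r)\<^sup>2)"
    using r log_tail_nonneg[OF r] by (simp add: A_entry_log_abs)
qed

lemma log_column_summable1: "summable (\<lambda>r. \<bar>A_entry (Suc r) 0\<bar>)"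
  by (rule summable_comparison_test'[OF log_column_summable, of 0])
     (use mult_left_mono[of 1 "3 ^ _" "\<bar>A_entry (Suc _) 0\<bar>"] in \<open>simp add: one_le_power\<close>)

text \<open>Multiplying the differentiated series by 1 + s telescopes: \<open>log_tail_Suc\<close>
  leaves the logarithmic series of 1 + s/3. At x = 1 + s the result is the derivative of the tail
  integral of the logarithm.\<close>

lemma log_column_deriv:
  assumes s: "-1 < s" "s < 1"
  shows "((\<lambda>s. \<Sum>r. A_entry (Suc r) 0 * s ^ r) has_real_derivative (- ln ((3 + s) / 2) / (1 + s))) (at s)"
proof -
  let ?a = "\<lambda>r. A_entry (Suc r) 0"
  let ?t = "\<lambda>n. (-1) ^ Suc n * log_tail (Suc n)"
  have "summable (\<lambda>r. ?a r * 3 ^ r)"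
    by (rule summable_norm_cancel) (use log_column_summable in \<open>simp add: abs_mult\<close>)
  then have "((\<lambda>s. \<Sum>r. ?a r * s ^ r) has_real_derivative (\<Sum>n. diffs ?a n * s ^ n)) (at s)"
    by (rule termdiffs_strong) (use s in auto)
  moreover have d: "diffs ?a n = ?t n" for n
    unfolding diffs_def by (subst A_entry_log) auto
  have sm: "summable (\<lambda>n. ?t n * s ^ n)"
  proof -
    have "summable (\<lambda>n. diffs ?a n * s ^ n)"
    proof (rule termdiff_converges[of s 3])
      fix x :: real assume x: "norm x < 3"
      show "summable (\<lambda>n. ?a n * x ^ n)"
      proof (rule summable_comparison_test'[OF log_column_summable, of 0])
        fix n
        have "\<bar>?a n\<bar> * \<bar>x\<bar> ^ n \<le> \<bar>?a n\<bar> * 3 ^ n"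
          using x by (intro mult_left_mono power_mono) auto
        then show "norm (?a n * x ^ n) \<le> \<bar>?a n\<bar> * 3 ^ n" by (simp add: abs_mult power_abs)
      qed
    qed (use s in auto)
    then show ?thesis by (simp only: d)
  qed
  have "(\<Sum>n. ?t n * s ^ n) * (1 + s) = - ln ((3 + s) / 2)"
  proof -
    have u: "(\<lambda>n. ?t (Suc n) * s ^ Suc n) sums ((\<Sum>n. ?t n * s ^ n) - ?t 0)"
      using sums_Suc_iff[of "\<lambda>n. ?t n * s ^ n"] sm by (simp add: sums_iff)
    have v: "(\<lambda>n. ?t n * s ^ n * s) sums ((\<Sum>n. ?t n * s ^ n) * s)"
      by (intro sums_mult2 summable_sums sm)
    have "(\<lambda>n. ?t (Suc n) * s ^ Suc n + ?t n * s ^ n * s) sums ((\<Sum>n. ?t n * s ^ n) - ?t 0 + (\<Sum>n. ?t n * s ^ n) * s)"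
      by (rule sums_add[OF u v])
    moreover have "?t (Suc n) * s ^ Suc n + ?t n * s ^ n * s = - ((-1) ^ n / real (Suc n) * (s / 3) ^ Suc n)" for n
      using log_tail_Suc[of "Suc n"] by (simp add: power_divide field_simps)
    ultimately have "(\<lambda>n. - ((-1) ^ n / real (Suc n) * (s / 3) ^ Suc n)) sums ((\<Sum>n. ?t n * s ^ n) - ?t 0 + (\<Sum>n. ?t n * s ^ n) * s)"
      by simp
    moreover have "(\<lambda>n. - ((-1) ^ n / real (Suc n) * (s / 3) ^ Suc n)) sums (- ln (1 + s / 3))"
      by (intro sums_minus ln_series_1) (use s in auto)
    ultimately have "(\<Sum>n. ?t n * s ^ n) - ?t 0 + (\<Sum>n. ?t n * s ^ n) * s = - ln (1 + s / 3)"
      by (rule sums_unique2)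
    moreover have "?t 0 = - ln (3 / 2)" using log_tail_1 by simp
    moreover have "ln ((3 + s) / 2) = ln (3 / 2) + ln (1 + s / 3)"
    proof -
      have "(3 + s) / 2 = 3 / 2 * (1 + s / 3)" by (simp add: field_simps)
      then show ?thesis using ln_mult_pos[of "3/2" "1 + s/3"] s by simp
    qed
    ultimately show ?thesis by (simp add: algebra_simps)
  qed
  then have "(\<Sum>n. ?t n * s ^ n) = - ln ((3 + s) / 2) / (1 + s)" using s by (simp add: field_simps)
  ultimately show ?thesis by (simp add: d)
qed

text \<open>The Basel sum minus twice its terms with even denominator, which together are half of
  the Basel sum. Denominators are n + 1, so these terms sit at the odd n.\<close>

lemma alternating_inverse_squares: "(\<lambda>n. (-1) ^ n / (real (Suc n))\<^sup>2) sums (pi\<^sup>2 / 12)"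
proof -
  have 1: "(\<lambda>n. 1 / (real (Suc n))\<^sup>2) sums (pi\<^sup>2 / 6)" using inverse_squares_sums by (simp add: add.commute)
  have "(\<lambda>n. 1 / 2 * (1 / (real (Suc n))\<^sup>2)) sums (1 / 2 * (pi\<^sup>2 / 6))" by (rule sums_mult[OF 1])
  from sums_if'[OF this]
  have "(\<lambda>n. if even n then 0 else 1 / 2 * (1 / (real (Suc ((n - 1) div 2)))\<^sup>2)) sums (1 / 2 * (pi\<^sup>2 / 6))" .
  from sums_diff[OF 1 this]
  have "(\<lambda>n. 1 / (real (Suc n))\<^sup>2 - (if even n then 0 else 1 / 2 * (1 / (real (Suc ((n - 1) div 2)))\<^sup>2))) sums (pi\<^sup>2 / 12)"
    by simp
  moreover have "1 / (real (Suc n))\<^sup>2 - (if even n then 0 else 1 / 2 * (1 / (real (Suc ((n - 1) div 2)))\<^sup>2)) = (-1) ^ n / (real (Suc n))\<^sup>2" for n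
  proof (cases "even n")
    case False
    then obtain j where n: "n = 2 * j + 1" by (auto elim: oddE)
    have "real (Suc n) = 2 * real (Suc j)" by (simp add: n)
    then have "(real (Suc n))\<^sup>2 = 4 * (real (Suc j))\<^sup>2" by (simp add: power_mult_distrib del: of_nat_Suc)
    then show ?thesis using False by (simp add: n del: of_nat_Suc)
  qed simp
  ultimately show ?thesis by simp
qed

text \<open>P(u) is the dilogarithm - Li_2(-u). Its derivative is log(1 + u)/u, so the integral is
  P(1) - P(1/2), which explains both exotic terms of this entry. The value fixes the constant of
  integration in \<open>gcd_op_ln\<close>.\<close>

lemma tail_int_ln_1: "tail_int ln 1 - ln 2 / 2 = A_entry 1 0"
proof -
  define c where "c = (\<lambda>n::nat. if n = 0 then 0 else (-1) ^ (n - 1) / (real n)\<^sup>2 :: real)"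
  define P where "P = (\<lambda>u::real. \<Sum>n. c n * u ^ n)"
  have cS: "c (Suc n) = (-1) ^ n / (real (Suc n))\<^sup>2" for n by (simp add: c_def)
  have ca: "\<bar>c n\<bar> = 1 / (real n)\<^sup>2" for n by (simp add: c_def power_abs abs_divide)
  have cs: "summable (\<lambda>n. \<bar>c n\<bar>)"
    using inverse_power_summable[of 2, where 'a=real] by (simp add: ca inverse_eq_divide)
  have Pc: "continuous_on {-1..1} P" unfolding P_def by (rule l1_series_continuous[OF cs])
  have Pd: "(P has_real_derivative (ln (1 + u) / u)) (at u)" if u: "0 < u" "u < 1" for u
  proof -
    have "summable (\<lambda>n. c n * 1 ^ n)" using summable_rabs_cancel[OF cs] by simp
    then have "(P has_real_derivative (\<Sum>n. diffs c n * u ^ n)) (at u)"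
      unfolding P_def by (rule termdiffs_strong) (use u in auto)
    moreover have "(\<lambda>n. (-1) ^ n / real (Suc n) * u ^ Suc n / u) sums (ln (1 + u) / u)"
      by (intro sums_divide ln_series_1) (use u in auto)
    moreover have "(-1) ^ n / real (Suc n) * u ^ Suc n / u = diffs c n * u ^ n" for n
      unfolding diffs_def cS using u by (simp add: power2_eq_square del: of_nat_Suc)
    ultimately show ?thesis by (simp add: sums_iff)
  qed
  have "((\<lambda>y. ln y / (y - 1)) has_integral (P (2 - 1) - P (3 / 2 - 1))) {3 / 2..2}"
  proof (rule fundamental_theorem_of_calculus_interior)
    show "continuous_on {3 / 2..2} (\<lambda>y. P (y - 1))"
      by (rule continuous_on_compose2[OF Pc]) (auto intro!: continuous_intros)
    fix y :: real assume y: "y \<in> {3 / 2<..<2}"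
    have "((\<lambda>y. P (y - 1)) has_real_derivative (ln (1 + (y - 1)) / (y - 1)) * 1) (at y)"
      by (rule DERIV_chain2[OF Pd]) (use y in \<open>auto intro!: derivative_eq_intros\<close>)
    then show "((\<lambda>y. P (y - 1)) has_vector_derivative (ln y / (y - 1))) (at y)"
      by (simp add: has_real_derivative_iff_has_vector_derivative)
  qed auto
  then have "tail_int ln 1 = P 1 - P (1 / 2)"
    by (simp add: tail_int_def integral_unique)
  moreover have "P 1 = pi\<^sup>2 / 12"
    using sums_Suc_iff[of c "pi\<^sup>2 / 12"] alternating_inverse_squares cS
    by (simp add: P_def c_def sums_iff del: of_nat_Suc)
  moreover have "- P (1 / 2) = (\<Sum>m. (- 1) ^ Suc m / ((real (Suc m))\<^sup>2 * 2 ^ Suc m))"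
  proof -
    have "summable (\<lambda>n. c n * (1 / 2) ^ n)"
      by (rule summable_comparison_test'[OF cs, of 0])
         (simp add: abs_mult power_abs mult_left_le power_le_one)
    then have "(\<lambda>n. c (Suc n) * (1 / 2) ^ Suc n) sums P (1 / 2)"
      using sums_Suc_iff[of "\<lambda>n. c n * (1 / 2) ^ n"] by (simp add: c_def P_def summable_sums)
    from sums_minus[OF this]
    have "(\<lambda>m. - ((- 1) ^ m / (real (Suc m))\<^sup>2 * (1 / 2) ^ Suc m)) sums (- P (1 / 2))"
      unfolding cS .
    moreover have "- ((- 1) ^ m / (real (Suc m))\<^sup>2 * (1 / 2) ^ Suc m) = (- 1) ^ Suc m / ((real (Suc m))\<^sup>2 * 2 ^ Suc m)" for m
      by (simp add: power_one_over del: of_nat_Suc)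
    ultimately have "(\<lambda>m. (- 1) ^ Suc m / ((real (Suc m))\<^sup>2 * 2 ^ Suc m)) sums (- P (1 / 2))"
      by simp
    then show ?thesis by (rule sums_unique)
  qed
  ultimately show ?thesis by (simp add: A_entry.simps)
qed

text \<open>The difference D of the two sides has derivative 0 inside (0, 2) and vanishes at 1. The
  endpoint 2 is reached by continuity, for which absolute summability of the column is used.\<close>

lemma gcd_op_ln:
  assumes x: "0 < x" "x \<le> 2"
  shows "gcd_op ln x = ln x / 2 + (\<Sum>r. A_entry (Suc r) 0 * (x - 1) ^ r)"
proof -
  let ?L = "\<lambda>s. \<Sum>r. A_entry (Suc r) 0 * s ^ r"
  define D where "D = (\<lambda>x. tail_int ln x - ln 2 / 2 - ?L (x - 1))"
  have "tame (\<lambda>x. gcd_op ln x - 1 / 2 * ln x)"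
    by (intro tame_diff tame_gcd_op tame_cmult tame_ln)
  then have "continuous_on {0<..2} (\<lambda>x. gcd_op ln x - 1 / 2 * ln x)" by (rule tame_cont) simp
  then have "continuous_on {0<..2} (\<lambda>x. tail_int ln x - ln 2 / 2)"
    by (rule continuous_on_eq) (auto simp: gcd_op_eq[OF tame_ln] ln_div field_simps)
  moreover have "continuous_on {0<..2} (\<lambda>x. ?L (x - 1))"
    by (rule continuous_on_compose2[OF l1_series_continuous[OF log_column_summable1]]) (auto intro!: continuous_intros)
  ultimately have Dc: "continuous_on {0<..2} D" unfolding D_def by (rule continuous_on_diff)
  have Dd: "(D has_real_derivative 0) (at y)" if y: "0 < y" "y < 2" for y
  proof -
    have "((\<lambda>x. ?L (x - 1)) has_real_derivative (- ln ((3 + (y - 1)) / 2) / (1 + (y - 1))) * 1) (at y)"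
      by (rule DERIV_chain2[OF log_column_deriv]) (use y in \<open>auto intro!: derivative_eq_intros\<close>)
    moreover have "- ln ((3 + (y - 1)) / 2) / (1 + (y - 1)) * 1 = - ln (1 + y / 2) / y"
      by (simp add: add_divide_distrib)
    ultimately have "((\<lambda>x. ?L (x - 1)) has_real_derivative (- ln (1 + y / 2) / y)) (at y)" by (simp only:)
    then show ?thesis
      unfolding D_def by (auto intro!: derivative_eq_intros tail_int_deriv[OF tame_ln] y)
  qed
  have D1: "D 1 = 0" using tail_int_ln_1 by (simp add: D_def)
  have "D x = 0"
  proof (cases "x < 1")
    case True
    have "D 1 = D x"
      by (rule DERIV_isconst2[OF True]) (use x True in \<open>auto intro!: continuous_on_subset[OF Dc] Dd\<close>)
    then show ?thesis using D1 by simp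
  next
    case False
    show ?thesis
    proof (cases "x = 1")
      case False
      then have x1: "1 < x" using \<open>\<not> x < 1\<close> by simp
      have "D x = D 1"
        by (rule DERIV_isconst2[OF x1]) (use x x1 in \<open>auto intro!: continuous_on_subset[OF Dc] Dd\<close>)
      then show ?thesis using D1 by simp
    qed (use D1 in simp)
  qed
  then show ?thesis using x by (simp add: D_def gcd_op_eq[OF tame_ln] ln_div diff_divide_distrib)
qed

section \<open>Absolutely summable series and logarithmically Lipschitz functions\<close>

lemma tame_l1_series:
  assumes "summable (\<lambda>k. \<bar>c k\<bar>)" shows "tame (\<lambda>t. \<Sum>k. c k * (t - 1) ^ k)"
proof (rule tameI)
  show "continuous_on {0<..2} (\<lambda>t. \<Sum>k. c k * (t - 1) ^ k)"
    by (rule continuous_on_compose2[OF l1_series_continuous[OF assms]]) (auto intro!: continuous_intros)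
  fix x :: real assume x: "0 < x" "x \<le> 2"
  then have sx: "\<bar>x - 1\<bar> \<le> 1" by auto
  note sm = l1_series_summable[OF assms sx]
  have "\<bar>\<Sum>k. c k * (x - 1) ^ k\<bar> \<le> (\<Sum>k. \<bar>c k\<bar>)"
    by (rule order_trans[OF summable_rabs[OF sm(1)] suminf_le[OF sm(3,1) assms]])
  then show "\<bar>\<Sum>k. c k * (x - 1) ^ k\<bar> \<le> 2 * (\<Sum>k. \<bar>c k\<bar>) * wt x" by (rule abs_le_wt[OF x])
qed

lemma log_lip_cmult: assumes "log_lip f" shows "log_lip (\<lambda>x. c * f x)"
proof -
  obtain M where M: "\<And>x y. 0 < x \<Longrightarrow> x \<le> y \<Longrightarrow> y \<le> 2 \<Longrightarrow> \<bar>f x - f y\<bar> \<le> M * ln (y / x)"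
    using assms by (auto simp: log_lip_def)
  have "\<bar>c * f x - c * f y\<bar> \<le> (\<bar>c\<bar> * M) * ln (y / x)" if "0 < x" "x \<le> y" "y \<le> 2" for x y
    using mult_left_mono[OF M[OF that], of "\<bar>c\<bar>"] by (simp add: mult.assoc flip: right_diff_distrib abs_mult)
  then show ?thesis using assms tame_cmult unfolding log_lip_def by blast
qed

lemma log_lip_add: assumes "log_lip f" "log_lip g" shows "log_lip (\<lambda>x. f x + g x)"
proof -
  obtain M N where M: "\<And>x y. 0 < x \<Longrightarrow> x \<le> y \<Longrightarrow> y \<le> 2 \<Longrightarrow> \<bar>f x - f y\<bar> \<le> M * ln (y / x)"
    and N: "\<And>x y. 0 < x \<Longrightarrow> x \<le> y \<Longrightarrow> y \<le> 2 \<Longrightarrow> \<bar>g x - g y\<bar> \<le> N * ln (y / x)"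
    using assms unfolding log_lip_def by metis
  have "\<bar>f x + g x - (f y + g y)\<bar> \<le> (M + N) * ln (y / x)" if "0 < x" "x \<le> y" "y \<le> 2" for x y
    using M[OF that] N[OF that] unfolding distrib_right by linarith
  then show ?thesis using assms tame_add unfolding log_lip_def by blast
qed

lemma log_lip_ln: "log_lip ln"
  unfolding log_lip_def by (intro conjI tame_ln exI[of _ 1]) (auto simp: ln_div)

lemma log_lip_power: "log_lip (\<lambda>t. (t - 1) ^ k)"
proof -
  have "\<bar>(x - 1) ^ k - (y - 1) ^ k\<bar> \<le> (2 * real k) * ln (y / x)" if xy: "0 < x" "x \<le> y" "y \<le> 2" for x y :: real
  proof -
    have l: "1 - x / y \<le> ln (y / x)"
      using ln_le_minus_one[of "x / y"] xy by (simp add: ln_div)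
    have "norm ((x - 1) ^ k - (y - 1) ^ k) \<le> k * norm ((x - 1) - (y - 1))"
      by (rule norm_power_diff) (use xy in auto)
    also have "norm ((x - 1) - (y - 1)) = y * (1 - x / y)" using xy by (simp add: field_simps)
    also have "\<dots> \<le> 2 * ln (y / x)" by (rule mult_mono) (use xy l in auto)
    finally show ?thesis by (simp add: mult_left_mono)
  qed
  then show ?thesis unfolding log_lip_def using tame_power by blast
qed

section \<open>Eigenvalues of the truncations\<close>

text \<open>The blocks of the matrix that belong to the powers $(t-1)^i$ with $i \ge 1$, shifted to
  start at index 0: their mutual interaction, the part of the logarithm's column, and their
  contribution to the constant term.\<close>

definition core :: "nat \<Rightarrow> nat \<Rightarrow> real" where "core i j = A_entry (Suc (Suc i)) (Suc (Suc j))"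
definition src :: "nat \<Rightarrow> real" where "src i = A_entry (Suc (Suc i)) 0"
definition obs :: "nat \<Rightarrow> real" where "obs j = A_entry (Suc 0) (Suc (Suc j))"

section \<open>Weighted norms of the columns, the source and the constant row\<close>

lemma core_above: "j < i \<Longrightarrow> core i j = 0"
  by (simp add: core_def A_entry.simps)

lemma core_formula:
  "i \<le> j \<Longrightarrow> core i j = real (Suc j choose Suc i) * ((-1) ^ (j - i) / 2 ^ (j + 2) - 1 / (real (Suc j) * 2 ^ Suc j))"
  by (simp add: core_def A_entry.simps)

text \<open>The triangle inequality ignores the cancellation within an entry, and the binomial
  theorem sums what remains. The leading factor \<rho> turns \<rho>^i into \<rho>^(i+1), the power
  that belongs to the shifted binomial coefficient.\<close>

lemma core_column_crude:
  assumes "0 \<le> \<rho>"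
  shows "\<rho> * (\<Sum>i\<le>j. \<bar>core i j\<bar> * \<rho> ^ i) \<le> (1 / 2 + 1 / real (Suc j)) * ((1 + \<rho>) / 2) ^ Suc j"
proof -
  let ?w = "1 / 2 ^ (j + 2) + 1 / (real (Suc j) * 2 ^ Suc j) :: real"
  have c: "\<bar>core i j\<bar> \<le> real (Suc j choose Suc i) * ?w" if "i \<le> j" for i
  proof -
    have "\<bar>(-1) ^ (j - i) / 2 ^ (j + 2) - 1 / (real (Suc j) * 2 ^ Suc j)\<bar> \<le> ?w"
      by (rule order_trans[OF abs_triangle_ineq4]) (simp add: power_abs abs_divide)
    then show ?thesis unfolding core_formula[OF that] abs_mult by (intro mult_mono) auto
  qed
  have "\<rho> * (\<Sum>i\<le>j. \<bar>core i j\<bar> * \<rho> ^ i) = (\<Sum>i\<le>j. \<bar>core i j\<bar> * \<rho> ^ Suc i)"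
    by (simp add: sum_distrib_left mult_ac)
  also have "\<dots> \<le> (\<Sum>i\<le>j. (real (Suc j choose Suc i) * ?w) * \<rho> ^ Suc i)"
    by (intro sum_mono mult_right_mono c) (use assms in auto)
  also have "\<dots> = ?w * (\<Sum>i\<le>j. real (Suc j choose Suc i) * \<rho> ^ Suc i)"
    unfolding sum_distrib_left by (intro sum.cong) (simp_all only: mult_ac)
  also have "\<dots> \<le> ?w * (\<rho> + 1) ^ Suc j"
  proof (rule mult_left_mono)
    have "(\<rho> + 1) ^ Suc j = (\<Sum>i\<le>Suc j. real (Suc j choose i) * \<rho> ^ i)"
      using binomial_ring[of \<rho> 1 "Suc j"] by simp
    also have "\<dots> = 1 + (\<Sum>i\<le>j. real (Suc j choose Suc i) * \<rho> ^ Suc i)"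
      by (subst sum.atMost_Suc_shift) simp
    finally show "(\<Sum>i\<le>j. real (Suc j choose Suc i) * \<rho> ^ Suc i) \<le> (\<rho> + 1) ^ Suc j" by simp
  qed simp
  also have "\<dots> = (1 / 2 + 1 / real (Suc j)) * ((1 + \<rho>) / 2) ^ Suc j"
    by (simp add: power_divide field_simps del: of_nat_Suc)
  finally show ?thesis .
qed

text \<open>Columns 0 and 1 attain the bound, so they leave no room for the crude estimate; it takes
  over from j = 3 on.\<close>

lemma core_column_2: "(\<Sum>i\<le>j. \<bar>core i j\<bar> * 2 ^ i) \<le> 1 / 4 * 2 ^ j"
proof -
  consider "j = 0" | "j = 1" | "j = 2" | "3 \<le> j" by linarith
  then show ?thesis
  proof cases
    case 4
    have "(1 / 2 + 1 / real (Suc j)) * ((1 + 2) / 2) ^ Suc j \<le> (3 / 4) * (3 / 2) ^ Suc j"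
      using 4 by (intro mult_mono) (auto simp: field_simps)
    also have "(3 / 2) ^ Suc j = (3 / 4) ^ Suc j * (2 :: real) ^ Suc j"
      by (simp flip: power_mult_distrib)
    also have "(3 / 4) ^ Suc j \<le> ((3 / 4) ^ 4 :: real)" using 4 by (intro power_decreasing) auto
    finally have "(1 / 2 + 1 / real (Suc j)) * ((1 + 2) / 2) ^ Suc j \<le> 3 / 4 * ((3 / 4) ^ 4 * 2 ^ Suc j)" by simp
    also have "\<dots> \<le> 1 / 2 * (2 :: real) ^ j" by (simp add: eval_nat_numeral)
    finally show ?thesis using core_column_crude[of 2 j] by linarith
  qed (simp_all add: core_formula eval_nat_numeral)
qed

lemma core_column_3: "(\<Sum>i\<le>j. \<bar>core i j\<bar> * 3 ^ i) \<le> 1 / 2 * 3 ^ j"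
proof (cases "j = 0")
  case False
  have "(1 / 2 + 1 / real (Suc j)) * ((1 + 3) / 2) ^ Suc j \<le> 1 * 2 ^ Suc j"
    using False by (intro mult_mono) (auto simp: field_simps)
  also have "(2 :: real) ^ Suc j = (2 / 3) ^ Suc j * 3 ^ Suc j" by (simp flip: power_mult_distrib)
  also have "1 * ((2 / 3) ^ Suc j * 3 ^ Suc j) \<le> 1 * ((2 / 3) ^ 2 * (3 :: real) ^ Suc j)"
    using False by (intro mult_left_mono mult_right_mono power_decreasing) auto
  also have "\<dots> \<le> 3 / 2 * 3 ^ j" by (simp add: power2_eq_square)
  finally show ?thesis using core_column_crude[of 3 j] by simp
qed (simp add: core_formula)

lemma core_diag: "\<bar>core i i\<bar> \<le> 1 / 4"
proof -
  have "\<bar>core i i\<bar> * 2 ^ i \<le> (\<Sum>k\<le>i. \<bar>core k i\<bar> * 2 ^ k)"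
    by (rule member_le_sum) auto
  then have "\<bar>core i i\<bar> * 2 ^ i \<le> 1 / 4 * 2 ^ i" using core_column_2[of i] by linarith
  then show ?thesis by (rule mult_right_le_imp_le) simp
qed

text \<open>A bound for the norm dual to the weights 2^j, attained at j = 0 and j = 1.\<close>

lemma obs_bound: "\<bar>obs j\<bar> \<le> 1 / 4 * 2 ^ j"
proof -
  have f: "obs j = 1 / real (Suc j) + (-1) ^ Suc j / 2 ^ (j + 2) - 1 / (real (Suc j) * 2 ^ Suc j)"
    by (simp add: obs_def A_entry.simps)
  consider "j = 0" | "j = 1" | "2 \<le> j" by linarith
  then show ?thesis
  proof cases
    case 3
    have q: "1 \<le> (2 :: real) ^ Suc j" by (rule one_le_power) simp
    have "real (Suc j) * 1 \<le> real (Suc j) * 2 ^ Suc j"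
      by (rule mult_left_mono[OF q]) (rule of_nat_0_le_iff)
    then have a: "1 / (real (Suc j) * 2 ^ Suc j) \<le> 1 / real (Suc j)"
      unfolding mult_1_right by (rule divide_left_mono) auto
    have b: "1 / real (Suc j) \<le> 1 / 3" using 3 by (intro divide_left_mono) auto
    have "(1 / 2 :: real) ^ (j + 2) \<le> (1 / 2) ^ 1" by (rule power_decreasing) auto
    then have c: "1 / 2 ^ (j + 2) \<le> 1 / (2 :: real)" by (simp only: power_one_over power_one_right)
    have d: "\<bar>(-1) ^ Suc j / 2 ^ (j + 2) :: real\<bar> = 1 / 2 ^ (j + 2)" by (simp add: power_abs abs_divide)
    have e: "0 \<le> 1 / (real (Suc j) * 2 ^ Suc j)" by simp
    have "\<bar>obs j\<bar> \<le> 1" unfolding f using a b c d e by linarith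
    also have "1 \<le> 1 / 4 * (2 :: real) ^ j" using power_increasing[OF 3, of "2::real"] by simp
    finally show ?thesis .
  qed (use f in \<open>simp_all add: eval_nat_numeral\<close>)
qed

lemma src_abs: "\<bar>src i\<bar> = log_tail (Suc i) / real (Suc i)"
  unfolding src_def by (rule A_entry_log_abs) simp

text \<open>The first term of \<open>log_tail\<close> is kept exactly and only the rest is
  estimated. Using \<open>log_tail_le\<close> at once would raise the sum in
  \<open>src_norm_2\<close> to about 0.63, and the rate in \<open>eig_map_contraction\<close> would
  then exceed 1.\<close>

lemma src_le:
  "2 ^ i * \<bar>src i\<bar> \<le> 1 / 2 * (2 / 3) ^ Suc i * (1 / real (Suc i) * (1 / real (Suc i) + 1 / (2 * real (Suc (Suc i)))))"
proof -
  have "log_tail (Suc i) \<le> 1 / (real (Suc i) * 3 ^ Suc i) + 3 / 2 / (real (Suc (Suc i)) * 3 ^ Suc (Suc i))"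
    using log_tail_Suc[of "Suc i"] log_tail_le[of "Suc (Suc i)"] by simp
  then have "2 ^ i * (log_tail (Suc i) / real (Suc i))
      \<le> 2 ^ i * ((1 / (real (Suc i) * 3 ^ Suc i) + 3 / 2 / (real (Suc (Suc i)) * 3 ^ Suc (Suc i))) / real (Suc i))"
    by (intro mult_left_mono divide_right_mono) auto
  also have "\<dots> = 1 / 2 * (2 / 3) ^ Suc i * (1 / real (Suc i) * (1 / real (Suc i) + 1 / (2 * real (Suc (Suc i)))))"
    by (simp add: power_divide field_simps del: of_nat_Suc)
  finally show ?thesis by (simp only: src_abs)
qed

lemma src_norm_2: "(\<Sum>i<n. 2 ^ i * \<bar>src i\<bar>) \<le> 54 / 100"
proof -
  let ?S = "\<lambda>n. \<Sum>i<n. 2 ^ i * \<bar>src i\<bar>"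
  have S3: "?S 3 \<le> 54 / 100 - 21 / 160 * (2 / 3) ^ 4"
    using src_le[of 0] src_le[of 1] src_le[of 2] by (simp add: eval_nat_numeral)
  \<comment> \<open>For m at least 3 a term is at most 7/160 (2/3)^(m+1); the reserve 21/160 is
    three times 7/160, the sum of the geometric series with ratio 2/3.\<close>
  have "?S m \<le> 54 / 100 - 21 / 160 * (2 / 3) ^ Suc m" if "3 \<le> m" for m
    using that
  proof (induction m rule: dec_induct)
    case base
    then show ?case using S3 by (simp add: eval_nat_numeral)
  next
    case (step m)
    have "1 / real (Suc m) * (1 / real (Suc m) + 1 / (2 * real (Suc (Suc m)))) \<le> 1 / 4 * (1 / 4 + 1 / (2 * 5))"
      using step.hyps by (intro mult_mono add_mono divide_left_mono) auto
    then have "1 / 2 * (2 / 3) ^ Suc m * (1 / real (Suc m) * (1 / real (Suc m) + 1 / (2 * real (Suc (Suc m)))))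
        \<le> 1 / 2 * (2 / 3) ^ Suc m * (7 / 80)"
      by (intro mult_left_mono) auto
    from order_trans[OF src_le this]
    have "2 ^ m * \<bar>src m\<bar> \<le> 7 / 160 * (2 / 3) ^ Suc m" by simp
    then show ?case using step.IH by simp
  qed
  from this[of "max n 3"] have "?S (max n 3) \<le> 54 / 100"
    using zero_le_power[of "2 / 3 :: real" "Suc (max n 3)"] by linarith
  moreover have "?S n \<le> ?S (max n 3)" by (rule sum_mono2) auto
  ultimately show ?thesis by linarith
qed

text \<open>The three contributions nearly cancel (the value is about 0.03), so the series is
  evaluated through its third term, with a geometric remainder of at most 1/128.\<close>

lemma A_entry_1_0_bound: "\<bar>A_entry 1 0\<bar> \<le> 4 / 100"
proof -
  let ?f = "\<lambda>m. (- 1) ^ Suc m / ((real (Suc m))\<^sup>2 * 2 ^ Suc m) :: real"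
  have b: "\<bar>?f (m + 3)\<bar> \<le> 1 / 256 * (1 / 2) ^ m" for m
  proof -
    have "(16 :: real) \<le> (real (Suc (m + 3)))\<^sup>2"
      using power_mono[of 4 "real (Suc (m + 3))" 2] by simp
    then have "(256 :: real) * 2 ^ m \<le> (real (Suc (m + 3)))\<^sup>2 * 2 ^ Suc (m + 3)"
      using mult_right_mono[of 16 "(real (Suc (m + 3)))\<^sup>2" "2 ^ Suc (m + 3)"] by (simp add: eval_nat_numeral)
    then have "1 / ((real (Suc (m + 3)))\<^sup>2 * 2 ^ Suc (m + 3)) \<le> 1 / (256 * 2 ^ m)"
      by (rule divide_left_mono) auto
    then show ?thesis by (simp add: abs_divide power_abs abs_mult power_one_over del: of_nat_Suc)
  qed
  have g: "(\<lambda>m. 1 / 256 * (1 / 2 :: real) ^ m) sums (1 / 256 * (1 / (1 - 1 / 2)))"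
    by (intro sums_mult geometric_sums) auto
  have sa: "summable (\<lambda>m. \<bar>?f (m + 3)\<bar>)"
    by (rule summable_comparison_test'[OF sums_summable[OF g], of 0]) (use b in auto)
  have s: "summable ?f"
    using summable_rabs_cancel[OF sa] summable_iff_shift[of ?f 3] by blast
  have "\<bar>\<Sum>m. ?f (m + 3)\<bar> \<le> (\<Sum>m. \<bar>?f (m + 3)\<bar>)" by (rule summable_rabs[OF sa])
  also have "\<dots> \<le> 1 / 128" using sums_le[OF b summable_sums[OF sa] g] by simp
  finally have r: "\<bar>\<Sum>m. ?f (m + 3)\<bar> \<le> 1 / 128" .
  have p: "suminf ?f = (\<Sum>m. ?f (m + 3)) + (\<Sum>m<3. ?f m)" by (rule suminf_split_initial_segment[OF s])
  have q: "(\<Sum>m<3. ?f m) = - 1 / 2 + 1 / 16 - 1 / 72" by (simp add: eval_nat_numeral)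
  have "(31415 / 10000)\<^sup>2 \<le> pi\<^sup>2" "pi\<^sup>2 \<le> (31416 / 10000)\<^sup>2"
    using pi_approx by (auto intro!: power_mono)
  then have "98 / 10 \<le> pi\<^sup>2" "pi\<^sup>2 \<le> 98697 / 10000" by (simp_all add: power2_eq_square)
  moreover have "A_entry 1 0 = pi\<^sup>2 / 12 + suminf ?f - ln 2 / 2" by (simp add: A_entry.simps)
  ultimately show ?thesis using ln2_bounds r p q by linarith
qed

section \<open>Elimination of the core coordinates\<close>

definition core_solution :: "nat \<Rightarrow> 'a::real_normed_field \<Rightarrow> (nat \<Rightarrow> 'a) \<Rightarrow> (nat \<Rightarrow> 'a) \<Rightarrow> bool" where
  "core_solution n z c a \<longleftrightarrow> (\<forall>i<n. z * a i = c i + (\<Sum>j<n. of_real (core i j) * a j))"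

text \<open>Weighting the rows, adding them and exchanging the sums leaves weighted column sums, so
  q acts as the operator norm on weighted l^1. The same q serves every n, since a column of the core
  ends at its diagonal.\<close>

lemma core_estimate:
  fixes a :: "nat \<Rightarrow> 'a::real_normed_field"
  assumes sol: "core_solution n z c a" and \<rho>: "0 \<le> \<rho>"
    and col: "\<And>j. (\<Sum>i\<le>j. \<bar>core i j\<bar> * \<rho> ^ i) \<le> q * \<rho> ^ j"
  shows "(norm z - q) * (\<Sum>i<n. \<rho> ^ i * norm (a i)) \<le> (\<Sum>i<n. \<rho> ^ i * norm (c i))"
proof -
  have "norm z * (\<Sum>i<n. \<rho> ^ i * norm (a i)) = (\<Sum>i<n. \<rho> ^ i * norm (z * a i))"
    by (simp add: sum_distrib_left norm_mult mult_ac)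
  also have "\<dots> \<le> (\<Sum>i<n. \<rho> ^ i * norm (c i) + (\<Sum>j<n. norm (a j) * (\<bar>core i j\<bar> * \<rho> ^ i)))"
  proof (rule sum_mono)
    fix i assume "i \<in> {..<n}"
    then have "norm (z * a i) \<le> norm (c i) + norm (\<Sum>j<n. of_real (core i j) * a j)"
      using sol by (auto simp: core_solution_def intro: norm_triangle_ineq)
    also have "norm (\<Sum>j<n. of_real (core i j) * a j) \<le> (\<Sum>j<n. \<bar>core i j\<bar> * norm (a j))"
      by (rule order_trans[OF norm_sum]) (simp add: norm_mult)
    finally have "\<rho> ^ i * norm (z * a i) \<le> \<rho> ^ i * (norm (c i) + (\<Sum>j<n. \<bar>core i j\<bar> * norm (a j)))"
      using \<rho> by (intro mult_left_mono) auto
    then show "\<rho> ^ i * norm (z * a i) \<le> \<rho> ^ i * norm (c i) + (\<Sum>j<n. norm (a j) * (\<bar>core i j\<bar> * \<rho> ^ i))"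
      by (simp add: distrib_left sum_distrib_left mult_ac)
  qed
  also have "\<dots> = (\<Sum>i<n. \<rho> ^ i * norm (c i)) + (\<Sum>j<n. norm (a j) * (\<Sum>i<n. \<bar>core i j\<bar> * \<rho> ^ i))"
    unfolding sum.distrib sum_distrib_left by (subst sum.swap) simp
  also have "(\<Sum>j<n. norm (a j) * (\<Sum>i<n. \<bar>core i j\<bar> * \<rho> ^ i)) \<le> (\<Sum>j<n. norm (a j) * (q * \<rho> ^ j))"
  proof (intro sum_mono mult_left_mono)
    fix j assume "j \<in> {..<n}"
    then have "(\<Sum>i<n. \<bar>core i j\<bar> * \<rho> ^ i) = (\<Sum>i\<le>j. \<bar>core i j\<bar> * \<rho> ^ i)"
      by (intro sum.mono_neutral_right) (auto simp: core_above)
    then show "(\<Sum>i<n. \<bar>core i j\<bar> * \<rho> ^ i) \<le> q * \<rho> ^ j" using col by simp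
  qed auto
  also have "(\<Sum>j<n. norm (a j) * (q * \<rho> ^ j)) = q * (\<Sum>i<n. \<rho> ^ i * norm (a i))"
    by (simp add: sum_distrib_left mult_ac)
  finally show ?thesis by (simp add: left_diff_distrib)
qed

text \<open>Back substitution: the last coordinate is determined by its own row, and its column is
  moved into the source of the smaller system. Diagonal entries are at most 1/4 in modulus.\<close>

lemma core_solution_exists:
  fixes \<mu> :: real assumes "1 / 4 < \<mu>"
  shows "\<exists>a. core_solution n \<mu> c a \<and> (\<forall>i\<ge>n. a i = 0)"
proof (induction n arbitrary: c)
  case (Suc n)
  define t where "t = c n / (\<mu> - core n n)"
  obtain a where a: "core_solution n \<mu> (\<lambda>i. c i + core i n * t) a" "\<forall>i\<ge>n. a i = 0" using Suc.IH by blast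
  have ne: "\<mu> - core n n \<noteq> 0" using core_diag[of n] assms by auto
  have s: "(\<Sum>j<Suc n. core i j * (a(n := t)) j) = (\<Sum>j<n. core i j * a j) + core i n * t" for i
  proof -
    have "(\<Sum>j<n. core i j * (a(n := t)) j) = (\<Sum>j<n. core i j * a j)" by (rule sum.cong) auto
    then show ?thesis by simp
  qed
  have "core_solution (Suc n) \<mu> c (a(n := t))"
    unfolding core_solution_def
  proof (intro allI impI)
    fix i assume "i < Suc n"
    then consider "i < n" | "i = n" by linarith
    then show "\<mu> * (a(n := t)) i = c i + (\<Sum>j<Suc n. of_real (core i j) * (a(n := t)) j)"
    proof cases
      case 1
      then show ?thesis using a(1) s[of i] by (simp add: core_solution_def)
    next
      case 2
      have "(\<Sum>j<n. core n j * a j) = 0" by (intro sum.neutral) (auto simp: core_above)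
      moreover have "\<mu> * t = c n + core n n * t" using ne by (simp add: t_def field_simps)
      ultimately show ?thesis using s[of n] 2 by simp
    qed
  qed
  moreover have "\<forall>i\<ge>Suc n. (a(n := t)) i = 0" using a(2) by simp
  ultimately show ?case by blast
qed (auto simp: core_solution_def)

text \<open>For an eigenvector $(1, u_1, a)$ the first row gives $u_1 = 1/2 - z$; then the second row says
  that $z$ is the value of the following map.\<close>

definition eig_map :: "nat \<Rightarrow> 'a::real_normed_field \<Rightarrow> (nat \<Rightarrow> 'a) \<Rightarrow> 'a" where
  "eig_map n z a = of_real (1 / 2 + ln 2) - (of_real (A_entry 1 0) + (\<Sum>j<n. of_real (obs j) * a j)) / (z - of_real (1 / 2))"

lemma obs_sum_bound:
  fixes a :: "nat \<Rightarrow> 'a::real_normed_field"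
  shows "norm (\<Sum>j<n. of_real (obs j) * a j) \<le> 1 / 4 * (\<Sum>j<n. 2 ^ j * norm (a j))"
proof -
  have "norm (\<Sum>j<n. of_real (obs j) * a j) \<le> (\<Sum>j<n. \<bar>obs j\<bar> * norm (a j))"
    by (rule order_trans[OF norm_sum]) (simp add: norm_mult)
  also have "\<dots> \<le> (\<Sum>j<n. (1 / 4 * 2 ^ j) * norm (a j))"
    by (intro sum_mono mult_right_mono obs_bound) auto
  finally show ?thesis by (simp add: sum_distrib_left mult_ac)
qed

text \<open>Generic scalars serve two purposes: real ones locate the fixed point, complex ones
  exclude competing eigenvalues. Uniformity in n comes from \<open>core_estimate\<close>.\<close>

lemma eig_map_contraction:
  fixes z w :: "'a::real_normed_field"
  assumes z: "108 / 100 \<le> norm z" and w: "108 / 100 \<le> norm w"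
    and a: "core_solution n z (\<lambda>i. of_real (src i)) a" and b: "core_solution n w (\<lambda>i. of_real (src i)) b"
  shows "norm (eig_map n z a - eig_map n w b) \<le> 95 / 100 * norm (z - w)"
proof -
  let ?N = "\<lambda>a. \<Sum>i<n. 2 ^ i * norm (a i)" and ?h = "1 / 2 :: real"
  let ?d = "\<lambda>i. a i - b i"
  have "(norm w - 1 / 4) * ?N b \<le> 54 / 100"
    using core_estimate[OF b, of 2 "1/4"] core_column_2 src_norm_2[of n] by simp
  \<comment> \<open>83/100 is 108/100 minus the core norm 1/4; likewise 58/100 below is 108/100
    minus 1/2.\<close>
  moreover have "83 / 100 * ?N b \<le> (norm w - 1 / 4) * ?N b"
    using w by (intro mult_right_mono sum_nonneg) auto
  ultimately have Nb: "?N b \<le> 54 / 83" by linarith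
  \<comment> \<open>The difference of the two solutions solves the system at z with source - (z - w)
    b, so its norm is proportional to that of z - w.\<close>
  have "core_solution n z (\<lambda>i. - ((z - w) * b i)) ?d"
    unfolding core_solution_def
  proof (intro allI impI)
    fix i assume "i < n"
    then have "z * a i = of_real (src i) + (\<Sum>j<n. of_real (core i j) * a j)"
      "w * b i = of_real (src i) + (\<Sum>j<n. of_real (core i j) * b j)"
      using a b by (auto simp: core_solution_def)
    then have "z * a i - w * b i = (\<Sum>j<n. of_real (core i j) * ?d j)"
      by (simp add: right_diff_distrib sum_subtractf)
    then show "z * ?d i = - ((z - w) * b i) + (\<Sum>j<n. of_real (core i j) * ?d j)"
      by (simp add: algebra_simps)
  qed
  from core_estimate[OF this, of 2 "1/4"]
  have "(norm z - 1 / 4) * ?N ?d \<le> (\<Sum>i<n. 2 ^ i * norm (- ((z - w) * b i)))"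
    using core_column_2 by simp
  also have "\<dots> = norm (z - w) * ?N b" by (simp add: norm_mult sum_distrib_left mult_ac)
  also have "\<dots> \<le> norm (z - w) * (54 / 83)" by (intro mult_left_mono Nb) auto
  finally have "(norm z - 1 / 4) * ?N ?d \<le> norm (z - w) * (54 / 83)" .
  moreover have "83 / 100 * ?N ?d \<le> (norm z - 1 / 4) * ?N ?d"
    using z by (intro mult_right_mono sum_nonneg) auto
  ultimately have Nd: "?N ?d \<le> norm (z - w) * (5400 / 6889)" by linarith
  define H where "H = of_real (A_entry 1 0) + (\<Sum>j<n. of_real (obs j) * a j)"
  define K where "K = of_real (A_entry 1 0) + (\<Sum>j<n. of_real (obs j) * b j)"
  have HK: "norm (H - K) \<le> norm (z - w) * (1350 / 6889)"
  proof -
    have "H - K = (\<Sum>j<n. of_real (obs j) * ?d j)" by (simp add: H_def K_def right_diff_distrib sum_subtractf)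
    then show ?thesis using obs_sum_bound[of ?d n] Nd by simp
  qed
  have Kn: "norm K \<le> 4 / 100 + 27 / 166"
  proof -
    have "norm K \<le> norm (of_real (A_entry 1 0) :: 'a) + norm (\<Sum>j<n. of_real (obs j) * b j)"
      unfolding K_def by (rule norm_triangle_ineq)
    then show ?thesis using A_entry_1_0_bound obs_sum_bound[of b n] Nb by simp
  qed
  have zh: "58 / 100 \<le> norm (z - of_real ?h)" and wh: "58 / 100 \<le> norm (w - of_real ?h)"
    using z w norm_triangle_ineq2[of z "of_real ?h"] norm_triangle_ineq2[of w "of_real ?h"]
    by (simp_all only: norm_of_real)
  have nz: "z - of_real ?h \<noteq> 0" "w - of_real ?h \<noteq> 0" using zh wh by (metis norm_zero not_le zero_less_divide_iff zero_less_numeral)+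
  have "eig_map n z a - eig_map n w b = K / (w - of_real ?h) - H / (z - of_real ?h)"
    by (simp add: eig_map_def H_def K_def)
  also have "\<dots> = - ((H - K) / (z - of_real ?h)) + K * (z - w) / ((z - of_real ?h) * (w - of_real ?h))"
  proof -
    have "K / W - H / Z = - ((H - K) / Z) + K * (Z - W) / (Z * W)" if "Z \<noteq> 0" "W \<noteq> 0" for Z W :: 'a
      using that by (simp add: field_simps)
    from this[OF nz] show ?thesis by simp
  qed
  finally have "norm (eig_map n z a - eig_map n w b)
      \<le> norm (H - K) / norm (z - of_real ?h) + norm K * norm (z - w) / (norm (z - of_real ?h) * norm (w - of_real ?h))"
    using norm_triangle_ineq[of "- ((H - K) / (z - of_real ?h))" "K * (z - w) / ((z - of_real ?h) * (w - of_real ?h))"]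
    by (simp only: norm_minus_cancel norm_divide norm_mult)
  \<comment> \<open>The two summands are about 0.34 and 0.60 times the norm of z - w.\<close>
  also have "\<dots> \<le> (norm (z - w) * (1350 / 6889)) / (58 / 100) + (4 / 100 + 27 / 166) * norm (z - w) / (58 / 100 * (58 / 100))"
    by (intro add_mono frac_le mult_mono HK Kn zh wh) auto
  also have "\<dots> = ((1350 / 6889) / (58 / 100) + (4 / 100 + 27 / 166) / (58 / 100 * (58 / 100))) * norm (z - w)"
    by (simp add: algebra_simps)
  also have "\<dots> \<le> 95 / 100 * norm (z - w)" by (intro mult_right_mono) auto
  finally show ?thesis .
qed

lemma sum_atMost_Suc_split: "(\<Sum>j\<le>Suc n. f j) = f 0 + f 1 + (\<Sum>j<n. f (Suc (Suc j)))"
  for f :: "nat \<Rightarrow> 'a::comm_monoid_add"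
  by (simp only: sum.atMost_Suc_shift[of f n] lessThan_Suc_atMost[symmetric] sum.lessThan_Suc_shift) (simp add: add.assoc)

section \<open>From matrices to the scalar fixed-point equation\<close>

lemma eigenvalue_A_trunc_iff:
  "eigenvalue (A_trunc N) z \<longleftrightarrow>
     (\<exists>u. (\<exists>i\<le>N. u i \<noteq> 0) \<and> (\<forall>i\<le>N. (\<Sum>j\<le>N. of_real (A_entry i j) * u j) = z * u i))"
proof
  assume "eigenvalue (A_trunc N) z"
  then obtain x where x: "x \<in> carrier_vec (N + 1)" "x \<noteq> 0\<^sub>v (N + 1)" "A_trunc N *\<^sub>v x = z \<cdot>\<^sub>v x"
    by (auto simp: eigenvalue_def eigenvector_def A_trunc_def)
  have "\<exists>i\<le>N. vec_index x i \<noteq> 0"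
  proof (rule ccontr)
    assume "\<not> ?thesis"
    then have "x = 0\<^sub>v (N + 1)" using x(1) by (intro eq_vecI) auto
    then show False using x(2) by simp
  qed
  moreover have "(\<Sum>j\<le>N. of_real (A_entry i j) * vec_index x j) = z * vec_index x i" if "i \<le> N" for i
  proof -
    have "vec_index (A_trunc N *\<^sub>v x) i = (\<Sum>j<N + 1. of_real (A_entry i j) * vec_index x j)"
      using that x(1) by (simp add: A_trunc_def scalar_prod_def atLeast0LessThan)
    moreover have "vec_index (z \<cdot>\<^sub>v x) i = z * vec_index x i" using that x(1) by simp
    ultimately show ?thesis using x(3) by (simp add: lessThan_Suc_atMost)
  qed
  ultimately show "\<exists>u. (\<exists>i\<le>N. u i \<noteq> 0) \<and> (\<forall>i\<le>N. (\<Sum>j\<le>N. of_real (A_entry i j) * u j) = z * u i)" by blast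
next
  assume "\<exists>u. (\<exists>i\<le>N. u i \<noteq> 0) \<and> (\<forall>i\<le>N. (\<Sum>j\<le>N. of_real (A_entry i j) * u j) = z * u i)"
  then obtain u i0 where u: "i0 \<le> N" "u i0 \<noteq> 0" "\<And>i. i \<le> N \<Longrightarrow> (\<Sum>j\<le>N. of_real (A_entry i j) * u j) = z * u i" by blast
  let ?x = "Matrix.vec (N + 1) u"
  have "vec_index ?x i0 \<noteq> vec_index (0\<^sub>v (N + 1)) i0" using u(1,2) by simp
  then have "?x \<noteq> 0\<^sub>v (N + 1)" by auto
  moreover have "A_trunc N *\<^sub>v ?x = z \<cdot>\<^sub>v ?x"
  proof (rule eq_vecI)
    fix i assume "i < dim_vec (z \<cdot>\<^sub>v ?x)"
    then have i: "i \<le> N" by simp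
    have "vec_index (A_trunc N *\<^sub>v ?x) i = (\<Sum>j<N + 1. of_real (A_entry i j) * u j)"
      using i by (simp add: A_trunc_def scalar_prod_def atLeast0LessThan)
    then show "vec_index (A_trunc N *\<^sub>v ?x) i = vec_index (z \<cdot>\<^sub>v ?x) i"
      using u(3)[OF i] i by (simp add: lessThan_Suc_atMost)
  qed (simp add: A_trunc_def)
  ultimately show "eigenvalue (A_trunc N) z"
    unfolding eigenvalue_def eigenvector_def by (intro exI[of _ ?x]) (simp add: A_trunc_def)
qed

lemma eigenvalue_A_trunc:
  assumes z: "108 / 100 \<le> cmod z"
  shows "eigenvalue (A_trunc (Suc n)) z \<longleftrightarrow>
     (\<exists>a. core_solution n z (\<lambda>i. of_real (src i)) a \<and> z = eig_map n z a)"
proof -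
  let ?h = "of_real (1 / 2) :: complex"
  have zh: "z - ?h \<noteq> 0"
  proof
    assume "z - ?h = 0"
    then have "z = ?h" by (simp only: right_minus_eq)
    then have "cmod z = cmod ?h" by (simp only:)
    also have "\<dots> = 1 / 2" by (simp only: norm_of_real)
    finally show False using z by simp
  qed
  have row: "(\<Sum>j\<le>Suc n. of_real (A_entry i j) * u j)
      = of_real (A_entry i 0) * u 0 + of_real (A_entry i 1) * u 1 + (\<Sum>j<n. of_real (A_entry i (Suc (Suc j))) * u (Suc (Suc j)))"
    for i and u :: "nat \<Rightarrow> complex" by (rule sum_atMost_Suc_split)
  have rows: "(\<forall>i\<le>Suc n. (\<Sum>j\<le>Suc n. of_real (A_entry i j) * u j) = z * u i) \<longleftrightarrow>
      ?h * u 0 - u 1 = z * u 0 \<and>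
      of_real (A_entry 1 0) * u 0 + of_real (1 / 2 + ln 2) * u 1 + (\<Sum>j<n. of_real (obs j) * u (Suc (Suc j))) = z * u 1 \<and>
      core_solution n z (\<lambda>i. of_real (src i) * u 0) (\<lambda>i. u (Suc (Suc i)))" (is "?L \<longleftrightarrow> ?R") for u
  proof -
    have "?L \<longleftrightarrow> (\<Sum>j\<le>Suc n. of_real (A_entry 0 j) * u j) = z * u 0 \<and> (\<Sum>j\<le>Suc n. of_real (A_entry 1 j) * u j) = z * u 1
       \<and> (\<forall>i<n. (\<Sum>j\<le>Suc n. of_real (A_entry (Suc (Suc i)) j) * u j) = z * u (Suc (Suc i)))"
      unfolding less_Suc_eq_le[symmetric] All_less_Suc2 One_nat_def ..
    moreover have "(\<Sum>j\<le>Suc n. of_real (A_entry 0 j) * u j) = ?h * u 0 - u 1"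
      unfolding row by (simp add: A_entry.simps)
    moreover have "(\<Sum>j\<le>Suc n. of_real (A_entry 1 j) * u j)
       = of_real (A_entry 1 0) * u 0 + of_real (1 / 2 + ln 2) * u 1 + (\<Sum>j<n. of_real (obs j) * u (Suc (Suc j)))"
      unfolding row by (simp add: A_entry.simps(4) obs_def)
    moreover have "(\<Sum>j\<le>Suc n. of_real (A_entry (Suc (Suc i)) j) * u j)
       = of_real (src i) * u 0 + (\<Sum>j<n. of_real (core i j) * u (Suc (Suc j)))" for i
      unfolding row by (simp add: A_entry.simps(4) src_def core_def)
    ultimately show ?thesis unfolding core_solution_def by auto
  qed
  have key: "of_real (A_entry 1 0) + of_real (1 / 2 + ln 2) * (?h - z) + S = z * (?h - z)
      \<longleftrightarrow> z = of_real (1 / 2 + ln 2) - (of_real (A_entry 1 0) + S) / (z - ?h)" for S :: complex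
  proof -
    have "z = b - (c + S) / (z - h) \<longleftrightarrow> c + b * (h - z) + S = z * (h - z)" if "z - h \<noteq> 0" for b c h :: complex
    proof -
      have "z = b - (c + S) / (z - h) \<longleftrightarrow> (c + S) / (z - h) = b - z" by (auto simp: algebra_simps)
      also have "\<dots> \<longleftrightarrow> c + S = (b - z) * (z - h)" by (rule nonzero_divide_eq_eq[OF that])
      also have "\<dots> \<longleftrightarrow> c + S - (b - z) * (z - h) = 0" by simp
      also have "c + S - (b - z) * (z - h) = c + b * (h - z) + S - z * (h - z)" by (simp add: algebra_simps)
      finally show ?thesis by simp
    qed
    from this[OF zh] show ?thesis by blast
  qed
  show ?thesis
  proof
    assume "eigenvalue (A_trunc (Suc n)) z"
    then obtain u where nz: "\<exists>i\<le>Suc n. u i \<noteq> 0" and r: "?h * u 0 - u 1 = z * u 0"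
      "of_real (A_entry 1 0) * u 0 + of_real (1 / 2 + ln 2) * u 1 + (\<Sum>j<n. of_real (obs j) * u (Suc (Suc j))) = z * u 1"
      "core_solution n z (\<lambda>i. of_real (src i) * u 0) (\<lambda>i. u (Suc (Suc i)))"
      unfolding eigenvalue_A_trunc_iff rows by blast
    have u1: "u 1 = (?h - z) * u 0" using r(1) by (simp add: algebra_simps)
    \<comment> \<open>If it vanished, so would u 1 by the first row, and the rest would be an
      eigenvector of the core for an eigenvalue of modulus above 1/4, the bound on its norm.\<close>
    have u0: "u 0 \<noteq> 0"
    proof
      assume u0: "u 0 = 0"
      have "(cmod z - 1 / 4) * (\<Sum>i<n. 2 ^ i * cmod (u (Suc (Suc i)))) \<le> 0"
        using core_estimate[OF r(3), of 2 "1/4"] core_column_2 u0 by simp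
      then have "(\<Sum>i<n. 2 ^ i * cmod (u (Suc (Suc i)))) \<le> 0" using z by (simp add: mult_le_0_iff)
      then have "(\<Sum>i<n. 2 ^ i * cmod (u (Suc (Suc i)))) = 0" by (intro antisym sum_nonneg) auto
      then have "\<forall>i<n. u (Suc (Suc i)) = 0" by (subst (asm) sum_nonneg_eq_0_iff) auto
      moreover have "u 1 = 0" using u1 u0 by simp
      ultimately have "u i = 0" if "i \<le> Suc n" for i
        using that u0 by (cases i; cases "i - 1") auto
      then show False using nz by blast
    qed
    define a where "a = (\<lambda>i. u (Suc (Suc i)) / u 0)"
    have "core_solution n z (\<lambda>i. of_real (src i)) a"
      using r(3) u0 unfolding core_solution_def a_def
      by (auto simp: field_simps sum_divide_distrib[symmetric] sum_distrib_left)
    moreover have "z = eig_map n z a"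
    proof -
      have s: "(\<Sum>j<n. of_real (obs j) * u (Suc (Suc j))) = u 0 * (\<Sum>j<n. of_real (obs j) * a j)"
        using u0 by (simp add: a_def sum_distrib_left)
      have "u 0 * (of_real (A_entry 1 0) + of_real (1 / 2 + ln 2) * (?h - z) + (\<Sum>j<n. of_real (obs j) * a j)) = u 0 * (z * (?h - z))"
        using r(2) unfolding u1 s by (simp only: algebra_simps)
      then show ?thesis using u0 key unfolding eig_map_def mult_cancel_left by blast
    qed
    ultimately show "\<exists>a. core_solution n z (\<lambda>i. of_real (src i)) a \<and> z = eig_map n z a" by blast
  next
    assume "\<exists>a. core_solution n z (\<lambda>i. of_real (src i)) a \<and> z = eig_map n z a"
    then obtain a where a: "core_solution n z (\<lambda>i. of_real (src i)) a" "z = eig_map n z a" by blast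
    define u where "u = (\<lambda>i. if i = 0 then 1 else if i = 1 then ?h - z else a (i - 2))"
    have "of_real (A_entry 1 0) + of_real (1 / 2 + ln 2) * (?h - z) + (\<Sum>j<n. of_real (obs j) * a j) = z * (?h - z)"
      unfolding key using a(2) by (simp only: eig_map_def)
    then have "\<forall>i\<le>Suc n. (\<Sum>j\<le>Suc n. of_real (A_entry i j) * u j) = z * u i"
      unfolding rows using a(1) by (simp add: u_def algebra_simps)
    moreover have "u 0 \<noteq> 0" by (simp add: u_def)
    ultimately show "eigenvalue (A_trunc (Suc n)) z" unfolding eigenvalue_A_trunc_iff by blast
  qed
qed

text \<open>An eigenvalue of modulus at least \<mu> also solves the fixed-point equation, and a
  contraction has only one fixed point. This settles existence and uniqueness in the definite
  description at once.\<close>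

lemma max_eigenvalue_A_trunc:
  assumes \<mu>: "108 / 100 \<le> \<mu>" and a: "core_solution n \<mu> src a" "\<mu> = eig_map n \<mu> a"
  shows "max_eigenvalue (A_trunc (Suc n)) = \<mu>"
proof -
  let ?c = "complex_of_real"
  have "core_solution n (?c \<mu>) (\<lambda>i. of_real (src i)) (\<lambda>i. ?c (a i))"
    using a(1) unfolding core_solution_def by (simp flip: of_real_mult of_real_add of_real_sum)
  moreover have "eig_map n (?c \<mu>) (\<lambda>i. ?c (a i)) = ?c (eig_map n \<mu> a)"
    unfolding eig_map_def by simp
  ultimately have sol: "core_solution n (?c \<mu>) (\<lambda>i. of_real (src i)) (\<lambda>i. ?c (a i))"
    "?c \<mu> = eig_map n (?c \<mu>) (\<lambda>i. ?c (a i))" using a(2) by auto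
  have e\<mu>: "eigenvalue (A_trunc (Suc n)) (?c \<mu>)"
    by (subst eigenvalue_A_trunc) (use sol \<mu> in auto)
  have dom: "cmod z < \<bar>\<mu>\<bar>" if z: "eigenvalue (A_trunc (Suc n)) z" "z \<noteq> ?c \<mu>" for z
  proof (rule ccontr)
    assume "\<not> cmod z < \<bar>\<mu>\<bar>"
    then have zn: "108 / 100 \<le> cmod z" using \<mu> by simp
    then obtain b where b: "core_solution n z (\<lambda>i. of_real (src i)) b" "z = eig_map n z b"
      using z(1) eigenvalue_A_trunc by blast
    have "norm (eig_map n z b - eig_map n (?c \<mu>) (\<lambda>i. ?c (a i))) \<le> 95 / 100 * norm (z - ?c \<mu>)"
      by (rule eig_map_contraction[OF zn _ b(1) sol(1)]) (use \<mu> in simp)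
    then have "norm (z - ?c \<mu>) \<le> 95 / 100 * norm (z - ?c \<mu>)" using b(2) sol(2) by simp
    then show False using z(2) by simp
  qed
  show ?thesis unfolding max_eigenvalue_def
  proof (rule the_equality)
    show "eigenvalue (A_trunc (Suc n)) (?c \<mu>) \<and> (\<forall>z. eigenvalue (A_trunc (Suc n)) z \<and> z \<noteq> ?c \<mu> \<longrightarrow> cmod z < \<bar>\<mu>\<bar>)"
      using e\<mu> dom by blast
    fix l assume l: "eigenvalue (A_trunc (Suc n)) (?c l) \<and> (\<forall>z. eigenvalue (A_trunc (Suc n)) z \<and> z \<noteq> ?c l \<longrightarrow> cmod z < \<bar>l\<bar>)"
    show "l = \<mu>"
    proof (rule ccontr)
      assume "l \<noteq> \<mu>"
      then have "?c l \<noteq> ?c \<mu>" by simp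
      then have "cmod (?c l) < \<bar>\<mu>\<bar>" by (rule dom[OF conjunct1[OF l]])
      moreover have "cmod (?c \<mu>) < \<bar>l\<bar>"
        using conjunct2[OF l, rule_format, of "?c \<mu>"] e\<mu> \<open>?c l \<noteq> ?c \<mu>\<close> by simp
      ultimately show False by simp
    qed
  qed
qed

text \<open>The limit l is only an approximate fixed point of the n-th map, with error tending to 0;
  since the contraction rate does not depend on n, the true fixed points approach l.\<close>

lemma max_eigenvalue_tendsto:
  assumes l: "217 / 200 \<le> l" and s: "\<And>n. core_solution n l src (s n)"
    and lim: "(\<lambda>n. eig_map n l (s n)) \<longlonglongrightarrow> l"
  shows "(\<lambda>n. max_eigenvalue (A_trunc n)) \<longlonglongrightarrow> l"
proof -
  have "(\<lambda>n. max_eigenvalue (A_trunc (Suc n))) \<longlonglongrightarrow> l"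
  proof (rule LIMSEQ_I)
    fix r :: real assume r: "0 < r"
    \<comment> \<open>The bound 5/1000 keeps the interval around l above 108/100, where the
      contraction holds.\<close>
    define e where "e = min (r / 2) (5 / 1000)"
    have e: "0 < e" "e < r" "e \<le> 5 / 1000" using r by (auto simp: e_def)
    \<comment> \<open>The error e / 20 together with 95/100 e is at most e, so the interval is
      mapped into itself.\<close>
    obtain N where N: "\<And>n. n \<ge> N \<Longrightarrow> norm (eig_map n l (s n) - l) < e / 20"
      using LIMSEQ_D[OF lim, of "e / 20"] e by auto
    have "norm (max_eigenvalue (A_trunc (Suc n)) - l) < r" if n: "n \<ge> N" for n
    proof -
      have "\<forall>\<mu>. \<exists>a. 1 / 4 < \<mu> \<longrightarrow> core_solution n \<mu> src a" using core_solution_exists[of _ n src] by blast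
      then obtain S where S: "\<And>\<mu>. 1 / 4 < \<mu> \<Longrightarrow> core_solution n \<mu> src (S \<mu>)" by metis
      let ?F = "\<lambda>\<mu>. eig_map n \<mu> (S \<mu>)" and ?I = "{l - e..l + e}"
      have con: "\<bar>eig_map n x a - eig_map n y b\<bar> \<le> 95 / 100 * \<bar>x - y\<bar>"
        if "x \<in> ?I" "y \<in> ?I" "core_solution n x src a" "core_solution n y src b" for x y a b
        using eig_map_contraction[of x y n a b] that l e by simp
      have "\<exists>!\<mu>\<in>?I. ?F \<mu> = \<mu>"
      proof (rule Banach_fix)
        show "?F ` ?I \<subseteq> ?I"
        proof
          fix y assume "y \<in> ?F ` ?I"
          then obtain x where x: "x \<in> ?I" "y = ?F x" by blast
          have "\<bar>?F x - eig_map n l (s n)\<bar> \<le> 95 / 100 * \<bar>x - l\<bar>"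
            by (rule con) (use x S[of x] s l e in auto)
          moreover have "\<bar>x - l\<bar> \<le> e" using x by auto
          moreover have "\<bar>?F x - l\<bar> \<le> \<bar>?F x - eig_map n l (s n)\<bar> + \<bar>eig_map n l (s n) - l\<bar>"
            using abs_triangle_ineq[of "?F x - eig_map n l (s n)" "eig_map n l (s n) - l"] by simp
          moreover have "A \<le> 95 / 100 * D \<Longrightarrow> D \<le> e \<Longrightarrow> C \<le> A + B \<Longrightarrow> B < e / 20 \<Longrightarrow> C \<le> e"
            for A B C D :: real by linarith
          ultimately have "\<bar>?F x - l\<bar> \<le> e" using N[OF n] unfolding real_norm_def by blast
          then show "y \<in> ?I" using x(2) by auto
        qed
        show "dist (?F x) (?F y) \<le> 95 / 100 * dist x y" if "x \<in> ?I" "y \<in> ?I" for x y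
          using con[OF that S S] that l e by (simp add: dist_real_def)
      qed (use e in \<open>auto intro: compact_imp_complete\<close>)
      then obtain \<mu> where \<mu>: "\<mu> \<in> ?I" "?F \<mu> = \<mu>" by blast
      have "max_eigenvalue (A_trunc (Suc n)) = \<mu>"
        by (rule max_eigenvalue_A_trunc[of _ _ "S \<mu>"]) (use \<mu> S[of \<mu>] l e in auto)
      then show ?thesis using \<mu>(1) e by (auto simp: abs_less_iff)
    qed
    then show "\<exists>no. \<forall>n\<ge>no. norm (max_eigenvalue (A_trunc (Suc n)) - l) < r" by blast
  qed
  then show ?thesis by (rule LIMSEQ_imp_Suc)
qed

section \<open>The limit density\<close>

lemma log_lip_sum:
  "(\<And>k. k < n \<Longrightarrow> log_lip (f k)) \<Longrightarrow> log_lip (\<lambda>x. \<Sum>k<(n::nat). f k x)"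
proof (induction n)
  case 0
  then show ?case using log_lip_cmult[OF log_lip_ln, of 0] by simp
next
  case (Suc n)
  then show ?case by (simp add: log_lip_add)
qed

lemma log_lip_polynomial: "log_lip (\<lambda>x. l * ln x + (\<Sum>k<n. c k * (x - 1) ^ k))"
  by (intro log_lip_add log_lip_sum log_lip_cmult log_lip_ln log_lip_power)

lemma l1_series_tail:
  fixes c :: "nat \<Rightarrow> real"
  assumes c: "summable (\<lambda>k. \<bar>c k\<bar>)" and s: "\<bar>s\<bar> \<le> 1"
  shows "\<bar>(\<Sum>k. c k * s ^ k) - (\<Sum>k<n. c k * s ^ k)\<bar> \<le> (\<Sum>k. \<bar>c (k + n)\<bar>)"
proof -
  note sm = l1_series_summable[OF c s]
  have s1: "summable (\<lambda>k. \<bar>c (k + n) * s ^ (k + n)\<bar>)" using summable_ignore_initial_segment[OF sm(1), of n] .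
  have s2: "summable (\<lambda>k. \<bar>c (k + n)\<bar>)" using summable_ignore_initial_segment[OF c, of n] .
  have "(\<Sum>k. c k * s ^ k) - (\<Sum>k<n. c k * s ^ k) = (\<Sum>k. c (k + n) * s ^ (k + n))"
    using suminf_split_initial_segment[OF sm(2), of n] by simp
  also have "\<bar>\<dots>\<bar> \<le> (\<Sum>k. \<bar>c (k + n) * s ^ (k + n)\<bar>)" by (rule summable_rabs[OF s1])
  also have "\<dots> \<le> (\<Sum>k. \<bar>c (k + n)\<bar>)" by (rule suminf_le[OF sm(3) s1 s2])
  finally show ?thesis .
qed

lemma tame_log_series:
  assumes "summable (\<lambda>k. \<bar>c k\<bar>)" shows "tame (\<lambda>x. l * ln x + (\<Sum>k. c k * (x - 1) ^ k))"
  by (intro tame_add tame_cmult tame_ln tame_l1_series assms)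

lemma log_series_approx:
  assumes c: "summable (\<lambda>k. \<bar>c k\<bar>)" and \<epsilon>: "0 < (\<epsilon> :: real)"
  shows "\<exists>p. log_lip p \<and> (\<forall>x. 0 < x \<longrightarrow> x \<le> 2 \<longrightarrow> \<bar>l * ln x + (\<Sum>k. c k * (x - 1) ^ k) - p x\<bar> \<le> \<epsilon> * wt x)"
proof -
  obtain n where n: "norm (\<Sum>k. \<bar>c (k + n)\<bar>) < \<epsilon> / 2"
    using suminf_exist_split[OF half_gt_zero[OF \<epsilon>] c] by auto
  let ?p = "\<lambda>x. l * ln x + (\<Sum>k<n. c k * (x - 1) ^ k)"
  have "\<bar>l * ln x + (\<Sum>k. c k * (x - 1) ^ k) - ?p x\<bar> \<le> \<epsilon> * wt x" if x: "0 < x" "x \<le> 2" for x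
  proof -
    have "\<bar>(\<Sum>k. c k * (x - 1) ^ k) - (\<Sum>k<n. c k * (x - 1) ^ k)\<bar> \<le> \<epsilon> / 2"
    proof -
      have "\<bar>x - 1\<bar> \<le> 1" using x by auto
      from l1_series_tail[OF c this, of n] show ?thesis using n unfolding real_norm_def by linarith
    qed
    then show ?thesis using abs_le_wt[OF x] by fastforce
  qed
  then show ?thesis using log_lip_polynomial by blast
qed

lemma gcd_op_sum:
  "(\<And>k. k < n \<Longrightarrow> tame (f k)) \<Longrightarrow> gcd_op (\<lambda>x. \<Sum>k<(n::nat). f k x) = (\<lambda>x. \<Sum>k<n. gcd_op (f k) x)
     \<and> tame (\<lambda>x. \<Sum>k<n. f k x)"
proof (induction n)
  case 0
  then show ?case using gcd_op_cmult[OF tame_const[of 0], of 0] tame_const[of 0] by simp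
next
  case (Suc n)
  then show ?case by (simp add: gcd_op_add tame_add)
qed

text \<open>The choice 1/2 - l of the constant term makes the logarithm reproduce with factor l, and
  the core equations do the same for the positive powers below the cut. What is left is a defect in
  the constant term, independent of x, and the part of the logarithm's column that was cut
  off.\<close>

lemma gcd_op_log_polynomial:
  assumes sol: "core_solution n l src a" and x: "0 < x" "x \<le> 2" and l: "l \<noteq> 1 / 2"
  defines "f \<equiv> \<lambda>x. ln x + ((1 / 2 - l) + (\<Sum>i<n. a i * (x - 1) ^ Suc i))"
  shows "gcd_op f x = l * f x + (l - 1 / 2) * (l - eig_map n l a)
    + ((\<Sum>r. A_entry (Suc r) 0 * (x - 1) ^ r) - (\<Sum>r<Suc n. A_entry (Suc r) 0 * (x - 1) ^ r))"
proof -
  let ?s = "x - 1" and ?L = "\<Sum>r. A_entry (Suc r) 0 * (x - 1) ^ r"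
  have tp: "tame (\<lambda>x. a i * (x - 1) ^ Suc i)" for i by (intro tame_cmult tame_power)
  have p: "gcd_op (\<lambda>x. \<Sum>i<n. a i * (x - 1) ^ Suc i) x
      = (\<Sum>j<n. obs j * a j) + (\<Sum>i<n. (\<Sum>j<n. core i j * a j) * ?s ^ Suc i)"
  proof -
    have "gcd_op (\<lambda>x. a j * (x - 1) ^ Suc j) x = obs j * a j + (\<Sum>i<n. core i j * a j * ?s ^ Suc i)" if "j < n" for j
    proof -
      have "gcd_op (\<lambda>x. a j * (x - 1) ^ Suc j) x = a j * (\<Sum>r\<le>Suc j. A_entry (Suc r) (Suc (Suc j)) * ?s ^ r)"
        by (simp only: gcd_op_cmult[OF tame_power] gcd_op_power_expand[OF x])
      also have "(\<Sum>r\<le>Suc j. A_entry (Suc r) (Suc (Suc j)) * ?s ^ r) = obs j + (\<Sum>i\<le>j. core i j * ?s ^ Suc i)"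
        by (subst sum.atMost_Suc_shift) (simp add: obs_def core_def)
      also have "(\<Sum>i\<le>j. core i j * ?s ^ Suc i) = (\<Sum>i<n. core i j * ?s ^ Suc i)"
        by (rule sum.mono_neutral_left) (use that in \<open>auto simp: core_above\<close>)
      finally show ?thesis by (simp add: distrib_left sum_distrib_left mult_ac)
    qed
    then have "gcd_op (\<lambda>x. \<Sum>i<n. a i * (x - 1) ^ Suc i) x
        = (\<Sum>j<n. obs j * a j + (\<Sum>i<n. core i j * a j * ?s ^ Suc i))"
      using gcd_op_sum[of n "\<lambda>i x. a i * (x - 1) ^ Suc i", OF tp] by (auto intro: sum.cong)
    also have "\<dots> = (\<Sum>j<n. obs j * a j) + (\<Sum>i<n. (\<Sum>j<n. core i j * a j) * ?s ^ Suc i)"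
      unfolding sum.distrib sum_distrib_right by (subst (2) sum.swap) simp
    finally show ?thesis .
  qed
  have c: "gcd_op (\<lambda>x. 1 / 2 - l) x = (1 / 2 - l) * (1 / 2 + ln 2 - ln x)"
    using gcd_op_cmult[OF tame_const[of 1], of "1 / 2 - l"] gcd_op_one[OF x] by simp
  have ts: "tame (\<lambda>x. \<Sum>i<n. a i * (x - 1) ^ Suc i)" using gcd_op_sum[of n "\<lambda>i x. a i * (x - 1) ^ Suc i", OF tp] by simp
  have "gcd_op f x = gcd_op ln x + (gcd_op (\<lambda>x. 1 / 2 - l) x + gcd_op (\<lambda>x. \<Sum>i<n. a i * (x - 1) ^ Suc i) x)"
    unfolding f_def by (simp only: gcd_op_add tame_ln tame_const tame_add ts)
  also have "\<dots> = ln x / 2 + ?L + ((1 / 2 - l) * (1 / 2 + ln 2 - ln x)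
      + ((\<Sum>j<n. obs j * a j) + (\<Sum>i<n. (\<Sum>j<n. core i j * a j) * ?s ^ Suc i)))"
    by (simp only: gcd_op_ln[OF x] c p)
  finally have 1: "gcd_op f x = ln x / 2 + ?L + ((1 / 2 - l) * (1 / 2 + ln 2 - ln x)
      + ((\<Sum>j<n. obs j * a j) + (\<Sum>i<n. (\<Sum>j<n. core i j * a j) * ?s ^ Suc i)))" .
  have 2: "l * (\<Sum>i<n. a i * ?s ^ Suc i) = (\<Sum>i<n. src i * ?s ^ Suc i) + (\<Sum>i<n. (\<Sum>j<n. core i j * a j) * ?s ^ Suc i)"
  proof -
    have "l * (\<Sum>i<n. a i * ?s ^ Suc i) = (\<Sum>i<n. (l * a i) * ?s ^ Suc i)"
      by (simp add: sum_distrib_left mult_ac)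
    also have "\<dots> = (\<Sum>i<n. (src i + (\<Sum>j<n. core i j * a j)) * ?s ^ Suc i)"
      using sol by (intro sum.cong) (auto simp: core_solution_def)
    finally show ?thesis by (simp only: distrib_right sum.distrib)
  qed
  have 3: "(\<Sum>r<Suc n. A_entry (Suc r) 0 * ?s ^ r) = A_entry 1 0 + (\<Sum>i<n. src i * ?s ^ Suc i)"
    by (subst sum.lessThan_Suc_shift) (simp add: src_def)
  have 4: "(l - 1 / 2) * (l - eig_map n l a) = (l - 1 / 2) * (l - (1 / 2 + ln 2)) + (A_entry 1 0 + (\<Sum>j<n. obs j * a j))"
    using l by (simp add: eig_map_def field_simps)
  have 5: "l * f x = l * ln x + l * (1 / 2 - l) + l * (\<Sum>i<n. a i * ?s ^ Suc i)"
    by (simp add: f_def distrib_left)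
  show ?thesis unfolding 1 3 4 5 2 by (simp add: algebra_simps)
qed

text \<open>A solution padded by zeros solves a larger system up to the source beyond its length,
  because the core is upper triangular. The truncated solutions are therefore Cauchy in the weights
  3^i, with an error governed by the tail of the source.\<close>

lemma core_solution_limit:
  assumes l: "1 \<le> l" and s: "\<And>n. core_solution n l src (s n)" and s0: "\<And>n i. n \<le> i \<Longrightarrow> s n i = 0"
  obtains a e where "e \<longlonglongrightarrow> 0" "summable (\<lambda>i. 3 ^ i * \<bar>a i\<bar>)"
    "\<And>n K. (\<Sum>i<K. 3 ^ i * \<bar>a i - s n i\<bar>) \<le> e n"
proof -
  have ss: "summable (\<lambda>i. 3 ^ i * \<bar>src i\<bar>)"
  proof -
    have "summable (\<lambda>i. 1 / 3 * (\<bar>A_entry (Suc (Suc i)) 0\<bar> * 3 ^ Suc i))"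
      using log_column_summable summable_Suc_iff[of "\<lambda>r. \<bar>A_entry (Suc r) 0\<bar> * 3 ^ r"] by (intro summable_mult) simp
    then show ?thesis by (simp add: src_def mult_ac)
  qed
  \<comment> \<open>The factor 2 is 1 / (1 - 1/2), from l >= 1 and the core norm 1/2 at the weight
    3.\<close>
  define e where "e = (\<lambda>n. 2 * (\<Sum>i. 3 ^ (i + n) * \<bar>src (i + n)\<bar>))"
  have elim: "e \<longlonglongrightarrow> 0"
  proof -
    let ?f = "\<lambda>i. 3 ^ i * \<bar>src i\<bar>"
    have "(\<lambda>n. 2 * (suminf ?f - (\<Sum>i<n. ?f i))) \<longlonglongrightarrow> 2 * (suminf ?f - suminf ?f)"
      by (intro tendsto_intros summable_LIMSEQ ss)
    then show ?thesis unfolding e_def by (simp add: suminf_minus_initial_segment[OF ss])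
  qed
  \<comment> \<open>The range K is independent of m, so that m can tend to infinity with K
    fixed.\<close>
  have d: "(\<Sum>i<K. 3 ^ i * \<bar>s m i - s n i\<bar>) \<le> e n" if "n \<le> m" for n m K
  proof -
    let ?c = "\<lambda>i. if i < n then 0 else src i" and ?d = "\<lambda>i. s m i - s n i"
    have "core_solution m l ?c ?d"
      unfolding core_solution_def
    proof (intro allI impI)
      fix i assume i: "i < m"
      have m: "l * s m i = src i + (\<Sum>j<m. core i j * s m j)" using s[of m] i by (simp add: core_solution_def)
      have z: "(\<Sum>j<m. core i j * s n j) = (\<Sum>j<n. core i j * s n j)"
        by (rule sum.mono_neutral_right) (use that s0 in auto)
      have n: "l * s n i = (if i < n then src i else 0) + (\<Sum>j<m. core i j * s n j)"
      proof (cases "i < n")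
        case True
        then show ?thesis using s[of n] z by (simp add: core_solution_def)
      next
        case False
        then have "(\<Sum>j<n. core i j * s n j) = 0" by (intro sum.neutral) (auto simp: core_above)
        then show ?thesis using False s0 z by simp
      qed
      show "l * ?d i = ?c i + (\<Sum>j<m. of_real (core i j) * ?d j)"
        using m n by (simp add: right_diff_distrib sum_subtractf)
    qed
    from core_estimate[OF this, of 3 "1/2"]
    have "(l - 1 / 2) * (\<Sum>i<m. 3 ^ i * \<bar>?d i\<bar>) \<le> (\<Sum>i<m. 3 ^ i * \<bar>?c i\<bar>)"
      using core_column_3 l by simp
    moreover have "1 / 2 * (\<Sum>i<m. 3 ^ i * \<bar>?d i\<bar>) \<le> (l - 1 / 2) * (\<Sum>i<m. 3 ^ i * \<bar>?d i\<bar>)"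
      using l by (intro mult_right_mono sum_nonneg) auto
    moreover have "(\<Sum>i<m. 3 ^ i * \<bar>?c i\<bar>) \<le> (\<Sum>i. 3 ^ (i + n) * \<bar>src (i + n)\<bar>)"
    proof -
      have "(\<Sum>i<m. 3 ^ i * \<bar>?c i\<bar>) = (\<Sum>i\<in>{n..<m}. 3 ^ i * \<bar>src i\<bar>)"
        by (rule sum.mono_neutral_cong_right) auto
      also have "\<dots> = (\<Sum>i<m - n. 3 ^ (i + n) * \<bar>src (i + n)\<bar>)"
        by (rule sum.reindex_bij_witness[of _ "\<lambda>i. i + n" "\<lambda>i. i - n"]) auto
      also have "\<dots> \<le> (\<Sum>i. 3 ^ (i + n) * \<bar>src (i + n)\<bar>)"
        by (rule sum_le_suminf[OF summable_ignore_initial_segment[OF ss]]) auto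
      finally show ?thesis .
    qed
    ultimately have "(\<Sum>i<m. 3 ^ i * \<bar>?d i\<bar>) \<le> e n" unfolding e_def by linarith
    moreover have "(\<Sum>i<K. 3 ^ i * \<bar>?d i\<bar>) \<le> (\<Sum>i<m. 3 ^ i * \<bar>?d i\<bar>)"
    proof -
      have "(\<Sum>i<K. 3 ^ i * \<bar>?d i\<bar>) = (\<Sum>i\<in>{..<K} \<inter> {..<m}. 3 ^ i * \<bar>?d i\<bar>)"
      proof (rule sum.mono_neutral_right)
        show "\<forall>i\<in>{..<K} - {..<K} \<inter> {..<m}. 3 ^ i * \<bar>?d i\<bar> = 0"
        proof
          fix i assume "i \<in> {..<K} - {..<K} \<inter> {..<m}"
          then have "m \<le> i" by auto
          then show "3 ^ i * \<bar>?d i\<bar> = 0" using that by (simp add: s0)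
        qed
      qed auto
      also have "\<dots> \<le> (\<Sum>i<m. 3 ^ i * \<bar>?d i\<bar>)" by (rule sum_mono2) auto
      finally show ?thesis .
    qed
    ultimately show ?thesis by linarith
  qed
  have c: "\<bar>s m i - s n i\<bar> \<le> e n" if "n \<le> m" for m n i
  proof -
    have "1 * \<bar>s m i - s n i\<bar> \<le> 3 ^ i * \<bar>s m i - s n i\<bar>" by (intro mult_right_mono) auto
    also have "\<dots> \<le> (\<Sum>k<Suc i. 3 ^ k * \<bar>s m k - s n k\<bar>)"
      by (rule member_le_sum) auto
    finally show ?thesis using d[OF that, of "Suc i"] by simp
  qed
  have "\<exists>a. (\<lambda>n. s n i) \<longlonglongrightarrow> a" for i
  proof -
    have "Cauchy (\<lambda>n. s n i)"
    proof (rule metric_CauchyI)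
      fix r :: real assume "0 < r"
      then obtain N where N: "e N < r / 2"
        using order_tendstoD(2)[OF elim half_gt_zero] unfolding eventually_sequentially by blast
      have "dist (s m i) (s n i) < r" if "N \<le> m" "N \<le> n" for m n
        using c[OF that(1), of i] c[OF that(2), of i] N unfolding dist_real_def by linarith
      then show "\<exists>M. \<forall>m\<ge>M. \<forall>n\<ge>M. dist (s m i) (s n i) < r" by blast
    qed
    then show ?thesis using Cauchy_convergent convergent_def by blast
  qed
  then obtain a where a: "\<And>i. (\<lambda>n. s n i) \<longlonglongrightarrow> a i" by metis
  have bound: "(\<Sum>i<K. 3 ^ i * \<bar>a i - s n i\<bar>) \<le> e n" for n K
  proof (rule LIMSEQ_le_const2)
    show "(\<lambda>m. \<Sum>i<K. 3 ^ i * \<bar>s m i - s n i\<bar>) \<longlonglongrightarrow> (\<Sum>i<K. 3 ^ i * \<bar>a i - s n i\<bar>)"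
      by (intro tendsto_intros a)
    show "\<exists>N. \<forall>m\<ge>N. (\<Sum>i<K. 3 ^ i * \<bar>s m i - s n i\<bar>) \<le> e n" using d by blast
  qed
  have "summable (\<lambda>i. 3 ^ i * \<bar>a i\<bar>)"
    by (rule summableI_nonneg_bounded[of _ "e 0"]) (use bound[of 0] s0[of 0] in auto)
  then show ?thesis using that[OF elim _ bound] by blast
qed

context leading_pair
begin

lemma log_lip_v: "log_lip v" by (rule log_lip_log_cone[OF v_cone])

lemma lam_eq: "lam = 1 + upper_mass v"
  using mass_gcd_op[OF tame_v] upper_mass_eq[OF tame_v] by (simp add: gcd_op_v mass_cmult mass_v)

lemma asymp_const_pos: "\<exists>\<psi>>0. asymp_coeff v (\<lambda>x. 1) \<psi>"
proof -
  have "log_lip (\<lambda>x. 1)" using log_lip_power[of 0] by simp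
  then obtain \<psi> where p: "asymp_coeff v (\<lambda>x. 1) \<psi>" using asymp_log_lip by blast
  have "0 < \<psi>" by (rule asymp_positive[OF tame_const _ _ p]) (auto simp: mass_const)
  then show ?thesis using p by blast
qed

lemma iter_cong:
  assumes "\<And>x. 0 < x \<Longrightarrow> x \<le> 2 \<Longrightarrow> f x = g x" "0 < x" "x \<le> 2"
  shows "(gcd_op ^^ m) f x = (gcd_op ^^ m) g x"
  using assms(2,3)
proof (induction m arbitrary: x)
  case (Suc m)
  then show ?case using gcd_op_cong[of "(gcd_op ^^ m) f" "(gcd_op ^^ m) g"] by simp
qed (use assms in auto)

lemma asymp_cong:
  assumes "asymp_coeff v f \<phi>" "\<And>x. 0 < x \<Longrightarrow> x \<le> 2 \<Longrightarrow> f x = g x"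
  shows "asymp_coeff v g \<phi>"
proof -
  have "(gcd_op ^^ m) f x = (gcd_op ^^ m) g x" if "x \<in> {0<..2}" for m x
    by (rule iter_cong[OF assms(2)]) (use that in auto)
  then show ?thesis using assms(1) unfolding asymp_coeff_def by simp
qed

text \<open>An eigenvector up to a constant is a genuine one: the asymptotic coefficient is multiplied
  by \<^term>\<open>lam\<close> under \<^const>\<open>gcd_op\<close>, and constants have a nonzero coefficient.\<close>

lemma eigen_proportional:
  assumes f: "tame f" and a: "asymp_coeff v f \<phi>"
    and T: "\<And>x. 0 < x \<Longrightarrow> x \<le> 2 \<Longrightarrow> gcd_op f x = lam * f x + \<delta>"
  shows "\<delta> = 0" "\<exists>k>0. \<forall>x. 0 < x \<longrightarrow> x \<le> 2 \<longrightarrow> k * f x = \<phi> * v x"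
proof -
  obtain \<psi> where \<psi>: "0 < \<psi>" "asymp_coeff v (\<lambda>x. 1) \<psi>" using asymp_const_pos by blast
  have "asymp_coeff v (\<lambda>x. lam * f x + \<delta> * 1) (lam * \<phi> + \<delta> * \<psi>)"
    by (intro asymp_add asymp_cmult a \<psi>(2) f tame_const tame_cmult)
  moreover have "asymp_coeff v (\<lambda>x. lam * f x + \<delta> * 1) (lam * \<phi>)"
    by (rule asymp_cong[OF asymp_gcd_op[OF f a]]) (simp add: T)
  ultimately have "lam * \<phi> + \<delta> * \<psi> = lam * \<phi>" by (rule asymp_unique)
  then show \<delta>: "\<delta> = 0" using \<psi>(1) by simp
  have itf: "(gcd_op ^^ m) f x = lam ^ m * f x" if "0 < x" "x \<le> 2" for m x
    using that
  proof (induction m arbitrary: x)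
    case (Suc m)
    have "gcd_op ((gcd_op ^^ m) f) = gcd_op (\<lambda>x. lam ^ m * f x)" by (rule gcd_op_cong) (rule Suc.IH)
    then show ?case using T[OF Suc.prems] \<delta> by (simp add: gcd_op_cmult[OF f])
  qed simp
  have itv: "(gcd_op ^^ m) v = (\<lambda>x. lam ^ m * v x)" for m
    by (induction m) (simp_all add: gcd_op_v gcd_op_cmult tame_v mult.assoc mult.left_commute)
  obtain \<kappa> where \<kappa>: "asymp_coeff v v \<kappa>" using asymp_log_lip[OF log_lip_v] by blast
  have k: "0 < \<kappa>" by (rule asymp_positive[OF tame_v _ _ \<kappa>]) (auto simp: mass_v intro: less_imp_le v_pos)
  have "\<kappa> * f x = \<phi> * v x" if x: "0 < x" "x \<le> 2" for x
  proof -
    have vx: "0 < v x" by (rule v_pos[OF x])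
    \<comment> \<open>Since T^m v = lam^m v, the coefficient \<kappa> is the limit of lam^m / M m.
      The same factor governs f, so one limit is computed in two ways.\<close>
    have "(\<lambda>m. lam ^ m * v x / M m * (f x / v x)) \<longlonglongrightarrow> \<kappa> * v x * (f x / v x)"
      using asymp_tendsto[OF \<kappa> x] unfolding itv by (rule tendsto_mult_right)
    moreover have "lam ^ m * v x / M m * (f x / v x) = (gcd_op ^^ m) f x / M m" for m
      using vx by (simp add: itf[OF x])
    moreover have "\<kappa> * v x * (f x / v x) = \<kappa> * f x" using vx by simp
    ultimately have "(\<lambda>m. (gcd_op ^^ m) f x / M m) \<longlonglongrightarrow> \<kappa> * f x" by (simp only:)
    then show ?thesis using asymp_tendsto[OF a x] LIMSEQ_unique by blast
  qed
  then show "\<exists>k>0. \<forall>x. 0 < x \<longrightarrow> x \<le> 2 \<longrightarrow> k * f x = \<phi> * v x" using k by blast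
qed

lemma series_of_v:
  "\<exists>c. (\<forall>t\<in>{0<..2}. v t = log_series c t) \<and> (\<forall>\<rho>\<in>{1..3}. c \<in> weighted_l1 \<rho>)"
  and max_eigenvalue_limit: "(\<lambda>n. max_eigenvalue (A_trunc n)) \<longlonglongrightarrow> lam"
proof -
  have l1: "1 / 4 < lam" "1 \<le> lam" "lam \<noteq> 1 / 2" using lambda_ge by auto
  have "\<forall>n. \<exists>a. core_solution n lam src a \<and> (\<forall>i\<ge>n. a i = 0)" using core_solution_exists[OF l1(1)] by blast
  then obtain s where s: "\<And>n. core_solution n lam src (s n)" "\<And>n i. n \<le> i \<Longrightarrow> s n i = 0" by metis
  obtain a e where e: "e \<longlonglongrightarrow> 0" and sa: "summable (\<lambda>i. 3 ^ i * \<bar>a i\<bar>)"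
    and ae: "\<And>n K. (\<Sum>i<K. 3 ^ i * \<bar>a i - s n i\<bar>) \<le> e n"
    using core_solution_limit[OF l1(2) s] by metis
  \<comment> \<open>These are the coordinates of an eigenvector with logarithmic coefficient 1; the
    entry at 0 is the constant term, which the first row forces.\<close>
  define c where "c = (\<lambda>k. if k = 0 then 1 / 2 - lam else a (k - 1))"
  have c3: "summable (\<lambda>k. 3 ^ k * \<bar>c k\<bar>)"
  proof -
    have "summable (\<lambda>i. 3 * (3 ^ i * \<bar>a i\<bar>))" by (rule summable_mult[OF sa])
    then have "summable (\<lambda>k. 3 ^ Suc k * \<bar>c (Suc k)\<bar>)" by (simp add: c_def mult.assoc)
    then show ?thesis by (simp only: summable_Suc_iff[of "\<lambda>k. 3 ^ k * \<bar>c k\<bar>"])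
  qed
  have c\<rho>: "summable (\<lambda>k. \<rho> ^ k * \<bar>c k\<bar>)" if "1 \<le> \<rho>" "\<rho> \<le> 3" for \<rho> :: real
    by (rule summable_comparison_test'[OF c3, of 0])
       (use that in \<open>auto simp: abs_mult intro!: mult_right_mono power_mono\<close>)
  have c1: "summable (\<lambda>k. \<bar>c k\<bar>)" using c\<rho>[of 1] by simp
  define f where "f = (\<lambda>x. 1 * ln x + (\<Sum>k. c k * (x - 1) ^ k))"
  define F where "F = (\<lambda>n x. ln x + ((1 / 2 - lam) + (\<Sum>i<n. s n i * (x - 1) ^ Suc i)))"
  have ft: "tame f" unfolding f_def by (rule tame_log_series[OF c1])
  have Ft: "tame (F n)" for n
    unfolding F_def
    by (intro tame_add tame_ln tame_const conjunct2[OF gcd_op_sum] tame_cmult tame_power)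
  have fF: "\<bar>f x - F n x\<bar> \<le> e n" if x: "0 < x" "x \<le> 2" for n x
  proof -
    have sx: "\<bar>x - 1\<bar> \<le> 1" using x by auto
    have lim: "(\<lambda>K. (\<Sum>k<Suc K. c k * (x - 1) ^ k)) \<longlonglongrightarrow> (\<Sum>k. c k * (x - 1) ^ k)"
      by (rule LIMSEQ_Suc[OF summable_LIMSEQ[OF l1_series_summable(2)[OF c1 sx]]])
    have eq: "(\<Sum>k<Suc K. c k * (x - 1) ^ k) = (1 / 2 - lam) + (\<Sum>i<K. a i * (x - 1) ^ Suc i)" for K
      by (subst sum.lessThan_Suc_shift) (simp add: c_def)
    have "\<bar>(\<Sum>i<K. a i * (x - 1) ^ Suc i) - (\<Sum>i<n. s n i * (x - 1) ^ Suc i)\<bar> \<le> e n" if "n \<le> K" for K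
    proof -
      have "(\<Sum>i<n. s n i * (x - 1) ^ Suc i) = (\<Sum>i<K. s n i * (x - 1) ^ Suc i)"
        by (rule sum.mono_neutral_left) (use that s(2) in auto)
      then have "\<bar>(\<Sum>i<K. a i * (x - 1) ^ Suc i) - (\<Sum>i<n. s n i * (x - 1) ^ Suc i)\<bar>
          = \<bar>\<Sum>i<K. (a i - s n i) * (x - 1) ^ Suc i\<bar>" by (simp add: left_diff_distrib sum_subtractf)
      also have "\<dots> \<le> (\<Sum>i<K. \<bar>(a i - s n i) * (x - 1) ^ Suc i\<bar>)" by (rule sum_abs)
      also have "\<dots> \<le> (\<Sum>i<K. 3 ^ i * \<bar>a i - s n i\<bar>)"
      proof (rule sum_mono)
        fix i
        have "\<bar>x - 1\<bar> ^ Suc i \<le> 1" by (rule power_le_one[OF abs_ge_zero sx])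
        also have "1 \<le> (3::real) ^ i" by (rule one_le_power) simp
        finally have "\<bar>a i - s n i\<bar> * \<bar>x - 1\<bar> ^ Suc i \<le> \<bar>a i - s n i\<bar> * 3 ^ i"
          by (rule mult_left_mono) (rule abs_ge_zero)
        then show "\<bar>(a i - s n i) * (x - 1) ^ Suc i\<bar> \<le> 3 ^ i * \<bar>a i - s n i\<bar>"
          by (simp only: abs_mult power_abs mult.commute)
      qed
      finally show ?thesis using ae[of n K] by linarith
    qed
    then have "\<bar>(\<Sum>k<Suc K. c k * (x - 1) ^ k) - ((1 / 2 - lam) + (\<Sum>i<n. s n i * (x - 1) ^ Suc i))\<bar> \<le> e n" if "n \<le> K" for K
      using that unfolding eq by simp
    then have "\<bar>(\<Sum>k. c k * (x - 1) ^ k) - ((1 / 2 - lam) + (\<Sum>i<n. s n i * (x - 1) ^ Suc i))\<bar> \<le> e n"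
      by (intro LIMSEQ_le_const2[OF tendsto_rabs[OF tendsto_diff[OF lim tendsto_const]]]) auto
    then show ?thesis by (simp add: f_def F_def)
  qed
  define \<delta> where "\<delta> = (\<lambda>n. (lam - 1 / 2) * (lam - eig_map n lam (s n)))"
  define R where "R = (\<lambda>n x. (\<Sum>r. A_entry (Suc r) 0 * (x - 1) ^ r) - (\<Sum>r<Suc n. A_entry (Suc r) 0 * (x - 1) ^ r))"
  have TF: "gcd_op (F n) x = lam * F n x + \<delta> n + R n x" if "0 < x" "x \<le> 2" for n x
    unfolding F_def \<delta>_def R_def by (rule gcd_op_log_polynomial[OF s(1) that l1(3)])
  have Flim: "(\<lambda>n. F n x) \<longlonglongrightarrow> f x" if x: "0 < x" "x \<le> 2" for x
  proof -
    have "(\<lambda>n. F n x - f x) \<longlonglongrightarrow> 0"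
      by (rule Lim_null_comparison[OF _ e]) (use fF[OF x] in \<open>simp add: abs_minus_commute\<close>)
    then show ?thesis by (simp add: LIM_zero_iff)
  qed
  have TFlim: "(\<lambda>n. gcd_op (F n) x) \<longlonglongrightarrow> gcd_op f x" if x: "0 < x" "x \<le> 2" for x
  proof -
    have b: "\<bar>gcd_op (F n) x - gcd_op f x\<bar> \<le> e n * gcd_op (\<lambda>t. 1) x" for n
    proof -
      have "\<bar>(gcd_op ^^ 1) (\<lambda>x. F n x - f x) x\<bar> \<le> (gcd_op ^^ 1) (\<lambda>x. e n * 1) x"
        by (rule iter_abs_le[OF tame_diff[OF Ft ft] tame_cmult[OF tame_const] _ x]) (use fF in \<open>simp add: abs_minus_commute\<close>)
      then show ?thesis unfolding iter_diff[OF Ft ft] iter_cmult[OF tame_const] by simp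
    qed
    have "(\<lambda>n. e n * gcd_op (\<lambda>t. 1) x) \<longlonglongrightarrow> 0" using tendsto_mult_right[OF e] by simp
    then have "(\<lambda>n. gcd_op (F n) x - gcd_op f x) \<longlonglongrightarrow> 0"
      by (rule Lim_null_comparison[rotated]) (use b in simp)
    then show ?thesis by (simp add: LIM_zero_iff)
  qed
  have Rlim: "(\<lambda>n. R n x) \<longlonglongrightarrow> 0" if x: "0 < x" "x \<le> 2" for x
  proof -
    have "\<bar>x - 1\<bar> \<le> 1" using x by auto
    note l1_series_summable(2)[OF log_column_summable1 this]
    from tendsto_diff[OF tendsto_const LIMSEQ_Suc[OF summable_LIMSEQ[OF this]], of "\<Sum>r. A_entry (Suc r) 0 * (x - 1) ^ r"]
    show ?thesis by (simp add: R_def)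
  qed
  \<comment> \<open>\<delta> does not depend on x while the limit formally does; hence T f - lam f
    is one and the same constant at every point.\<close>
  have dlim: "\<delta> \<longlonglongrightarrow> gcd_op f x - lam * f x - 0" if x: "0 < x" "x \<le> 2" for x
  proof -
    have "(\<lambda>n. gcd_op (F n) x - lam * F n x - R n x) \<longlonglongrightarrow> gcd_op f x - lam * f x - 0"
      by (intro tendsto_diff tendsto_mult tendsto_const TFlim Flim Rlim x)
    then show ?thesis by (simp add: TF[OF x])
  qed
  define d where "d = lim \<delta>"
  have dd: "gcd_op f x = lam * f x + d" if "0 < x" "x \<le> 2" for x
    using limI[OF dlim[OF that]] by (simp add: d_def)
  obtain \<phi> where \<phi>: "asymp_coeff v f \<phi>"
    using asymp_approx[OF ft] log_series_approx[OF c1, of _ 1] unfolding f_def by blast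
  note d0 = eigen_proportional(1)[OF ft \<phi> dd]
  have "\<delta> \<longlonglongrightarrow> 0" using dlim[of 1] dd[of 1] d0 by simp
  then have "(\<lambda>n. lam - \<delta> n / (lam - 1 / 2)) \<longlonglongrightarrow> lam - 0 / (lam - 1 / 2)"
    using l1(3) by (intro tendsto_intros) auto
  then have "(\<lambda>n. eig_map n lam (s n)) \<longlonglongrightarrow> lam" using l1(3) by (simp add: \<delta>_def)
  then show "(\<lambda>n. max_eigenvalue (A_trunc n)) \<longlonglongrightarrow> lam"
    by (rule max_eigenvalue_tendsto[OF lambda_ge s(1)])
  obtain k where k: "0 < k" "\<And>x. 0 < x \<Longrightarrow> x \<le> 2 \<Longrightarrow> k * f x = \<phi> * v x"
    using eigen_proportional(2)[OF ft \<phi> dd] by blast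
  have "\<phi> \<noteq> 0"
  proof
    assume "\<phi> = 0"
    then have f0: "f x = 0" if "0 < x" "x \<le> 2" for x using k(2)[OF that] k(1) by simp
    define B where "B = (\<Sum>k. \<bar>c k\<bar>)"
    have B: "0 \<le> B" unfolding B_def by (rule suminf_nonneg[OF c1]) simp
    let ?x = "exp (- B - 1)"
    have "?x \<le> exp 0" by (subst exp_le_cancel_iff) (use B in simp)
    then have "?x \<le> 2" unfolding exp_zero by linarith
    note x = exp_gt_zero[of "- B - 1"] this
    have "\<bar>\<Sum>k. c k * (?x - 1) ^ k\<bar> \<le> B"
      using l1_series_tail[OF c1, of "?x - 1" 0] x by (simp add: B_def abs_le_iff)
    moreover have "f ?x = - B - 1 + (\<Sum>k. c k * (?x - 1) ^ k)" by (simp add: f_def)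
    ultimately show False using f0[OF x] by simp
  qed
  define g where "g = (\<lambda>i. k / \<phi> * (case i of 0 \<Rightarrow> 1 | Suc j \<Rightarrow> c j))"
  have "v t = log_series g t" if t: "t \<in> {0<..2}" for t
  proof -
    have "\<bar>t - 1\<bar> \<le> 1" using t by auto
    note st = l1_series_summable(2)[OF c1 this]
    have "v t = k / \<phi> * f t" using k(2)[of t] t \<open>\<phi> \<noteq> 0\<close> by (simp add: field_simps)
    also have "\<dots> = k / \<phi> * ln t + (\<Sum>j. k / \<phi> * (c j * (t - 1) ^ j))"
      by (simp only: f_def distrib_left suminf_mult[OF st] mult_1)
    also have "\<dots> = log_series g t" by (simp add: log_series_def g_def mult.assoc)
    finally show ?thesis .
  qed
  moreover have "g \<in> weighted_l1 \<rho>" if \<rho>: "\<rho> \<in> {1..3}" for \<rho>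
  proof -
    have "summable (\<lambda>j. \<bar>k / \<phi>\<bar> * \<rho> * (\<rho> ^ j * \<bar>c j\<bar>))" using \<rho> by (intro summable_mult c\<rho>) auto
    then have "summable (\<lambda>j. \<rho> ^ Suc j * \<bar>g (Suc j)\<bar>)" by (simp add: g_def abs_mult mult_ac)
    then have "summable (\<lambda>j. \<rho> ^ j * \<bar>g j\<bar>)" by (simp only: summable_Suc_iff[of "\<lambda>j. \<rho> ^ j * \<bar>g j\<bar>"])
    then show ?thesis by (simp add: weighted_l1_def)
  qed
  ultimately show "\<exists>c. (\<forall>t\<in>{0<..2}. v t = log_series c t) \<and> (\<forall>\<rho>\<in>{1..3}. c \<in> weighted_l1 \<rho>)" by blast
qed

end

section \<open>Densities and their normalised iterates\<close>

lemma tame_lborel: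
  assumes "tame f"
  shows "set_integrable lborel {0<..2} f" "(LBINT x:{0<..2}. f x) = mass f"
proof -
  have "f absolutely_integrable_on {0<..2}"
    by (rule set_integrable_subset[OF tame_abs_integrable[OF assms]]) auto
  moreover have "(\<lambda>x. indicator {0<..2} x *\<^sub>R f x) \<in> borel_measurable borel"
    by (rule borel_measurable_continuous_on_indicator) (use assms in \<open>auto simp: tame_def\<close>)
  ultimately show i: "set_integrable lborel {0<..2} f"
    unfolding set_integrable_def by (simp add: integrable_completion)
  have "(LBINT x:{0<..2}. f x) = integral {0<..2} f" by (rule set_borel_integral_eq_integral(2)[OF i])
  also have "\<dots> = mass f" unfolding mass_def
    by (rule integral_subset_negligible) (auto intro: negligible_subset[of "{0}"])
  finally show "(LBINT x:{0<..2}. f x) = mass f" .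
qed

lemma upper_mass_cong: "(\<And>x. 0 < x \<Longrightarrow> x \<le> 2 \<Longrightarrow> f x = g x) \<Longrightarrow> upper_mass f = upper_mass g"
  unfolding upper_mass_def by (rule set_lebesgue_integral_cong) auto

text \<open>By \<open>mass_gcd_op\<close> the factor 1 + C_s is the ratio of the masses of two
  consecutive linear iterates, so the normalisations telescope. Values of the given functions
  outside (0, 2] are arbitrary and never enter.\<close>

lemma normalized_iterates:
  assumes t: "tame f0" and nn: "\<And>x. 0 < x \<Longrightarrow> x \<le> 2 \<Longrightarrow> 0 \<le> f0 x" and m1: "mass f0 = 1"
    and f0: "\<And>x. 0 < x \<Longrightarrow> x \<le> 2 \<Longrightarrow> f 0 x = f0 x"
    and step: "\<And>s x. 0 < x \<Longrightarrow> x \<le> 2 \<Longrightarrow> (1 + upper_mass (f s)) * f (Suc s) x = transfer_op (f s) x"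
  shows "0 < x \<Longrightarrow> x \<le> 2 \<Longrightarrow> f s x = (gcd_op ^^ s) f0 x / mass ((gcd_op ^^ s) f0)"
proof (induction s arbitrary: x)
  case 0
  then show ?case by (simp add: f0 m1)
next
  case (Suc s)
  let ?h = "(gcd_op ^^ s) f0"
  have th: "tame ?h" by (rule tame_funpow[OF t])
  have mh: "0 < mass ?h" using mass_funpow_bounds(1)[OF t nn, of s] m1 by simp
  have mS: "0 < mass (gcd_op ?h)" using mass_funpow_bounds(1)[OF t nn, of "Suc s"] m1 by simp
  have eq: "f s y = 1 / mass ?h * ?h y" if "0 < y" "y \<le> 2" for y using Suc.IH[OF that] by simp
  have "gcd_op (f s) x = 1 / mass ?h * gcd_op ?h x"
    using gcd_op_cong[of "f s" "\<lambda>y. 1 / mass ?h * ?h y", OF eq] gcd_op_cmult[OF th, of "1 / mass ?h"] by simp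
  moreover have "upper_mass (f s) = 1 / mass ?h * (mass (gcd_op ?h) - mass ?h)"
  proof -
    have "upper_mass (f s) = upper_mass (\<lambda>y. 1 / mass ?h * ?h y)" by (rule upper_mass_cong[OF eq])
    also have "\<dots> = mass (gcd_op (\<lambda>y. 1 / mass ?h * ?h y)) - mass (\<lambda>y. 1 / mass ?h * ?h y)"
      by (simp only: mass_gcd_op[OF tame_cmult[OF th]] upper_mass_eq[OF tame_cmult[OF th]])
    finally show ?thesis unfolding gcd_op_cmult[OF th] mass_cmult by (simp add: right_diff_distrib)
  qed
  then have "1 + upper_mass (f s) = mass (gcd_op ?h) / mass ?h" using mh by (simp add: field_simps)
  moreover have "gcd_op (f s) x = transfer_op (f s) x" using Suc.prems by (simp add: gcd_op_def)
  ultimately have "mass (gcd_op ?h) / mass ?h * f (Suc s) x = 1 / mass ?h * gcd_op ?h x"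
    using step[OF Suc.prems, of s] by simp
  then show ?case using mh mS by (simp add: field_simps)
qed

context leading_pair
begin

text \<open>Integrating the asymptotic estimate gives the limit \<phi> for the masses too, so the
  quotient tends to v. The estimate carries the weight \<open>wt\<close>, unbounded at 0 but at most
  \<open>wt y\<close> on [y, 2]; hence uniformity away from 0.\<close>

lemma normalized_iterates_tendsto:
  assumes t: "tame f0" and nn: "\<And>x. 0 < x \<Longrightarrow> x \<le> 2 \<Longrightarrow> 0 \<le> f0 x" and m1: "mass f0 = 1"
    and a: "asymp_coeff v f0 \<phi>" and y: "0 < y" "y < 2"
  shows "(\<lambda>s. SUP t\<in>{y..2}. \<bar>(gcd_op ^^ s) f0 t / mass ((gcd_op ^^ s) f0) - v t\<bar>) \<longlonglongrightarrow> 0"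
proof (rule LIMSEQ_I)
  fix r :: real assume r: "0 < r"
  have \<phi>: "0 < \<phi>" by (rule asymp_positive[OF t nn _ a]) (use m1 in auto)
  obtain B where B: "0 \<le> B" "\<And>x. 0 < x \<Longrightarrow> x \<le> 2 \<Longrightarrow> \<bar>v x\<bar> \<le> B * wt x"
    using tame_obtain[OF tame_v] by metis
  define W where "W = mass wt"
  have W: "0 < W" using mass_wt_bounds by (simp add: W_def)
  have wy: "0 < wt y" by (rule wt_pos) (use y in auto)
  define C where "C = (1 + W * B) * wt y / (\<phi> / 2)"
  have C: "0 < C" unfolding C_def using W B(1) wy \<phi> by (intro divide_pos_pos mult_pos_pos add_pos_nonneg) auto
  \<comment> \<open>The first bound keeps the mass ratio above \<phi> / 2, the second makes the
    final error smaller than r.\<close>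
  define e where "e = min (\<phi> / (2 * W)) (r / (2 * C))"
  have e: "0 < e" "e * W \<le> \<phi> / 2" "e * C < r"
  proof -
    show "0 < e" using \<phi> W r C by (simp add: e_def)
    have "e * W \<le> \<phi> / (2 * W) * W" using W by (intro mult_right_mono) (auto simp: e_def)
    then show "e * W \<le> \<phi> / 2" using W by simp
    have "e * C \<le> r / (2 * C) * C" using C by (intro mult_right_mono) (auto simp: e_def)
    then show "e * C < r" using C r by simp
  qed
  obtain N where N: "\<And>m x. m \<ge> N \<Longrightarrow> 0 < x \<Longrightarrow> x \<le> 2 \<Longrightarrow> \<bar>(gcd_op ^^ m) f0 x / M m - \<phi> * v x\<bar> \<le> e * wt x"
    using asymp_coeffD[OF a e(1)] unfolding eventually_sequentially by fastforce
  have main: "\<bar>(gcd_op ^^ m) f0 x / mass ((gcd_op ^^ m) f0) - v x\<bar> \<le> e * C"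
    if m: "m \<ge> N" and x: "y \<le> x" "x \<le> 2" for m x
  proof -
    let ?h = "(gcd_op ^^ m) f0"
    have x0: "0 < x" using x y by simp
    have M0: "0 < M m" by (rule mass_iter_wt_pos)
    define \<rho> where "\<rho> = mass ?h / M m"
    have th: "tame ?h" by (rule tame_funpow[OF t])
    have N': "1 / M m * ?h x - \<phi> * v x \<le> e * wt x" "- e * wt x \<le> 1 / M m * ?h x - \<phi> * v x"
      if "0 < x" "x \<le> 2" for x
      using N[OF m that] by (auto simp: abs_le_iff)
    have td: "tame (\<lambda>x. 1 / M m * ?h x - \<phi> * v x)" by (intro tame_diff tame_cmult th tame_v)
    have "mass (\<lambda>x. 1 / M m * ?h x - \<phi> * v x) \<le> mass (\<lambda>x. e * wt x)"
      by (rule mass_mono[OF td tame_cmult[OF tame_wt] N'(1)])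
    moreover have "mass (\<lambda>x. - e * wt x) \<le> mass (\<lambda>x. 1 / M m * ?h x - \<phi> * v x)"
      by (rule mass_mono[OF tame_cmult[OF tame_wt] td N'(2)])
    ultimately have \<rho>: "\<bar>\<rho> - \<phi>\<bar> \<le> e * W"
      unfolding mass_cmult mass_diff[OF tame_cmult[OF th] tame_cmult[OF tame_v]]
      by (simp add: mass_v \<rho>_def W_def abs_le_iff)
    then have \<rho>2: "\<phi> / 2 \<le> \<rho>" using e(2) by linarith
    have "\<bar>\<rho> - \<phi>\<bar> * \<bar>v x\<bar> \<le> (e * W) * (B * wt x)"
      by (rule mult_mono[OF \<rho> B(2)]) (use e W x x0 in auto)
    then have "\<bar>\<phi> * v x - \<rho> * v x\<bar> \<le> (e * W) * (B * wt x)"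
      by (simp add: abs_minus_commute flip: abs_mult left_diff_distrib)
    moreover have "(e * W) * (B * wt x) + e * wt x = e * ((1 + W * B) * wt x)" by (simp add: algebra_simps)
    ultimately have 1: "\<bar>?h x / M m - \<rho> * v x\<bar> \<le> e * ((1 + W * B) * wt x)"
      using N[OF m x0 x(2)] by linarith
    have "A / (\<rho> * K) - w = (A / K - \<rho> * w) / \<rho>" for A K w
      using \<rho>2 \<phi> by (simp add: diff_divide_distrib mult.commute)
    moreover have "mass ?h = \<rho> * M m" using M0 by (simp add: \<rho>_def)
    ultimately have "?h x / mass ?h - v x = (?h x / M m - \<rho> * v x) / \<rho>" by simp
    then have "\<bar>?h x / mass ?h - v x\<bar> = \<bar>?h x / M m - \<rho> * v x\<bar> / \<rho>"
      using \<rho>2 \<phi> by (simp add: abs_divide)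
    also have "\<dots> \<le> e * ((1 + W * B) * wt y) / (\<phi> / 2)"
    proof (rule frac_le)
      have "wt x \<le> wt y" using x y x0 by (simp add: wt_def)
      then have "e * ((1 + W * B) * wt x) \<le> e * ((1 + W * B) * wt y)"
        using e W B(1) by (intro mult_left_mono) auto
      then show "\<bar>?h x / M m - \<rho> * v x\<bar> \<le> e * ((1 + W * B) * wt y)" using 1 by linarith
      show "0 \<le> e * ((1 + W * B) * wt y)" using e W B(1) wy by (intro mult_nonneg_nonneg) auto
    qed (use \<rho>2 \<phi> in auto)
    also have "\<dots> = e * C" by (simp add: C_def)
    finally show ?thesis .
  qed
  have "norm ((SUP t\<in>{y..2}. \<bar>(gcd_op ^^ m) f0 t / mass ((gcd_op ^^ m) f0) - v t\<bar>) - 0) < r" if m: "m \<ge> N" for m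
  proof -
    let ?g = "\<lambda>t. \<bar>(gcd_op ^^ m) f0 t / mass ((gcd_op ^^ m) f0) - v t\<bar>"
    have ne: "{y..2} \<noteq> {}" using y by simp
    have up: "(SUP t\<in>{y..2}. ?g t) \<le> e * C" by (rule cSUP_least[OF ne]) (use main[OF m] in auto)
    have "0 \<le> ?g 2" by simp
    also have "?g 2 \<le> (SUP t\<in>{y..2}. ?g t)"
      by (rule cSUP_upper) (use y main[OF m] in \<open>auto intro!: bdd_aboveI2[of _ _ "e * C"]\<close>)
    finally show ?thesis using up e(3) by simp
  qed
  then show "\<exists>no. \<forall>n\<ge>no. norm ((SUP t\<in>{y..2}. \<bar>(gcd_op ^^ n) f0 t / mass ((gcd_op ^^ n) f0) - v t\<bar>) - 0) < r" by blast
qed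

end

theorem corollary5p9:
  shows "\<exists>(fstar :: real \<Rightarrow> real) (cstar :: nat \<Rightarrow> real).
      prob_density_on {0<..2} fstar \<and>
      (\<forall>t\<in>{0<..2}. fstar t = log_series cstar t) \<and>
      (\<forall>\<rho>\<in>{1..3}. cstar \<in> weighted_l1 \<rho>) \<and>
      (\<forall>x\<in>{0<..2}. (1 + upper_mass fstar) * fstar x = transfer_op fstar x) \<and>
      (\<lambda>n. max_eigenvalue (A_trunc n)) \<longlonglongrightarrow> 1 + upper_mass fstar \<and>
      (\<forall>(f :: nat \<Rightarrow> real \<Rightarrow> real) (c :: nat \<Rightarrow> real).
         prob_density_on {0<..2} (f 0) \<and>
         c \<in> weighted_l1 1 \<and>
         (\<forall>t\<in>{0<..2}. f 0 t = log_series c t) \<and>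
         (\<forall>s. \<forall>x\<in>{0<..2}. (1 + upper_mass (f s)) * f (Suc s) x = transfer_op (f s) x) \<longrightarrow>
         (\<forall>y. 0 < y \<and> y < 2 \<longrightarrow>
            (\<lambda>s. SUP t\<in>{y..2}. \<bar>f s t - fstar t\<bar>) \<longlonglongrightarrow> 0))"
proof -
  obtain v lam where "leading_pair v lam" using leading_pair_exists by blast
  then interpret leading_pair v lam .
  obtain cstar where cstar: "\<forall>t\<in>{0<..2}. v t = log_series cstar t" "\<forall>\<rho>\<in>{1..3}. cstar \<in> weighted_l1 \<rho>"
    using series_of_v by blast
  have dens: "prob_density_on {0<..2} v"
    using tame_lborel[OF tame_v] v_pos by (auto simp: prob_density_on_def mass_v intro: less_imp_le)
  have eigen: "\<forall>x\<in>{0<..2}. (1 + upper_mass v) * v x = transfer_op v x"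
  proof
    fix x :: real assume "x \<in> {0<..2}"
    then have "gcd_op v x = transfer_op v x" by (simp add: gcd_op_def)
    then show "(1 + upper_mass v) * v x = transfer_op v x" by (simp add: gcd_op_v lam_eq)
  qed
  have conv: "(\<lambda>s. SUP t\<in>{y..2}. \<bar>f s t - v t\<bar>) \<longlonglongrightarrow> 0"
    if d: "prob_density_on {0<..2} (f 0)" and c: "c \<in> weighted_l1 1"
      and ser: "\<forall>t\<in>{0<..2}. f 0 t = log_series c t"
      and step: "\<forall>s. \<forall>x\<in>{0<..2}. (1 + upper_mass (f s)) * f (Suc s) x = transfer_op (f s) x"
      and y: "0 < y" "y < 2" for f :: "nat \<Rightarrow> real \<Rightarrow> real" and c y
  proof -
    have c1: "summable (\<lambda>k. \<bar>c (Suc k)\<bar>)"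
      using c summable_Suc_iff[of "\<lambda>k. \<bar>c k\<bar>"] by (simp add: weighted_l1_def)
    define h where "h = (\<lambda>x. c 0 * ln x + (\<Sum>k. c (Suc k) * (x - 1) ^ k))"
    have fh: "f 0 x = h x" if "0 < x" "x \<le> 2" for x
      using ser that by (simp add: h_def log_series_def)
    have th: "tame h" unfolding h_def by (rule tame_log_series[OF c1])
    have tf: "tame (f 0)" by (rule tame_cong[OF th]) (use fh in simp)
    have nn: "0 \<le> f 0 x" if "0 < x" "x \<le> 2" for x using d that by (simp add: prob_density_on_def)
    have m1: "mass (f 0) = 1" using d tame_lborel(2)[OF tf] by (simp add: prob_density_on_def)
    have "\<exists>\<phi>. asymp_coeff v h \<phi>"
      by (rule asymp_approx[OF th]) (use log_series_approx[OF c1] in \<open>simp add: h_def\<close>)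
    then obtain \<phi> where "asymp_coeff v h \<phi>" by blast
    then have a: "asymp_coeff v (f 0) \<phi>" by (rule asymp_cong) (use fh in simp)
    have it: "f s x = (gcd_op ^^ s) (f 0) x / mass ((gcd_op ^^ s) (f 0))" if "0 < x" "x \<le> 2" for s x
      by (rule normalized_iterates[where f = f, OF tf nn m1 refl _ that]) (use step in auto)
    have "(SUP t\<in>{y..2}. \<bar>f s t - v t\<bar>) = (SUP t\<in>{y..2}. \<bar>(gcd_op ^^ s) (f 0) t / mass ((gcd_op ^^ s) (f 0)) - v t\<bar>)" for s
      by (rule SUP_cong[OF refl]) (use it[of _ s] y in auto)
    then show ?thesis using normalized_iterates_tendsto[OF tf nn m1 a y] by simp
  qed
  show ?thesis
    using dens cstar eigen max_eigenvalue_limit conv unfolding lam_eq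
    by (intro exI[of _ v] exI[of _ cstar] conjI allI impI) (blast, blast, blast, blast, blast, elim conjE, blast)
qed

end
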